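(* Let $n\ge 3$ and let $(M^n,g)$ be an asymptotically flat manifold with a non-compact boundary $\partial M$ (with decay rate $\tau>\frac{n-2}{2}$), whose scalar curvature $R$ is integrable on $M$ and whose boundary mean curvature $H$ is integrable on $\partial M$. Then $$m_{\mathrm{ADM}} = -c_n \lim_{r\to\infty}\left[\int_{\Sigma_r^+} G(X,\nu)\,\mathrm{d}\sigma + \int_{\partial\Sigma_r^+} (A-Hg)(X,\vartheta)\,\mathrm{d}\theta\right],\qquad c_n=\frac{1}{(n-2)(n-1)\omega_{n-1}}.$$
   Context: Notation: $\mathbb{R}^n_+=\{x\in\mathbb{R}^n: x_1\ge 0\}$, $\bar B_1^+(0)=\{x\in\mathbb{R}^n_+:|x|\le 1\}$. Indices $i,j,k,l$ range over $1,\dots,n$ and $a,b$ range over $2,\dots,n$; repeated indices are summed; a comma denotes partial differentiation in the coordinates $x$. Asymptotically flat: a Riemannian manifold $(M^n,g)$ with non-compact boundary $\partial M$ is asymptotically flat with decay rate $\tau>\frac{n-2}{2}$ if there are a compact set $K\subset M$ and a diffeomorphism $\Psi:M\setminus K\to\mathbb{R}^n_+\setminus\bar B_1^+(0)$ such that, in the induced coordinates $x=(x_1,\dots,x_n)$ with $r=|x|$, $|g_{ij}-\delta_{ij}|+r|g_{ij,k}|+r^2|g_{ij,kl}|=o(r^{-\tau})$ as $r\to\infty$. Along $\partial M$ (where $x_1=0$) the $\partial_a$ span $T\partial M$ and $\partial_1$ points into $M$. ADM mass: with $S^{n-1}_{r,+}=\{|x|=r\}\subset M$ the coordinate hemisphere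 of radius $r$, $$m_{\mathrm{ADM}}=\lim_{r\to\infty} b_n\left\{\int_{S^{n-1}_{r,+}}(g_{ij,j}-g_{jj,i})\bar\nu^i\,\mathrm{d}\bar\sigma+\int_{\partial S^{n-1}_{r,+}} g_{a1}\bar\vartheta^a\,\mathrm{d}\bar\theta\right\},\qquad b_n=\frac{1}{2(n-1)\omega_{n-1}},$$ where $\bar\nu$ is the Euclidean outward unit normal to the hemisphere, $\bar\vartheta$ is the Euclidean outward unit co-normal of $\partial S^{n-1}_{r,+}$ in $\partial M$, the barred measures are Euclidean, and $\omega_{n-1}$ is the volume of the standard unit $(n-1)$-sphere. The limit exists when $R\in L^1(M)$ and $H\in L^1(\partial M)$. In the claim: $\Sigma_r^+=\{|x|=r\}$ is the coordinate hemisphere of radius $r$; $\Pi_r$ is the part of $\partial M$ enclosed by $\partial \Sigma_r^+$ (the points of $\partial M$ with $|x|\le r$, together with $\partial M\cap K$); $X=x_i\partial_i$ is the coordinate position vector field; $\nu$ is the $g$-unit normal of $\Sigma_r^+$ pointing towards infinity; $\vartheta$ is the $g$-unit normal of $\partial\Sigma_r^+=\partial\Pi_r$ in $\partial M$ pointing out of $\Pi_r$; $\mathrm{d}\sigma$ and $\mathrm{d}\theta$ are the $(n-1)$- and $(n-2)$-dimensional volume elements induced by $g$; $G=\mathrm{Rc}-\frac12 Rg$ is the Einstein tensor of $g$; $\mu$ is the outward $g$-unit normal of $\partial M$ in $M$; $A(Y,Z)=g(\nabla_Y\mu,Z)$ is the second fundamental form of $\partial M$, and $H$ is its trace with respect to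 the induced metric. *)

theory Defs
  imports "HOL-Analysis.Analysis" "HOL-Library.Landau_Symbols"
begin

section \<open>Differentiation on subsets of Euclidean space\<close>

text \<open>
  Partial derivative in the \<open>i\<close>-th coordinate, taken within \<open>S\<close>.  For relatively open subsets of a
  half-space this is the usual partial derivative at interior points and, in the normal
  direction, the one-sided one at boundary points.
\<close>

definition partial_deriv ::
    "(real^'n) set \<Rightarrow> 'n::finite \<Rightarrow> (real^'n \<Rightarrow> real) \<Rightarrow> real^'n \<Rightarrow> real" where
  "partial_deriv S i f x =
     vector_derivative (\<lambda>t. f (x + t *\<^sub>R axis i 1)) (at 0 within {t. x + t *\<^sub>R axis i 1 \<in> S})"

primrec Ck_on :: "nat \<Rightarrow> (real^'n) set \<Rightarrow> (real^'n::finite \<Rightarrow> real) \<Rightarrow> bool" where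
  "Ck_on 0 S f \<longleftrightarrow> continuous_on S f"
| "Ck_on (Suc k) S f \<longleftrightarrow> f differentiable_on S \<and> (\<forall>i. Ck_on k S (partial_deriv S i f))"

definition smooth_on :: "(real^'n) set \<Rightarrow> (real^'n::finite \<Rightarrow> real) \<Rightarrow> bool" where
  "smooth_on S f \<longleftrightarrow> (\<forall>k. Ck_on k S f)"

section \<open>Riemannian geometry in coordinates\<close>

text \<open>
  A metric in coordinates is a matrix-valued function \<open>g\<close> on a set \<open>S\<close>; the set only
  matters for the (possibly one-sided) derivatives.
\<close>

definition form :: "real^'n^'n \<Rightarrow> real^'n \<Rightarrow> real^'n::finite \<Rightarrow> real" where
  "form m u v = u \<bullet> (m *v v)"

definition christoffel ::
    "(real^'n) set \<Rightarrow> (real^'n \<Rightarrow> real^'n^'n) \<Rightarrow> 'n::finite \<Rightarrow> 'n \<Rightarrow> 'n \<Rightarrow> real^'n \<Rightarrow> real" where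
  "christoffel S g k i j x =
     (1/2) * (\<Sum>l\<in>UNIV. matrix_inv (g x) $ k $ l *
        (partial_deriv S i (\<lambda>y. g y $ j $ l) x + partial_deriv S j (\<lambda>y. g y $ i $ l) x
          - partial_deriv S l (\<lambda>y. g y $ i $ j) x))"

text \<open>Sign convention: round spheres have positive Ricci curvature.\<close>

definition ricci ::
    "(real^'n) set \<Rightarrow> (real^'n \<Rightarrow> real^'n^'n) \<Rightarrow> real^'n \<Rightarrow> real^'n^'n::finite" where
  "ricci S g x = (\<chi> i j. \<Sum>k\<in>UNIV.
       partial_deriv S k (christoffel S g k i j) x - partial_deriv S i (christoffel S g k k j) x
       + (\<Sum>l\<in>UNIV. christoffel S g k k l x * christoffel S g l i j x
                   - christoffel S g k i l x * christoffel S g l k j x))"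

definition scalar_curv ::
    "(real^'n) set \<Rightarrow> (real^'n \<Rightarrow> real^'n^'n) \<Rightarrow> real^'n::finite \<Rightarrow> real" where
  "scalar_curv S g x = (\<Sum>i\<in>UNIV. \<Sum>j\<in>UNIV. matrix_inv (g x) $ i $ j * ricci S g x $ i $ j)"

definition einstein ::
    "(real^'n) set \<Rightarrow> (real^'n \<Rightarrow> real^'n^'n) \<Rightarrow> real^'n \<Rightarrow> real^'n^'n::finite" where
  "einstein S g x = ricci S g x - (scalar_curv S g x / 2) *\<^sub>R g x"

text \<open>
  The \<open>m\<close>-unit normal of the hyperplane Euclidean-orthogonal to \<open>d\<close>, on the side of \<open>d\<close>.
\<close>

definition unit_normal :: "real^'n^'n \<Rightarrow> real^'n \<Rightarrow> real^'n::finite" where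
  "unit_normal m d =
     (THE v. form m v v = 1 \<and> (\<forall>w. w \<bullet> d = 0 \<longrightarrow> form m v w = 0) \<and> v \<bullet> d > 0)"

text \<open>
  The ratio, on the hyperplane Euclidean-orthogonal to \<open>d\<close>, between the volume element induced
  by \<open>m\<close> and the Euclidean one: the square root of the Gram determinant of \<open>m\<close> in a
  Euclidean-orthonormal basis of the hyperplane (it does not depend on the basis).
\<close>

definition induced_density :: "real^'n^'n \<Rightarrow> real^'n::finite \<Rightarrow> real" where
  "induced_density m d =
     (let B = (SOME B. pairwise orthogonal B \<and> (\<forall>v\<in>B. norm v = 1) \<and> span B = {w. w \<bullet> d = 0})
      in sqrt (\<Sum>p | p permutes B. of_int (sign p) * (\<Prod>v\<in>B. form m v (p v))))"

text \<open>
  Euclidean surface measure of the sphere of radius \<open>r\<close> about the origin (a Borel measure on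
  the whole space, concentrated on the sphere): the cone measure, scaled so that Lebesgue measure
  is \<open>dr d\<sigma>\<close> in polar coordinates.
\<close>

definition sphere_measure :: "real \<Rightarrow> 'a::euclidean_space measure" where
  "sphere_measure r = scale_measure (ennreal (real DIM('a) * r ^ (DIM('a) - 1)))
     (distr (restrict_space lborel (cball 0 1)) borel (\<lambda>x. r *\<^sub>R sgn x))"

section \<open>The half-space and its boundary hyperplane\<close>

text \<open>
  The model space of dimension \<open>n = CARD('m) + 1\<close> has index type \<open>'m option\<close>: \<open>None\<close> stands for
  the first (normal) coordinate \<open>1\<close>, and \<open>Some a\<close> for the tangential coordinates
  \<open>a = 2, \<dots>, n\<close>.  The boundary hyperplane is identified with \<open>real^'m\<close> via \<open>bdry_pt\<close>.
\<close>

definition half_space :: "(real^('m::finite option)) set" where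
  "half_space = {x. x $ None \<ge> 0}"

definition end_region :: "(real^('m::finite option)) set" where
  "end_region = half_space - cball 0 1"

definition bdry_pt :: "real^'m::finite \<Rightarrow> real^('m option)" where
  "bdry_pt y = (\<chi> i. case i of None \<Rightarrow> 0 | Some a \<Rightarrow> y $ a)"

definition tang :: "real^('m::finite option)^('m option) \<Rightarrow> real^'m^'m" where
  "tang m = (\<chi> a b. m $ Some a $ Some b)"

text \<open>The outward unit normal \<open>\<mu>\<close> and \<open>A(\<partial>\<^sub>a, \<partial>\<^sub>b) = g(\<nabla>\<^sub>a \<mu>, \<partial>\<^sub>b)\<close> along the boundary
  hyperplane; only values of \<open>\<mu>\<close> on that hyperplane enter.\<close>

definition outward_normal :: "real^('m::finite option)^('m option) \<Rightarrow> real^('m option)" where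
  "outward_normal m = unit_normal m (- axis None 1)"

definition second_ff ::
    "(real^('m option)) set \<Rightarrow> (real^('m option) \<Rightarrow> real^('m option)^('m option))
      \<Rightarrow> real^('m option) \<Rightarrow> real^'m^'m::finite" where
  "second_ff S g x = (\<chi> a b. \<Sum>k\<in>UNIV.
      (partial_deriv S (Some a) (\<lambda>y. outward_normal (g y) $ k) x
        + (\<Sum>l\<in>UNIV. christoffel S g k (Some a) l x * outward_normal (g x) $ l))
      * g x $ k $ Some b)"

definition mean_curv ::
    "(real^('m option)) set \<Rightarrow> (real^('m option) \<Rightarrow> real^('m option)^('m option))
      \<Rightarrow> real^('m::finite option) \<Rightarrow> real" where
  "mean_curv S g x =
     (\<Sum>a\<in>UNIV. \<Sum>b\<in>UNIV. matrix_inv (tang (g x)) $ a $ b * second_ff S g x $ a $ b)"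

section \<open>Smooth manifolds with boundary\<close>

text \<open>
  The manifold is the whole type \<open>'p\<close>.  A chart is a domain together with a coordinate map, whose
  values outside the domain are irrelevant.
\<close>

type_synonym ('p, 'm) chart = "'p set \<times> ('p \<Rightarrow> real^('m option))"

type_synonym ('p, 'm) tensor2 =
  "('p, 'm) chart \<Rightarrow> real^('m option) \<Rightarrow> real^('m option)^('m option)"

definition is_chart :: "('p::topological_space, 'm::finite) chart \<Rightarrow> bool" where
  "is_chart = (\<lambda>(U, \<phi>). open U \<and> openin (top_of_set half_space) (\<phi> ` U) \<and>
     homeomorphism U (\<phi> ` U) \<phi> (inv_into U \<phi>))"

definition overlap :: "('p, 'm::finite) chart \<Rightarrow> ('p, 'm) chart \<Rightarrow> (real^('m option)) set" where
  "overlap c d = snd c ` (fst c \<inter> fst d)"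

definition transition ::
    "('p, 'm::finite) chart \<Rightarrow> ('p, 'm) chart \<Rightarrow> real^('m option) \<Rightarrow> real^('m option)" where
  "transition c d x = snd d (inv_into (fst c) (snd c) x)"

definition compatible :: "('p, 'm::finite) chart \<Rightarrow> ('p, 'm) chart \<Rightarrow> bool" where
  "compatible c d \<longleftrightarrow>
     (\<forall>i. smooth_on (overlap c d) (\<lambda>x. transition c d x $ i)) \<and>
     (\<forall>i. smooth_on (overlap d c) (\<lambda>x. transition d c x $ i))"

text \<open>
  A maximal smooth atlas.  By maximality, a diffeomorphism from an open subset \<open>U\<close> of the manifold
  onto a relatively open subset of the half-space is the same thing as a chart with domain \<open>U\<close>.
\<close>

definition smooth_structure :: "('p::topological_space, 'm::finite) chart set \<Rightarrow> bool" where
  "smooth_structure \<A> \<longleftrightarrow>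
     (\<forall>c\<in>\<A>. is_chart c) \<and> \<Union> (fst ` \<A>) = UNIV \<and> (\<forall>c\<in>\<A>. \<forall>d\<in>\<A>. compatible c d) \<and>
     (\<forall>c. is_chart c \<and> (\<forall>d\<in>\<A>. compatible c d) \<longrightarrow> c \<in> \<A>)"

definition boundary :: "('p, 'm::finite) chart set \<Rightarrow> 'p set" where
  "boundary \<A> = {p. \<exists>(U, \<phi>)\<in>\<A>. p \<in> U \<and> \<phi> p $ None = 0}"

definition jacobian ::
    "('p, 'm::finite) chart \<Rightarrow> ('p, 'm) chart \<Rightarrow> real^('m option) \<Rightarrow> real^('m option)^('m option)"
  where
  "jacobian c d x = (\<chi> k i. partial_deriv (overlap c d) i (\<lambda>y. transition c d y $ k) x)"

text \<open>
  A Riemannian metric is given by its components \<open>g c\<close> in every chart \<open>c\<close>, subject to the tensor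
  transformation law.
\<close>

definition riemannian_metric ::
    "('p, 'm::finite) chart set \<Rightarrow> ('p, 'm) tensor2 \<Rightarrow> bool" where
  "riemannian_metric \<A> g \<longleftrightarrow>
     (\<forall>c\<in>\<A>. \<forall>i j. smooth_on (snd c ` fst c) (\<lambda>x. g c x $ i $ j)) \<and>
     (\<forall>c\<in>\<A>. \<forall>x\<in>snd c ` fst c.
        transpose (g c x) = g c x \<and> (\<forall>v. v \<noteq> 0 \<longrightarrow> form (g c x) v v > 0)) \<and>
     (\<forall>c\<in>\<A>. \<forall>d\<in>\<A>. \<forall>x\<in>overlap c d.
        g c x = transpose (jacobian c d x) ** g d (transition c d x) ** jacobian c d x)"

text \<open>
  The volume measures of the manifold and of its boundary are the Borel measures with density
  \<open>sqrt (det g)\<close> in every chart; these conditions determine them uniquely.  Likewise the scalar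
  curvature and the mean curvature of the boundary are the functions that in every chart are
  given by the coordinate formulas.
\<close>

definition riemannian_volume ::
    "('p::topological_space, 'm::finite) chart set \<Rightarrow> ('p, 'm) tensor2 \<Rightarrow> 'p measure \<Rightarrow> bool" where
  "riemannian_volume \<A> g vol \<longleftrightarrow> sets vol = sets borel \<and>
     (\<forall>c\<in>\<A>. \<forall>B\<in>sets vol. B \<subseteq> fst c \<longrightarrow>
        emeasure vol B = (\<integral>\<^sup>+x\<in>snd c ` B. ennreal (sqrt (det (g c x))) \<partial>lborel))"

definition boundary_volume ::
    "('p::topological_space, 'm::finite) chart set \<Rightarrow> ('p, 'm) tensor2 \<Rightarrow> 'p measure \<Rightarrow> bool" where
  "boundary_volume \<A> g area \<longleftrightarrow> sets area = sets (restrict_space borel (boundary \<A>)) \<and>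
     (\<forall>c\<in>\<A>. \<forall>B\<in>sets area. B \<subseteq> fst c \<longrightarrow>
        emeasure area B =
          (\<integral>\<^sup>+y\<in>{y. bdry_pt y \<in> snd c ` B}. ennreal (sqrt (det (tang (g c (bdry_pt y))))) \<partial>lborel))"

definition is_scalar_curvature ::
    "('p, 'm::finite) chart set \<Rightarrow> ('p, 'm) tensor2 \<Rightarrow> ('p \<Rightarrow> real) \<Rightarrow> bool" where
  "is_scalar_curvature \<A> g R \<longleftrightarrow>
     (\<forall>c\<in>\<A>. \<forall>p\<in>fst c. R p = scalar_curv (snd c ` fst c) (g c) (snd c p))"

definition is_boundary_mean_curvature ::
    "('p, 'm::finite) chart set \<Rightarrow> ('p, 'm) tensor2 \<Rightarrow> ('p \<Rightarrow> real) \<Rightarrow> bool" where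
  "is_boundary_mean_curvature \<A> g H \<longleftrightarrow>
     (\<forall>c\<in>\<A>. \<forall>p\<in>fst c \<inter> boundary \<A>. H p = mean_curv (snd c ` fst c) (g c) (snd c p))"

section \<open>Asymptotically flat ends\<close>

text \<open>
  \<open>\<Psi>\<close> is a diffeomorphism from the complement of the compact set \<open>K\<close> onto \<open>end_region\<close>.  The filter
  expresses \<open>r \<rightarrow> \<infinity>\<close> within the half-space, uniformly in the direction.
\<close>

definition asymptotically_flat ::
    "('p::topological_space, 'm::finite) chart set \<Rightarrow> ('p, 'm) tensor2 \<Rightarrow> real \<Rightarrow> 'p set
      \<Rightarrow> ('p \<Rightarrow> real^('m option)) \<Rightarrow> bool" where
  "asymptotically_flat \<A> g \<tau> K \<Psi> \<longleftrightarrow>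
     compact K \<and> (- K, \<Psi>) \<in> \<A> \<and> \<Psi> ` (- K) = end_region \<and>
     (\<forall>i j k l.
        (\<lambda>x. \<bar>g (- K, \<Psi>) x $ i $ j - mat 1 $ i $ j\<bar>
           + norm x * \<bar>partial_deriv end_region k (\<lambda>y. g (- K, \<Psi>) y $ i $ j) x\<bar>
           + (norm x)\<^sup>2 * \<bar>partial_deriv end_region l
               (partial_deriv end_region k (\<lambda>y. g (- K, \<Psi>) y $ i $ j)) x\<bar>)
        \<in> o[inf at_infinity (principal half_space)](\<lambda>x. norm x powr (- \<tau>)))"

definition hemisphere :: "real \<Rightarrow> (real^('m::finite option)) set" where
  "hemisphere r = sphere 0 r \<inter> half_space"

text \<open>The volume of the standard unit sphere in \<open>'a\<close>.\<close>

definition unit_sphere_vol :: "'a::euclidean_space itself \<Rightarrow> real" where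
  "unit_sphere_vol _ = measure (sphere_measure 1 :: 'a measure) (sphere 0 1)"

text \<open>
  The quantities below depend on the metric components \<open>g\<close> on \<open>end_region\<close>.  The boundary of the
  hemisphere of radius \<open>r\<close> is the sphere of radius \<open>r\<close> in \<open>real^'m\<close>.
\<close>

definition adm_flux ::
    "(real^('m option) \<Rightarrow> real^('m option)^('m::finite option)) \<Rightarrow> real \<Rightarrow> real" where
  "adm_flux g r =
     1 / (2 * (real CARD('m option) - 1) * unit_sphere_vol TYPE(real^('m option))) *
     ((LINT x:hemisphere r|sphere_measure r.
         (\<Sum>i\<in>UNIV. (\<Sum>j\<in>UNIV. partial_deriv end_region j (\<lambda>y. g y $ i $ j) x
                              - partial_deriv end_region i (\<lambda>y. g y $ j $ j) x)
            * (x $ i / norm x)))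
      + (LINT y:sphere 0 r|sphere_measure r.
           (\<Sum>a\<in>UNIV. g (bdry_pt y) $ Some a $ None * (y $ a / norm y))))"

definition adm_mass ::
    "(real^('m option) \<Rightarrow> real^('m option)^('m::finite option)) \<Rightarrow> real" where
  "adm_mass g = Lim at_top (adm_flux g)"

text \<open>
  In both integrals \<open>X\<close> is the position vector, and \<open>\<nu>\<close>, \<open>\<vartheta>\<close> are the unit normals for \<open>g\<close> and for
  the metric that \<open>g\<close> induces on the boundary hyperplane.
\<close>

definition einstein_flux ::
    "(real^('m option) \<Rightarrow> real^('m option)^('m::finite option)) \<Rightarrow> real \<Rightarrow> real" where
  "einstein_flux g r =
     (LINT x:hemisphere r|sphere_measure r.
        form (einstein end_region g x) x (unit_normal (g x) x) * induced_density (g x) x)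
     + (LINT y:sphere 0 r|sphere_measure r.
          (let x = bdry_pt y; h = tang (g x)
           in form (second_ff end_region g x - mean_curv end_region g x *\<^sub>R h) y (unit_normal h y)
                * induced_density h y))"

end

theory Submission
  imports Defs
begin

text \<open>
  Write \<open>g = \<delta> + e\<close> on the end, so that \<open>e\<close>, its first and its second derivatives are of order
  \<open>r\<^sup>-\<^sup>\<tau>\<close>, \<open>r\<^sup>-\<^sup>\<tau>\<^sup>-\<^sup>1\<close>, \<open>r\<^sup>-\<^sup>\<tau>\<^sup>-\<^sup>2\<close>.  Every term of the two flux integrals that is at least quadratic in
  \<open>e\<close> contributes at most \<open>r\<^sup>n\<^sup>-\<^sup>2\<^sup>-\<^sup>2\<^sup>\<tau>\<close> on the hemisphere of radius \<open>r\<close>, which tends to \<open>0\<close> because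
  \<open>2\<tau> > n - 2\<close>.  Hence \<open>G(X, \<nu>) d\<sigma>\<close> and \<open>(A - H g)(X, \<vartheta>) d\<theta>\<close> may be replaced by their
  linearisations at the flat metric.

  For the linearisations the identity with the mass integrand is exact on every single sphere.
  With \<open>V\<^sub>i = e\<^sub>i\<^sub>j\<^sub>,\<^sub>j - e\<^sub>j\<^sub>j\<^sub>,\<^sub>i\<close> the linearised Einstein tensor satisfies
  \<open>2 G\<^sub>i\<^sub>j x\<^sub>i x\<^sub>j + (n - 2) V\<^sub>i x\<^sub>i = U\<^sub>k\<^sub>,\<^sub>k\<close> for the vector field
  \<open>U\<^sub>k = (e\<^sub>k\<^sub>j\<^sub>,\<^sub>i - e\<^sub>i\<^sub>j\<^sub>,\<^sub>k) x\<^sub>i x\<^sub>j + x\<^sub>k V\<^sub>i x\<^sub>i - r\<^sup>2 V\<^sub>k\<close>, which is tangent to the spheres.  The integral of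
  the divergence of a tangent field over a hemisphere reduces to a term on its boundary sphere.  A
  second field, \<open>Z\<^sub>b = (e\<^sub>a\<^sub>1 y\<^sub>a) y\<^sub>b - r\<^sup>2 e\<^sub>b\<^sub>1\<close> on the boundary hyperplane, turns the derivatives
  \<open>e\<^sub>a\<^sub>1\<^sub>,\<^sub>b\<close> on that sphere into \<open>e\<^sub>a\<^sub>1 y\<^sub>a\<close>.  Together with the linearisation of \<open>A - H g\<close>, all the
  derivative terms on the boundary sphere cancel, and the flux is \<open>- (n - 2) / 2\<close> times the mass integrand
  (\<open>linear_flux_identity\<close>).

  The mass integral has a limit because its increment between two radii is, by the
  divergence theorem, the integral of the linearised scalar curvature over the half-annulus plus twice the
  integral of the linearised mean curvature over the flat annulus (\<open>mass_flux_increment\<close>).  Both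
  differ by integrable errors from \<open>R\<close> and \<open>H\<close>, which are integrable by hypothesis.

  Integrals over spheres are handled through the cone measure: polar coordinates
  (\<open>lborel_integral_polar\<close>) turn integration by parts against radial cut-offs \<open>\<phi>(|x|)\<close> into a statement
  about the weak derivative of \<open>r \<mapsto> \<integral>\<^sub>S\<^sub>(\<^sub>r\<^sub>) f\<close>, and these functions are continuous.  This gives the
  divergence theorem on half-annuli and, for tangent fields, on single hemispheres, without charts on
  the sphere.
\<close>

section \<open>Polar coordinates and integrals over spheres\<close>

text \<open>
  The measure on the unit sphere that gives a set the volume of the part of the unit ball above it.
  It carries the normalisation \<open>1 / n\<close> of the surface measure, which \<open>radial_measure\<close> makes up for.
\<close>

definition cone_measure :: "'a::euclidean_space measure" where
  "cone_measure = distr (restrict_space lborel (cball 0 1)) borel sgn"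

definition radial_measure :: "nat \<Rightarrow> real measure" where
  "radial_measure n = density lborel (\<lambda>r. ennreal (indicator {0<..} r * (real n * r ^ (n - 1))))"

lemma sgn_borel [measurable]: "(sgn :: 'a::euclidean_space \<Rightarrow> 'a) \<in> borel_measurable borel"
  unfolding sgn_div_norm[abs_def] by measurable

lemma emeasure_cone_measure:
  assumes [measurable]: "B \<in> sets borel"
  shows "emeasure cone_measure B = emeasure lborel {x::'a::euclidean_space. norm x \<le> 1 \<and> sgn x \<in> B}"
proof -
  have m: "sgn \<in> measurable (restrict_space lborel (cball (0::'a) 1)) borel"
    by (rule measurable_restrict_space1) simp
  have "emeasure cone_measure B
      = emeasure (restrict_space lborel (cball 0 1)) (sgn -` B \<inter> cball (0::'a) 1)"
    unfolding cone_measure_def by (subst emeasure_distr[OF m]) (auto simp: space_restrict_space)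
  also have "\<dots> = emeasure lborel (sgn -` B \<inter> cball (0::'a) 1)"
    by (rule emeasure_restrict_space) auto
  also have "sgn -` B \<inter> cball (0::'a) 1 = {x. norm x \<le> 1 \<and> sgn x \<in> B}"
    by auto
  finally show ?thesis .
qed

lemma finite_cone_measure: "finite_measure (cone_measure :: 'a::euclidean_space measure)"
proof
  have "emeasure (cone_measure :: 'a measure) UNIV = emeasure lborel {x::'a. norm x \<le> 1 \<and> sgn x \<in> UNIV}"
    by (rule emeasure_cone_measure) simp
  also have "\<dots> = emeasure lborel (cball (0::'a) 1)"
    by (rule arg_cong[where f="emeasure lborel"]) auto
  also have "\<dots> < \<infinity>" by (rule emeasure_lborel_cball_finite)
  finally show "emeasure (cone_measure :: 'a measure) (space cone_measure) \<noteq> \<infinity>"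
    by (simp add: cone_measure_def)
qed

lemma emeasure_radial_measure_atMost:
  assumes "n > 0"
  shows "emeasure (radial_measure n) {..b} = ennreal (if b \<le> 0 then 0 else b ^ n)"
proof -
  have "emeasure (radial_measure n) {..b} 
    = (\<integral>\<^sup>+r. ennreal (indicator {0<..} r * (real n * r ^ (n - 1))) * indicator {..b} r \<partial>lborel)"
    unfolding radial_measure_def by (subst emeasure_density) auto
  also have "\<dots> = (\<integral>\<^sup>+r. ennreal (real n * r ^ (n - 1)) * indicator {0..b} r \<partial>lborel)"
    by (rule nn_integral_cong_AE, rule AE_mp[OF AE_lborel_singleton[of 0]])
      (auto intro!: AE_I2 simp: indicator_def)
  also have "\<dots> = ennreal (if b \<le> 0 then 0 else b ^ n)"
  proof (cases "b \<le> 0")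
    case True
    have "(\<integral>\<^sup>+r. ennreal (real n * r ^ (n - 1)) * indicator {0..b} r \<partial>lborel) = (\<integral>\<^sup>+(r::real). 0 \<partial>lborel)"
      by (rule nn_integral_cong_AE, rule AE_mp[OF AE_lborel_singleton[of 0]])
        (use True in \<open>auto intro!: AE_I2 simp: indicator_def\<close>)
    then show ?thesis using True by simp
  next
    case False
    have "(\<integral>\<^sup>+r. ennreal (real n * r ^ (n - 1)) * indicator {0..b} r \<partial>lborel) = b ^ n - 0 ^ n"
      by (rule nn_integral_FTC_Icc) (use False in \<open>auto intro!: derivative_eq_intros\<close>)
    then show ?thesis using False assms by simp
  qed
  finally show ?thesis .
qed

text \<open>
  Scaling by \<open>b\<close> maps the sector of the unit ball onto the sector of the ball of radius \<open>b\<close>.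
\<close>

lemma emeasure_lborel_cone_sector:
  fixes B :: "'a::euclidean_space set"
  assumes [measurable]: "B \<in> sets borel"
  shows "emeasure lborel {x. norm x \<le> b \<and> sgn x \<in> B}
     = ennreal (if b \<le> 0 then 0 else b ^ DIM('a)) * emeasure cone_measure B"
proof (cases "b \<le> 0")
  case True
  have "emeasure lborel {x. norm x \<le> b \<and> sgn x \<in> B} \<le> emeasure lborel {0::'a}"
  proof (rule emeasure_mono, safe)
    fix x :: 'a assume "norm x \<le> b"
    with True have "norm x \<le> 0" by linarith
    then show "x = 0" by simp
  qed auto
  then show ?thesis using True by simp
next
  case False
  then have b: "b > 0" by simp
  have S: "{x. norm x \<le> b \<and> sgn x \<in> B} \<in> sets borel" by measurable
  have "emeasure lborel {x. norm x \<le> b \<and> sgn x \<in> B}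
     = emeasure (density (distr lborel borel (\<lambda>x::'a. 0 + b *\<^sub>R x)) (\<lambda>_. \<bar>b\<bar>^DIM('a)))
        {x. norm x \<le> b \<and> sgn x \<in> B}"
    by (subst (1) lborel_affine[of b 0]) (use b in auto)
  also have "\<dots> = ennreal (b ^ DIM('a)) * emeasure (distr lborel borel (\<lambda>x::'a. b *\<^sub>R x))
        {x. norm x \<le> b \<and> sgn x \<in> B}"
    using b S by (subst emeasure_density) (auto simp: nn_integral_cmult)
  also have "emeasure (distr lborel borel (\<lambda>x::'a. b *\<^sub>R x)) {x. norm x \<le> b \<and> sgn x \<in> B}
     = emeasure lborel ((\<lambda>x::'a. b *\<^sub>R x) -` {x. norm x \<le> b \<and> sgn x \<in> B} \<inter> space lborel)"
    by (subst emeasure_distr) (use S in auto)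
  also have "(\<lambda>x::'a. b *\<^sub>R x) -` {x. norm x \<le> b \<and> sgn x \<in> B} \<inter> space lborel
     = {x. norm x \<le> 1 \<and> sgn x \<in> B}"
    using b by (auto simp: sgn_scaleR)
  finally show ?thesis using b by (simp add: emeasure_cone_measure)
qed

text \<open>
  Both sides agree on rectangles: for a fixed set of directions, the sectors \<open>norm x \<le> b\<close> have the
  right volume by scaling, and the half-lines \<open>{..b}\<close> generate the Borel sets.
\<close>

lemma lborel_polar:
  "distr lborel (borel \<Otimes>\<^sub>M borel) (\<lambda>x::'a::euclidean_space. (norm x, sgn x))
     = radial_measure DIM('a) \<Otimes>\<^sub>M cone_measure"
proof (rule pair_measure_eqI[symmetric])
  interpret finite_measure "cone_measure :: 'a measure" by (rule finite_cone_measure)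
  show "sigma_finite_measure (cone_measure :: 'a measure)" by unfold_locales
  show "sigma_finite_measure (radial_measure DIM('a))"
    unfolding radial_measure_def
    by (subst sigma_finite_measure.sigma_finite_iff_density_finite[OF sigma_finite_lborel]) auto
  show "sets (radial_measure DIM('a) \<Otimes>\<^sub>M (cone_measure :: 'a measure)) =
    sets (distr lborel (borel \<Otimes>\<^sub>M borel) (\<lambda>x::'a. (norm x, sgn x)))"
    unfolding radial_measure_def cone_measure_def sets_distr by (rule sets_pair_measure_cong) auto
  fix A B assume "A \<in> sets (radial_measure DIM('a))" "B \<in> sets (cone_measure :: 'a measure)"
  then have A[measurable]: "A \<in> sets borel" and B[measurable]: "B \<in> sets borel"
    by (auto simp: radial_measure_def cone_measure_def)
  let ?S = "sgn -` B :: 'a set"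
  have S[measurable]: "?S \<in> sets borel" using measurable_sets_borel[OF sgn_borel B] by simp
  let ?M = "distr (restrict_space lborel ?S) borel norm"
  let ?N = "scale_measure (emeasure cone_measure B) (radial_measure DIM('a))"
  have emM: "emeasure ?M X = emeasure lborel {x::'a. norm x \<in> X \<and> sgn x \<in> B}" 
    if [measurable]: "X \<in> sets borel" for X
  proof -
    have "emeasure ?M X = emeasure (restrict_space lborel ?S) (norm -` X \<inter> ?S)"
      by (subst emeasure_distr) (auto simp: space_restrict_space intro!: measurable_restrict_space1)
    also have "\<dots> = emeasure lborel (norm -` X \<inter> ?S)"
      by (rule emeasure_restrict_space) auto
    also have "norm -` X \<inter> ?S = {x. norm x \<in> X \<and> sgn x \<in> B}" by auto
    finally show ?thesis .
  qed
  have eq: "emeasure ?M {..b} = emeasure ?N {..b}" for b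
    by (subst emM) (auto simp: emeasure_lborel_cone_sector emeasure_radial_measure_atMost mult.commute)
  have "?M = ?N"
  proof (rule measure_eqI_generator_eq_countable)
    show "Int_stable (range (\<lambda>b::real. {..b}))" by (auto simp: Int_stable_def)
    show "\<And>X. X \<in> range (\<lambda>b::real. {..b}) \<Longrightarrow> emeasure ?M X = emeasure ?N X" using eq by auto
    show "sets ?M = sigma_sets UNIV (range (\<lambda>b::real. {..b}))"
      by (simp add: borel_eq_atMost)
    show "sets ?N = sigma_sets UNIV (range (\<lambda>b::real. {..b}))"
      by (simp add: radial_measure_def borel_eq_atMost)
    show "range (\<lambda>n::nat. {..real n}) \<subseteq> range (\<lambda>b::real. {..b})" by auto
    show "\<Union> (range (\<lambda>n::nat. {..real n})) = UNIV" using real_arch_simple by auto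
    fix a assume "a \<in> range (\<lambda>n::nat. {..real n})"
    then show "emeasure ?M a \<noteq> \<infinity>"
      using eq finite_measure.emeasure_finite[OF finite_cone_measure, of B]
      by (auto simp: emeasure_radial_measure_atMost ennreal_mult_eq_top_iff)
  qed auto
  then have "emeasure (radial_measure DIM('a)) A * emeasure cone_measure B = emeasure ?M A"
    by (simp add: mult.commute)
  also have "\<dots> = emeasure (distr lborel (borel \<Otimes>\<^sub>M borel) (\<lambda>x::'a. (norm x, sgn x))) (A \<times> B)"
    by (subst emM, simp, subst emeasure_distr) (auto intro!: arg_cong[where f="emeasure lborel"])
  finally show "emeasure (radial_measure DIM('a)) A * emeasure cone_measure B = 
    emeasure (distr lborel (borel \<Otimes>\<^sub>M borel) (\<lambda>x::'a. (norm x, sgn x))) (A \<times> B)" .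
qed

text \<open>
  The surface measure expressed by the radius-independent cone measure, so that integrals over
  different spheres become integrals over one measure space with the radius as a parameter.
\<close>

lemma sphere_measure_eq:
  "sphere_measure r = density (distr cone_measure borel (\<lambda>z::'a::euclidean_space. r *\<^sub>R z))
     (\<lambda>_. ennreal (real DIM('a) * r ^ (DIM('a) - 1)))"
proof -
  have m: "sgn \<in> measurable (restrict_space lborel (cball (0::'a) 1)) borel"
    by (rule measurable_restrict_space1) simp
  have d: "distr cone_measure borel (\<lambda>z::'a. r *\<^sub>R z)
      = distr (restrict_space lborel (cball 0 1)) borel (\<lambda>x. r *\<^sub>R sgn x)"
    unfolding cone_measure_def by (subst distr_distr[OF _ m]) (auto simp: comp_def)
  show ?thesis
    unfolding sphere_measure_def d
    by (rule measure_eqI) (auto simp: emeasure_density nn_integral_cmult)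
qed

lemma sets_sphere_measure [simp, measurable_cong]: "sets (sphere_measure r) = sets borel"
  by (simp add: sphere_measure_eq)

lemma space_sphere_measure [simp]: "space (sphere_measure r) = UNIV"
  by (simp add: sphere_measure_eq)

lemma sets_cone_measure [simp, measurable_cong]: "sets cone_measure = sets borel"
  by (simp add: cone_measure_def)

lemma space_cone_measure [simp]: "space cone_measure = UNIV"
  by (simp add: cone_measure_def)

lemma integral_sphere_measure:
  fixes f :: "'a::euclidean_space \<Rightarrow> real"
  assumes [measurable]: "f \<in> borel_measurable borel" and "r \<ge> 0"
  shows "integral\<^sup>L (sphere_measure r) f
    = real DIM('a) * r ^ (DIM('a) - 1) * (LINT z|cone_measure. f (r *\<^sub>R z))"
  unfolding sphere_measure_eq
  using assms(2) by (subst integral_density) (auto simp: integral_distr)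

lemma finite_sphere_measure: "finite_measure (sphere_measure r :: 'a::euclidean_space measure)"
proof
  have "emeasure (sphere_measure r :: 'a measure) UNIV < \<infinity>"
    using finite_measure.emeasure_finite[OF finite_cone_measure, of "UNIV::'a set"]
    by (auto simp: sphere_measure_eq emeasure_density nn_integral_cmult emeasure_distr less_top ennreal_mult_less_top)
  then show "emeasure (sphere_measure r :: 'a measure) (space (sphere_measure r)) \<noteq> \<infinity>" by simp
qed

lemma AE_cone_measure: "AE z in (cone_measure :: 'a::euclidean_space measure). norm z = 1"
proof -
  have m: "sgn \<in> measurable (restrict_space lborel (cball (0::'a) 1)) borel"
    by (rule measurable_restrict_space1) simp
  have "AE x in lborel. (x::'a) \<noteq> 0" by (rule AE_lborel_singleton)
  then show ?thesis
    unfolding cone_measure_def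
    by (subst AE_distr_iff[OF m]) (auto simp: AE_restrict_space_iff norm_sgn)
qed

lemma lborel_integral_polar:
  fixes f :: "'a::euclidean_space \<Rightarrow> real"
  assumes "integrable lborel f"
  shows "integrable lborel (\<lambda>r. indicator {0<..} r * integral\<^sup>L (sphere_measure r) f)" (is ?I)
    and "integral\<^sup>L lborel f = (LBINT r. indicator {0<..} r * integral\<^sup>L (sphere_measure r) f)" (is ?E)
proof -
  have f[measurable]: "f \<in> borel_measurable borel"
    using assms by simp
  let ?P = "\<lambda>x::'a. (norm x, sgn x)"
  let ?g = "\<lambda>(r, z). f (r *\<^sub>R z)"
  have P: "?P \<in> measurable lborel (borel \<Otimes>\<^sub>M borel)" by measurable
  have g: "?g \<in> borel_measurable (borel \<Otimes>\<^sub>M borel)" by measurable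
  have gP: "?g (?P x) = f x" for x :: 'a
    by (cases "x = 0") (auto simp: sgn_div_norm)
  interpret c: finite_measure "cone_measure :: 'a measure" by (rule finite_cone_measure)
  interpret r: sigma_finite_measure "radial_measure DIM('a)"
    unfolding radial_measure_def
    by (subst sigma_finite_measure.sigma_finite_iff_density_finite[OF sigma_finite_lborel]) auto
  interpret pair_sigma_finite "radial_measure DIM('a)" "cone_measure :: 'a measure" ..
  have "integrable (distr lborel (borel \<Otimes>\<^sub>M borel) ?P) ?g"
    by (subst integrable_distr_eq[OF P g]) (use assms gP in simp)
  then have int: "integrable (radial_measure DIM('a) \<Otimes>\<^sub>M cone_measure) ?g"
    by (simp only: lborel_polar)
  let ?h = "\<lambda>r. LINT z|cone_measure. f (r *\<^sub>R z)"
  have eq: "indicator {0<..} r * (real DIM('a) * r ^ (DIM('a) - 1)) * ?h r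
    = indicator {0<..} r * integral\<^sup>L (sphere_measure r) f" for r
    by (auto simp: indicator_def integral_sphere_measure)
  have h: "?h \<in> borel_measurable borel"
    by measurable
  have i1: "integrable (radial_measure DIM('a)) ?h" using integrable_fst'[OF int] by simp
  then have "integrable lborel (\<lambda>r. (indicator {0<..} r * (real DIM('a) * r ^ (DIM('a) - 1))) *\<^sub>R ?h r)"
    unfolding radial_measure_def
    by (subst (asm) integrable_density) (use h in \<open>auto simp: indicator_def\<close>)
  then show ?I by (simp only: real_scaleR_def eq)
  have "integral\<^sup>L lborel f = integral\<^sup>L (distr lborel (borel \<Otimes>\<^sub>M borel) ?P) ?g"
    by (subst integral_distr[OF P g]) (simp only: gP)
  also have "\<dots> = integral\<^sup>L (radial_measure DIM('a)) ?h"
    unfolding lborel_polar using integral_fst'[OF int] by simp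
  also have "\<dots> = (LBINT r. (indicator {0<..} r * (real DIM('a) * r ^ (DIM('a) - 1))) *\<^sub>R ?h r)"
    unfolding radial_measure_def by (rule integral_density) (use h in \<open>auto simp: indicator_def\<close>)
  also have "\<dots> = (LBINT r. indicator {0<..} r * integral\<^sup>L (sphere_measure r) f)"
    by (simp only: real_scaleR_def eq)
  finally show ?E .
qed

text \<open>
  Only closed cones occur: the half-space in dimension \<open>n\<close> and, for the boundary spheres, the whole
  space in dimension \<open>n - 1\<close>.
\<close>

definition is_cone :: "'a::euclidean_space set \<Rightarrow> bool" where
  "is_cone C \<longleftrightarrow> closed C \<and> (\<forall>x\<in>C. \<forall>t>0. t *\<^sub>R x \<in> C)"

definition cone_int :: "'a::euclidean_space set \<Rightarrow> ('a \<Rightarrow> real) \<Rightarrow> real \<Rightarrow> real" where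
  "cone_int C f r = (LINT x:(sphere 0 r \<inter> C)|sphere_measure r. f x)"

lemma is_cone_scaleR: "is_cone C \<Longrightarrow> t > 0 \<Longrightarrow> t *\<^sub>R x \<in> C \<longleftrightarrow> x \<in> C"
proof
  assume C: "is_cone C" "t > 0" and "t *\<^sub>R x \<in> C"
  then have "inverse t *\<^sub>R (t *\<^sub>R x) \<in> C"
    unfolding is_cone_def by (metis positive_imp_inverse_positive)
  with \<open>t > 0\<close> show "x \<in> C" by simp
qed (auto simp: is_cone_def)

lemma cone_sphere_measurable:
  assumes "is_cone C" "continuous_on (C - cball 0 1) f" "r > 1"
  shows "(\<lambda>x. indicator (sphere 0 r \<inter> C) x * (f x :: real)) \<in> borel_measurable borel"
proof -
  have "sphere 0 r \<inter> C \<in> sets borel" using assms(1) unfolding is_cone_def by auto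
  moreover have "continuous_on (sphere 0 r \<inter> C) f"
    by (rule continuous_on_subset[OF assms(2)]) (use assms(3) in auto)
  ultimately show ?thesis using borel_measurable_continuous_on_indicator by fastforce
qed

lemma cone_scaled_measurable:
  assumes C: "is_cone C" and f: "continuous_on (C - cball 0 1) f" and r: "r > 1"
  shows "(\<lambda>z. indicator (sphere 0 1 \<inter> C) z * (f (r *\<^sub>R z) :: real)) \<in> borel_measurable borel"
proof -
  have "(\<lambda>z. indicator (sphere 0 r \<inter> C) (r *\<^sub>R z) * f (r *\<^sub>R z)) \<in> borel_measurable borel"
    by (rule measurable_compose[OF _ cone_sphere_measurable[OF C f r]]) measurable
  moreover have "indicator (sphere 0 r \<inter> C) (r *\<^sub>R z) = (indicator (sphere 0 1 \<inter> C) z :: real)" for z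
    using r is_cone_scaleR[OF C, of r] by (auto simp: indicator_def)
  ultimately show ?thesis by simp
qed

lemma cone_int_eq:
  fixes f :: "'a::euclidean_space \<Rightarrow> real"
  assumes "is_cone C" "continuous_on (C - cball 0 1) f" "r > 1"
  shows "cone_int C f r = real DIM('a) * r ^ (DIM('a) - 1) *
      (LINT z|cone_measure. indicator (sphere 0 1 \<inter> C) z * f (r *\<^sub>R z))"
proof -
  have "cone_int C f r = real DIM('a) * r ^ (DIM('a) - 1) *
     (LINT z|cone_measure. indicator (sphere 0 r \<inter> C) (r *\<^sub>R z) * f (r *\<^sub>R z))"
    unfolding cone_int_def set_lebesgue_integral_def
    by (subst integral_sphere_measure[OF _ order.strict_implies_order])
      (use cone_sphere_measurable[OF assms] assms(3) in auto)
  also have "(\<lambda>z. indicator (sphere 0 r \<inter> C) (r *\<^sub>R z) * f (r *\<^sub>R z))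
     = (\<lambda>z. indicator (sphere 0 1 \<inter> C) z * f (r *\<^sub>R z))"
    using assms(1,3) is_cone_scaleR[OF assms(1), of r] by (auto simp: indicator_def fun_eq_iff)
  finally show ?thesis .
qed

lemma cone_set_integrable:
  assumes "is_cone C" "continuous_on (C - cball 0 1) f" "r > 1"
  shows "set_integrable (sphere_measure r) (sphere 0 r \<inter> C) (f :: _ \<Rightarrow> real)"
proof -
  have c: "compact (sphere 0 r \<inter> C)" using assms(1) unfolding is_cone_def
    by (simp add: closed_Int_compact compact_Int_closed)
  have "continuous_on (sphere 0 r \<inter> C) f"
    by (rule continuous_on_subset[OF assms(2)]) (use assms(3) in auto)
  then have "bounded (f ` (sphere 0 r \<inter> C))" using c compact_continuous_image compact_imp_bounded by blast
  then obtain B where B: "B > 0" "\<And>x. x \<in> sphere 0 r \<inter> C \<Longrightarrow> norm (f x) \<le> B"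
    unfolding bounded_pos by auto
  show ?thesis unfolding set_integrable_def
  proof (rule finite_measure.integrable_const_bound[OF finite_sphere_measure, where B=B])
    show "AE x in sphere_measure r. norm (indicat_real (sphere 0 r \<inter> C) x *\<^sub>R f x) \<le> B"
      using B by (auto intro!: AE_I2 simp: indicator_def)
    show "(\<lambda>x. indicat_real (sphere 0 r \<inter> C) x *\<^sub>R f x) \<in> borel_measurable (sphere_measure r)"
      using cone_sphere_measurable[OF assms] by (simp cong: measurable_cong_sets)
  qed
qed

text \<open>
  Dominated convergence on the unit sphere: along a convergent sequence of radii the integrand stays
  in a compact part of the cone.
\<close>

lemma cone_int_continuous:
  fixes f :: "'a::euclidean_space \<Rightarrow> real"
  assumes C: "is_cone C" and f: "continuous_on (C - cball 0 1) f"
  shows "continuous_on {1<..} (cone_int C f)"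
proof -
  let ?h = "\<lambda>r. LINT z|cone_measure. indicator (sphere 0 1 \<inter> C) z * f (r *\<^sub>R z)"
  note meas = cone_scaled_measurable[OF C f]
  have h: "continuous_on {1<..} ?h"
  proof (rule continuous_on_sequentiallyI)
    fix u a assume u: "\<forall>n. u n \<in> {1::real<..}" and a: "a \<in> {1<..}" and lim: "u \<longlonglongrightarrow> a"
    have "bounded (range u)" using lim convergent_imp_bounded by blast
    then obtain M where M: "\<And>n. u n \<le> M" unfolding bounded_iff by (auto simp: abs_le_iff)
    obtain m where m: "m > 1" "\<And>n. m \<le> u n"
    proof -
      have "compact (insert a (range u))" using compact_sequence_with_limit[OF lim] .
      then obtain s where s: "s \<in> insert a (range u)" "\<And>t. t \<in> insert a (range u) \<Longrightarrow> s \<le> t"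
        using compact_attains_inf[of "insert a (range u)"] by blast
      then show ?thesis using u a that[of s] by auto
    qed
    let ?K = "C \<inter> (cball 0 M - ball 0 m)"
    have "compact ?K" using C unfolding is_cone_def
      by (metis Diff_Int_distrib2 compact_cball compact_Int_closed closed_Int_compact compact_diff open_ball)
    moreover have "continuous_on ?K f"
      by (rule continuous_on_subset[OF f]) (use m in auto)
    ultimately have "bounded (f ` ?K)" using compact_continuous_image compact_imp_bounded by blast
    then obtain B where B: "B > 0" "\<And>x. x \<in> ?K \<Longrightarrow> norm (f x) \<le> B"
      unfolding bounded_pos by auto
    have inD: "s *\<^sub>R z \<in> C - cball 0 1" if "s > 1" "z \<in> sphere 0 1 \<inter> C" for s z
      using that C is_cone_scaleR[OF C, of s z] by auto
    show "(\<lambda>n. ?h (u n)) \<longlonglongrightarrow> ?h a"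
    proof (rule integral_dominated_convergence[where w="\<lambda>_. B"])
      show "(\<lambda>z. indicator (sphere 0 1 \<inter> C) z * f (a *\<^sub>R z)) \<in> borel_measurable cone_measure"
        using meas[of a] a by (simp cong: measurable_cong_sets)
      show "(\<lambda>z. indicator (sphere 0 1 \<inter> C) z * f (u n *\<^sub>R z)) \<in> borel_measurable cone_measure" for n
        using meas[of "u n"] u by (simp cong: measurable_cong_sets)
      show "integrable cone_measure (\<lambda>_::'a. B)"
        by (rule finite_measure.integrable_const[OF finite_cone_measure])
      show "AE z in cone_measure. (\<lambda>n. indicator (sphere 0 1 \<inter> C) z * f (u n *\<^sub>R z))
          \<longlonglongrightarrow> indicator (sphere 0 1 \<inter> C) z * f (a *\<^sub>R z)"
      proof (rule AE_I2)
        fix z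
        show "(\<lambda>n. indicator (sphere 0 1 \<inter> C) z * f (u n *\<^sub>R z))
          \<longlonglongrightarrow> indicator (sphere 0 1 \<inter> C) z * f (a *\<^sub>R z)"
        proof (cases "z \<in> sphere 0 1 \<inter> C")
          case True
          have "\<forall>n. u n *\<^sub>R z \<in> C - cball 0 1" using inD True u by blast
          then have "(\<lambda>n. f (u n *\<^sub>R z)) \<longlonglongrightarrow> f (a *\<^sub>R z)"
            by (intro continuous_on_tendsto_compose[OF f] inD[OF _ True] always_eventually)
              (use a lim in \<open>auto intro!: tendsto_intros\<close>)
          then show ?thesis by (intro tendsto_intros)
        qed auto
      qed
      fix n
      show "AE z in cone_measure. norm (indicator (sphere 0 1 \<inter> C) z * f (u n *\<^sub>R z)) \<le> B"
      proof (rule AE_I2)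
        fix z
        have "norm (f (u n *\<^sub>R z)) \<le> B" if z: "z \<in> sphere 0 1 \<inter> C"
        proof (rule B(2))
          have "u n > 1" using u by auto
          then show "u n *\<^sub>R z \<in> ?K" using z M[of n] m(2)[of n] is_cone_scaleR[OF C, of "u n" z] by auto
        qed
        then show "norm (indicator (sphere 0 1 \<inter> C) z * f (u n *\<^sub>R z)) \<le> B"
          using B(1) by (auto simp: indicator_def)
      qed
    qed
  qed
  have "continuous_on {1<..} (\<lambda>r. real DIM('a) * r ^ (DIM('a) - 1) * ?h r)"
    by (intro continuous_intros h)
  then show ?thesis
    by (rule continuous_on_eq) (simp add: cone_int_eq[OF C f])
qed

section \<open>Weak derivatives with respect to the radius\<close>

text \<open>
  Polar coordinates for a function that is only controlled outside the unit ball; the radial cut-off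
  \<open>\<psi>\<close> removes the rest.
\<close>

lemma cone_integral_polar:
  fixes f :: "'a::euclidean_space \<Rightarrow> real" and \<psi> :: "real \<Rightarrow> real"
  assumes C: "is_cone C" and f: "continuous_on (C - cball 0 1) f"
    and \<psi>: "continuous_on UNIV \<psi>" and a: "1 < a" and z: "\<And>r. r \<notin> {a..b} \<Longrightarrow> \<psi> r = 0"
  shows "integrable lborel (\<lambda>x. indicator C x * (\<psi> (norm x) * f x))" (is ?I)
    and "(LBINT x. indicator C x * (\<psi> (norm x) * f x))
       = integral {a..b} (\<lambda>r. \<psi> r * cone_int C f r)" (is ?E)
proof -
  let ?F = "\<lambda>x. indicator C x * (\<psi> (norm x) * f x)"
  let ?K = "C \<inter> (cball 0 b - ball 0 a)"
  have K: "compact ?K" using C unfolding is_cone_def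
    by (metis Diff_Int_distrib2 compact_cball compact_Int_closed closed_Int_compact compact_diff open_ball)
  have sub: "?K \<subseteq> C - cball 0 1" using a by auto
  have psi: "continuous_on S (\<lambda>x::'a. \<psi> (norm x))" for S
    by (rule continuous_on_compose2[OF \<psi>]) (auto intro!: continuous_intros)
  have "integrable lborel (\<lambda>x. indicator ?K x *\<^sub>R (\<psi> (norm x) * f x))"
    by (rule borel_integrable_compact[OF K])
      (intro continuous_intros psi continuous_on_subset[OF f sub])
  moreover have eqF: "(\<lambda>x. indicator ?K x *\<^sub>R (\<psi> (norm x) * f x)) = ?F"
  proof
    fix x show "indicator ?K x *\<^sub>R (\<psi> (norm x) * f x) = ?F x"
      using z[of "norm x"] by (auto simp: indicator_def)
  qed
  ultimately show I: ?I by simp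
  then have Fm: "?F \<in> borel_measurable borel" by simp
  have *: "indicator {0<..} r * integral\<^sup>L (sphere_measure r) ?F 
     = indicator {a..b} r *\<^sub>R (\<psi> r * cone_int C f r)" for r
  proof (cases "r > 0")
    case r: True
    have AE: "AE x in cone_measure. ?F (r *\<^sub>R x) = indicator C (r *\<^sub>R x) * (\<psi> r * f (r *\<^sub>R x))"
      using AE_cone_measure by eventually_elim (use r in auto)
    have "integral\<^sup>L (sphere_measure r) ?F = real DIM('a) * r ^ (DIM('a) - 1) *
       (LINT z|cone_measure. ?F (r *\<^sub>R z))"
      by (rule integral_sphere_measure[OF Fm]) (use r in auto)
    also have "(LINT z|cone_measure. ?F (r *\<^sub>R z)) 
        = \<psi> r * (LINT z|cone_measure. indicator (sphere 0 1 \<inter> C) z * f (r *\<^sub>R z))"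
    proof (cases "r > 1")
      case True
      have "(LINT z|cone_measure. ?F (r *\<^sub>R z)) 
        = (LINT z|cone_measure. \<psi> r * (indicator (sphere 0 1 \<inter> C) z * f (r *\<^sub>R z)))"
      proof (rule integral_cong_AE)
        show "(\<lambda>z. ?F (r *\<^sub>R z)) \<in> borel_measurable cone_measure"
          using measurable_compose[OF _ Fm, of "\<lambda>z. r *\<^sub>R z" borel] by (simp cong: measurable_cong_sets)
        show "(\<lambda>z. \<psi> r * (indicator (sphere 0 1 \<inter> C) z * f (r *\<^sub>R z))) \<in> borel_measurable cone_measure"
          using cone_scaled_measurable[OF C f True] by (simp cong: measurable_cong_sets)
        show "AE z in cone_measure. ?F (r *\<^sub>R z) = \<psi> r * (indicator (sphere 0 1 \<inter> C) z * f (r *\<^sub>R z))"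
          using AE_cone_measure AE
          by eventually_elim (use r is_cone_scaleR[OF C r] in \<open>auto simp: indicator_def\<close>)
      qed
      then show ?thesis by simp
    next
      case False
      then have "\<psi> r = 0" using a by (intro z) auto
      with AE have "(LINT z|cone_measure. ?F (r *\<^sub>R z)) = 0"
        by (intro integral_eq_zero_AE) auto
      with \<open>\<psi> r = 0\<close> show ?thesis by simp
    qed
    finally show ?thesis using r a z[of r] cone_int_eq[OF C f, of r]
      by (auto simp: indicator_def)
  qed (use a in auto)
  have "integral\<^sup>L lborel ?F = (LBINT r. indicator {0<..} r * integral\<^sup>L (sphere_measure r) ?F)"
    by (rule lborel_integral_polar(2)[OF I])
  also have "\<dots> = (LBINT r:{a..b}. \<psi> r * cone_int C f r)"
    unfolding * set_lebesgue_integral_def ..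
  also have "\<dots> = integral {a..b} (\<lambda>r. \<psi> r * cone_int C f r)"
  proof (rule set_borel_integral_eq_integral(2))
    have "continuous_on {a..b} (\<lambda>r. \<psi> r * cone_int C f r)"
      by (intro continuous_intros continuous_on_subset[OF \<psi>] continuous_on_subset[OF cone_int_continuous[OF C f]])
        (use a in auto)
    then show "set_integrable lborel {a..b} (\<lambda>r. \<psi> r * cone_int C f r)"
      by (rule borel_integrable_atLeastAtMost')
  qed
  finally show ?E .
qed

text \<open>
  Du Bois-Reymond's lemma.  If \<open>u\<close> is a primitive of \<open>Q\<close>, integration by parts gives
  \<open>\<integral> \<phi>' (P - u) = 0\<close> for all test functions.  Were \<open>P - u\<close> to take different values at \<open>s\<close> and \<open>t\<close>, a
  \<open>\<phi>'\<close> consisting of a positive tent at \<open>s\<close> and an equal negative tent at \<open>t\<close> would contradict this.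
\<close>

lemma weak_derivative_FTC:
  fixes P Q :: "real \<Rightarrow> real"
  assumes P: "continuous_on {1<..} P" and Q: "continuous_on {1<..} Q"
    and weak: "\<And>\<phi> \<phi>' a b. 1 < a \<Longrightarrow> (\<And>r. (\<phi> has_real_derivative \<phi>' r) (at r)) \<Longrightarrow> continuous_on UNIV \<phi>'
       \<Longrightarrow> (\<And>r. r \<notin> {a..b} \<Longrightarrow> \<phi> r = 0 \<and> \<phi>' r = 0)
       \<Longrightarrow> integral {a..b} (\<lambda>r. \<phi>' r * P r + \<phi> r * Q r) = 0"
    and s: "1 < s" "s \<le> t"
  shows "P t - P s = integral {s..t} Q"
proof (cases "s = t")
  case True then show ?thesis by simp
next
  case False
  with s have st: "s < t" by simp
  obtain u where u: "\<And>r. 1 < r \<Longrightarrow> (u has_real_derivative Q r) (at r)"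
    using einterval_antiderivative[of 1 \<infinity> Q] Q s
    by (auto simp: continuous_on_eq_continuous_at one_ereal_def has_real_derivative_iff_has_vector_derivative)
  have ucont: "continuous_on {1<..} u"
    by (rule continuous_at_imp_continuous_on) (use u DERIV_isCont in auto)
  define W where "W r = P r - u r" for r
  have Wcont: "continuous_on {1<..} W" unfolding W_def by (intro continuous_intros P ucont)
  have "W s = W t"
  proof (rule ccontr)
    assume ne: "W s \<noteq> W t"
    define d where "d = W s - W t"
    (* Subtracting m is harmless because the integral of \<phi>' is 0. *)
    define m where "m = (W s + W t) / 2"
    have d: "d \<noteq> 0" using ne d_def by simp
    have Ws: "d * (W s - m) > 0" and Wt: "d * (W t - m) < 0"
    proof -
      have "d * (W s - m) = d\<^sup>2 / 2" "d * (W t - m) = - (d\<^sup>2 / 2)" 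
        unfolding d_def m_def by (auto simp: power2_eq_square field_simps)
      moreover have "d\<^sup>2 > 0" using d by simp
      ultimately show "d * (W s - m) > 0" "d * (W t - m) < 0" by linarith+
    qed
    have co: "((\<lambda>r. d * (W r - m)) \<longlongrightarrow> d * (W r0 - m)) (at r0)" if "r0 > 1" for r0
      by (intro tendsto_intros) (use Wcont that in \<open>auto simp: continuous_on_eq_continuous_at isCont_def\<close>)
    obtain e1 where e1: "e1 > 0" "\<And>r. \<bar>r - s\<bar> < e1 \<Longrightarrow> d * (W r - m) > 0"
    proof -
      have "\<forall>\<^sub>F r in at s. d * (W r - m) > 0"
        using order_tendstoD(1)[OF co[of s] Ws] s by simp
      then obtain c where "c > 0" "\<And>r. r \<noteq> s \<Longrightarrow> dist r s < c \<Longrightarrow> d * (W r - m) > 0"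
        unfolding eventually_at by blast
      then show thesis using Ws that[of c] by (force simp: dist_real_def)
    qed
    obtain e2 where e2: "e2 > 0" "\<And>r. \<bar>r - t\<bar> < e2 \<Longrightarrow> d * (W r - m) < 0"
    proof -
      have "\<forall>\<^sub>F r in at t. d * (W r - m) < 0"
        using order_tendstoD(2)[OF co[of t] Wt] s by simp
      then obtain c where "c > 0" "\<And>r. r \<noteq> t \<Longrightarrow> dist r t < c \<Longrightarrow> d * (W r - m) < 0"
        unfolding eventually_at by blast
      then show thesis using Wt that[of c] by (force simp: dist_real_def)
    qed
    (* The tents of radius e around s and t lie in {1<..}, neither reaches the peak of the other,
       and each stays where W - m keeps its sign. *)
    define e where "e = Min {e1/2, e2/2, (s-1)/2, t-s}"
    have e: "e > 0" "e < e1" "e < e2" "e < s - 1" "e \<le> t - s"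
      unfolding e_def using e1 e2 s st by (auto simp: min_def)
    define \<beta> where "\<beta> z = max 0 (e - \<bar>z\<bar>)" for z :: real
    have \<beta>cont: "continuous_on A \<beta>" for A unfolding \<beta>_def by (intro continuous_intros)
    have \<beta>nn: "\<beta> z \<ge> 0" for z by (simp add: \<beta>_def)
    obtain B where B: "\<And>r. (B has_real_derivative \<beta> r) (at r)"
      using einterval_antiderivative[of "-\<infinity>" \<infinity> \<beta>] \<beta>cont[of UNIV]
      by (auto simp: continuous_on_eq_continuous_at has_real_derivative_iff_has_vector_derivative)
    have Bc: "continuous_on A B" for A
      using B DERIV_isCont by (intro continuous_at_imp_continuous_on) blast
    have Bl: "B z = B (-e)" if "z \<le> -e" for z
    proof (cases "z = - e")
      case False
      with that have "z < -e" by simp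
      from MVT2[OF this, of B \<beta>] B obtain x where "B (-e) - B z = (-e - z) * \<beta> x" "z < x" "x < -e"
        by blast
      then show ?thesis by (auto simp: \<beta>_def)
    qed simp
    have Br: "B z = B e" if "z \<ge> e" for z
    proof (cases "z = e")
      case False
      with that have "e < z" by simp
      from MVT2[OF this, of B \<beta>] B obtain x where "B z - B e = (z - e) * \<beta> x" "e < x" "x < z"
        by blast
      then show ?thesis by (auto simp: \<beta>_def)
    qed simp
    define \<phi> where "\<phi> r = B (r - s) - B (r - t)" for r
    define \<phi>' where "\<phi>' r = \<beta> (r - s) - \<beta> (r - t)" for r
    let ?a = "s - e" and ?b = "t + e"
    have \<phi>: "(\<phi> has_real_derivative \<phi>' r) (at r)" for r
      unfolding \<phi>_def \<phi>'_def
      by (auto intro!: derivative_eq_intros DERIV_chain'[OF _ B, of "\<lambda>r. r - c" for c])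
    have \<phi>'c: "continuous_on A \<phi>'" for A
      unfolding \<phi>'_def \<beta>_def by (intro continuous_intros)
    have \<phi>c: "continuous_on A \<phi>" for A
      using \<phi> DERIV_isCont by (intro continuous_at_imp_continuous_on) blast
    have out: "\<phi> r = 0 \<and> \<phi>' r = 0" if "r \<notin> {?a<..<?b}" for r
    proof (cases "r \<le> ?a")
      case True
      then have "B (r - s) = B (-e)" "B (r - t) = B (-e)" using st by (auto intro!: Bl)
      then show ?thesis using True st by (auto simp: \<phi>_def \<phi>'_def \<beta>_def max_def)
    next
      case False
      then have r: "r \<ge> ?b" using that by auto
      then have "B (r - s) = B e" "B (r - t) = B e" using st by (auto intro!: Br)
      then show ?thesis using r st e by (auto simp: \<phi>_def \<phi>'_def \<beta>_def max_def)
    qed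
    have a1: "1 < ?a" using e by simp
    have sub: "{?a..?b} \<subseteq> {1<..}" using a1 by auto
    have 1: "integral {?a..?b} (\<lambda>r. \<phi>' r * P r + \<phi> r * Q r) = 0"
      by (rule weak[OF a1 \<phi> \<phi>'c]) (use out in auto)
    have 2: "((\<lambda>r. \<phi>' r * u r + \<phi> r * Q r) has_integral (\<phi> ?b * u ?b - \<phi> ?a * u ?a)) {?a..?b}"
    proof (rule fundamental_theorem_of_calculus)
      fix x assume x: "x \<in> {?a..?b}"
      then have "((\<lambda>r. \<phi> r * u r) has_real_derivative (\<phi>' x * u x + \<phi> x * Q x)) (at x)"
        using sub by (auto intro!: derivative_eq_intros \<phi> u)
      then show "((\<lambda>r. \<phi> r * u r) has_vector_derivative (\<phi>' x * u x + \<phi> x * Q x)) (at x within {?a..?b})"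
        by (auto simp: has_real_derivative_iff_has_vector_derivative intro: has_vector_derivative_at_within)
    qed (use st e in auto)
    have 3: "(\<phi>' has_integral (\<phi> ?b - \<phi> ?a)) {?a..?b}"
      by (rule fundamental_theorem_of_calculus)
        (use st e \<phi> in \<open>auto simp: has_real_derivative_iff_has_vector_derivative intro: has_vector_derivative_at_within\<close>)
    have ab0: "\<phi> ?a = 0" "\<phi> ?b = 0" using out by auto
    let ?h = "\<lambda>r. \<phi>' r * (d * (W r - m))"
    have "((\<lambda>r. \<phi>' r * P r + \<phi> r * Q r) has_integral 0) {?a..?b}"
    proof -
      have "continuous_on {?a..?b} (\<lambda>r. \<phi>' r * P r + \<phi> r * Q r)"
        by (intro continuous_intros \<phi>c \<phi>'c continuous_on_subset[OF P sub] continuous_on_subset[OF Q sub])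
      then show ?thesis using 1 integrable_integral[OF integrable_continuous_interval] by metis
    qed
    from has_integral_diff[OF has_integral_diff[OF this 2] has_integral_mult_right[OF 3, of m]]
    have "((\<lambda>r. (\<phi>' r * P r + \<phi> r * Q r) - (\<phi>' r * u r + \<phi> r * Q r) - m * \<phi>' r) has_integral 0) {?a..?b}"
      using ab0 by simp
    from has_integral_mult_right[OF this, of d]
    have h0: "(?h has_integral 0) {?a..?b}"
      by (simp add: W_def algebra_simps)
    have "\<forall>x\<in>cbox ?a ?b. ?h x = 0"
    proof (rule iffD1[OF integral_cbox_eq_0_iff])
      show "continuous_on (cbox ?a ?b) ?h"
        using sub by (intro continuous_intros \<phi>'c) (auto intro!: continuous_on_subset[OF Wcont])
      show "box ?a ?b \<noteq> {}" using st e by auto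
      show "integral (cbox ?a ?b) ?h = 0" using h0 by (simp add: integral_unique)
      fix r assume "r \<in> cbox ?a ?b"
      have "\<beta> (r - s) * (d * (W r - m)) \<ge> 0"
      proof (cases "\<bar>r - s\<bar> < e")
        case True
        then have "0 \<le> d * (W r - m)" using e1(2)[of r] e by simp
        with \<beta>nn show ?thesis by (rule mult_nonneg_nonneg)
      qed (auto simp: \<beta>_def)
      moreover have "\<beta> (r - t) * (d * (W r - m)) \<le> 0"
      proof (cases "\<bar>r - t\<bar> < e")
        case True
        then have "d * (W r - m) \<le> 0" using e2(2)[of r] e by simp
        with \<beta>nn show ?thesis by (rule mult_nonneg_nonpos)
      qed (auto simp: \<beta>_def)
      ultimately show "?h r \<ge> 0" by (simp add: \<phi>'_def left_diff_distrib)
    qed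
    then have "?h s = 0" using st e by auto
    moreover have "\<phi>' s = e" unfolding \<phi>'_def \<beta>_def using st e by auto
    ultimately show False using Ws e by auto
  qed
  have "(Q has_integral (u t - u s)) {s..t}"
  proof (rule fundamental_theorem_of_calculus)
    fix x assume "x \<in> {s..t}"
    then show "(u has_vector_derivative Q x) (at x within {s..t})"
      using u[of x] s by (auto simp: has_real_derivative_iff_has_vector_derivative intro: has_vector_derivative_at_within)
  qed (use s in auto)
  then show ?thesis using \<open>W s = W t\<close> by (simp add: W_def integral_unique)
qed

text \<open>
  Integrating against \<open>\<phi>(|x|)\<close> only sees the integrals over spheres, so a weak identity between a
  flux \<open>p\<close>, a divergence \<open>q\<close> and a boundary term \<open>b\<close> determines the increments of the flux.
\<close>

lemma weak_radial_FTC: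
  fixes p q :: "'a::euclidean_space \<Rightarrow> real" and b :: "'b::euclidean_space \<Rightarrow> real"
  assumes C: "is_cone C" and p: "continuous_on (C - cball 0 1) p" and q: "continuous_on (C - cball 0 1) q"
    and b: "continuous_on (UNIV - cball 0 1) b"
    and weak: "\<And>\<phi> \<phi>' a c. 1 < a \<Longrightarrow> (\<And>r. (\<phi> has_real_derivative \<phi>' r) (at r)) \<Longrightarrow> continuous_on UNIV \<phi>'
       \<Longrightarrow> (\<And>r. r \<notin> {a..c} \<Longrightarrow> \<phi> r = 0 \<and> \<phi>' r = 0)
       \<Longrightarrow> (LBINT x. indicator C x * (\<phi>' (norm x) * p x)) + (LBINT x. indicator C x * (\<phi> (norm x) * q x))
          + (LBINT y. \<phi> (norm y) * b y) = 0"
    and s: "1 < s" "s \<le> t"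
  shows "cone_int C p t - cone_int C p s = integral {s..t} (\<lambda>r. cone_int C q r + cone_int UNIV b r)"
proof (rule weak_derivative_FTC[OF _ _ _ s])
  have U: "is_cone (UNIV :: 'b set)" by (simp add: is_cone_def)
  show P: "continuous_on {1<..} (cone_int C p)" by (rule cone_int_continuous[OF C p])
  have Q: "continuous_on {1<..} (cone_int C q)" by (rule cone_int_continuous[OF C q])
  have B: "continuous_on {1<..} (cone_int UNIV b)" by (rule cone_int_continuous[OF U b])
  show "continuous_on {1<..} (\<lambda>r. cone_int C q r + cone_int UNIV b r)"
    by (intro continuous_intros Q B)
  fix \<phi> \<phi>' :: "real \<Rightarrow> real" and a c :: real
  assume *: "1 < a" "\<And>r. (\<phi> has_real_derivative \<phi>' r) (at r)" "continuous_on UNIV \<phi>'"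
    "\<And>r. r \<notin> {a..c} \<Longrightarrow> \<phi> r = 0 \<and> \<phi>' r = 0"
  have \<phi>c: "continuous_on UNIV \<phi>"
    using *(2) DERIV_isCont by (intro continuous_at_imp_continuous_on) blast
  have sub: "{a..c} \<subseteq> {1<..}" using *(1) by auto
  have i: "(\<lambda>r. f r * g r) integrable_on {a..c}" if "continuous_on UNIV f" "continuous_on {1<..} g" for f g :: "real \<Rightarrow> real"
    by (intro integrable_continuous_interval continuous_intros continuous_on_subset[OF that(1)] continuous_on_subset[OF that(2) sub]) auto
  have "(LBINT x. indicator C x * (\<phi>' (norm x) * p x)) + (LBINT x. indicator C x * (\<phi> (norm x) * q x))
          + (LBINT y. indicator UNIV y * (\<phi> (norm y) * b y)) = 0"
    using weak[OF *] by simp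
  then have "integral {a..c} (\<lambda>r. \<phi>' r * cone_int C p r) + integral {a..c} (\<lambda>r. \<phi> r * cone_int C q r)
     + integral {a..c} (\<lambda>r. \<phi> r * cone_int UNIV b r) = 0"
    using cone_integral_polar(2)[OF C p *(3,1), of c] cone_integral_polar(2)[OF C q \<phi>c *(1), of c] 
      cone_integral_polar(2)[OF U b \<phi>c *(1), of c] *(4) by simp
  then show "integral {a..c} (\<lambda>r. \<phi>' r * cone_int C p r + \<phi> r * (cone_int C q r + cone_int UNIV b r)) = 0"
    by (simp add: distrib_left integral_add integrable_add i P Q B \<phi>c *(3))
qed

section \<open>The divergence theorem on cones\<close>

text \<open>
  The relational form of \<open>partial_deriv\<close>; it obeys the rules of the derivative of a real function of
  one variable, and at the boundary of \<open>S\<close> it is one-sided.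
\<close>

definition has_pd :: "(real^'n) set \<Rightarrow> 'n::finite \<Rightarrow> (real^'n \<Rightarrow> real) \<Rightarrow> real \<Rightarrow> real^'n \<Rightarrow> bool" where
  "has_pd S i f d x \<longleftrightarrow>
     ((\<lambda>t. f (x + t *\<^sub>R axis i 1)) has_real_derivative d) (at 0 within {t. x + t *\<^sub>R axis i 1 \<in> S})"

lemma has_pd_shift:
  assumes "has_pd S i f d (x + t0 *\<^sub>R axis i 1)"
  shows "((\<lambda>t. f (x + t *\<^sub>R axis i 1)) has_real_derivative d) (at t0 within {t. x + t *\<^sub>R axis i 1 \<in> S})"
proof -
  let ?T = "{t. x + t *\<^sub>R axis i 1 \<in> S}"
  have "((\<lambda>t. f ((x + t0 *\<^sub>R axis i 1) + t *\<^sub>R axis i 1)) has_real_derivative d)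
      (at (t0 - t0) within {t. (x + t0 *\<^sub>R axis i 1) + t *\<^sub>R axis i 1 \<in> S})"
    using assms unfolding has_pd_def by simp
  moreover have "{t. (x + t0 *\<^sub>R axis i 1) + t *\<^sub>R axis i 1 \<in> S} = (\<lambda>t. t - t0) ` ?T"
  proof (intro set_eqI iffI)
    fix t assume "t \<in> {t. (x + t0 *\<^sub>R axis i 1) + t *\<^sub>R axis i 1 \<in> S}"
    then have "t + t0 \<in> ?T" by (simp add: scaleR_add_left ac_simps)
    then show "t \<in> (\<lambda>t. t - t0) ` ?T" by (rule rev_image_eqI) simp
  qed (auto simp: algebra_simps)
  ultimately have "((\<lambda>t. f ((x + t0 *\<^sub>R axis i 1) + t *\<^sub>R axis i 1)) has_real_derivative d)
      (at (t0 - t0) within (\<lambda>t. t - t0) ` ?T)" by simp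
  moreover have "((\<lambda>t. t - t0) has_real_derivative 1) (at t0 within ?T)"
    by (auto intro!: derivative_eq_intros)
  ultimately have "((\<lambda>t. f ((x + t0 *\<^sub>R axis i 1) + (t - t0) *\<^sub>R axis i 1)) has_real_derivative d) (at t0 within ?T)"
    using DERIV_image_chain[of "\<lambda>t. f ((x + t0 *\<^sub>R axis i 1) + t *\<^sub>R axis i 1)" d "\<lambda>t. t - t0" t0 ?T 1]
    by (simp add: o_def)
  then show ?thesis by (simp add: algebra_simps)
qed

text \<open>
  In a direction that preserves \<open>C\<close>, the integral of \<open>f\<close> over \<open>C\<close> is invariant under translation, and
  its derivative is the integral of the derivative of \<open>f\<close>.
\<close>

lemma integral_translation_derivative:
  fixes f f' :: "'a::euclidean_space \<Rightarrow> real"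
  assumes C: "closed C" "\<And>x t. x \<in> C \<Longrightarrow> x + t *\<^sub>R e \<in> C"
    and f: "continuous_on C f" and f': "continuous_on C f'"
    and d: "\<And>x. x \<in> C \<Longrightarrow> ((\<lambda>t. f (x + t *\<^sub>R e)) has_real_derivative f' x) (at 0)"
    and z: "\<And>x. x \<in> C \<Longrightarrow> norm x > b \<Longrightarrow> f x = 0 \<and> f' x = 0"
  shows "(LBINT x. indicator C x * f' x) = 0"
proof -
  have d': "((\<lambda>t. f (x + t *\<^sub>R e)) has_real_derivative f' (x + t0 *\<^sub>R e)) (at t0)" if "x \<in> C" for x t0
    using d[OF C(2)[OF that, of t0]] DERIV_shift[of "\<lambda>t. f (x + t *\<^sub>R e)" _ 0 t0]
    by (simp add: scaleR_add_left ac_simps)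
  have mem: "x + t *\<^sub>R e \<in> C \<longleftrightarrow> x \<in> C" for x t
    using C(2)[of x t] C(2)[of "x + t *\<^sub>R e" "-t"] by auto
  let ?K = "C \<inter> cball 0 b"
  have K: "compact ?K" using C(1) by (simp add: closed_Int_compact)
  have "bounded (f' ` ?K)"
    by (intro compact_imp_bounded compact_continuous_image K continuous_on_subset[OF f']) auto
  then obtain B where B: "B > 0" "\<And>x. x \<in> ?K \<Longrightarrow> norm (f' x) \<le> B" unfolding bounded_pos by auto
  have B': "\<bar>f' x\<bar> \<le> B" if "x \<in> C" for x
    using B z[of x] that by (cases "norm x \<le> b") auto
  have int: "integrable lborel (\<lambda>x. indicator C x * h x)" 
    if "continuous_on C h" "\<And>x. x \<in> C \<Longrightarrow> norm x > b \<Longrightarrow> h x = 0" for h :: "'a \<Rightarrow> real"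
  proof -
    have "integrable lborel (\<lambda>x. indicator ?K x *\<^sub>R h x)"
      by (intro borel_integrable_compact K continuous_on_subset[OF that(1)]) auto
    moreover have "(\<lambda>x. indicator ?K x *\<^sub>R h x) = (\<lambda>x. indicator C x * h x)"
      using that(2) by (force simp: indicator_def fun_eq_iff)
    ultimately show ?thesis by simp
  qed
  have If: "integrable lborel (\<lambda>x. indicator C x * f x)" using f z by (intro int) auto
  have If': "integrable lborel (\<lambda>x. indicator C x * f' x)" using f' z by (intro int) auto
  have sh: "integrable lborel (\<lambda>x. indicator C x * f (x + t *\<^sub>R e))
      \<and> (LBINT x. indicator C x * f (x + t *\<^sub>R e)) = (LBINT x. indicator C x * f x)" for t
  proof -
    have eq: "indicator C x * f (x + t *\<^sub>R e) = indicator C (t *\<^sub>R e + x) * f (t *\<^sub>R e + x)" for x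
      using mem[of x t] by (auto simp: indicator_def add.commute)
    have m: "(\<lambda>x. indicator C x * f x) \<in> borel_measurable borel" using If by simp
    have "integrable (distr lborel borel ((+) (t *\<^sub>R e))) (\<lambda>x. indicator C x * f x)"
      using If by (simp add: lborel_distr_plus)
    moreover have "integral\<^sup>L (distr lborel borel ((+) (t *\<^sub>R e))) (\<lambda>x. indicator C x * f x) 
       = (LBINT x. indicator C x * f x)"
      by (simp add: lborel_distr_plus)
    ultimately show ?thesis
      unfolding eq by (subst (asm) integrable_distr_eq, simp, simp add: m, subst (asm) integral_distr)
        (use m in auto)
  qed
  let ?q = "\<lambda>n x. indicator C x * ((f (x + inverse (real (Suc n)) *\<^sub>R e) - f x) / inverse (real (Suc n)))"
  have q0: "(LBINT x. ?q n x) = 0" for n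
  proof -
    have "?q n = (\<lambda>x. (indicator C x * f (x + inverse (real (Suc n)) *\<^sub>R e) - indicator C x * f x) / inverse (real (Suc n)))"
      by (auto simp: fun_eq_iff indicator_def)
    then have "(LBINT x. ?q n x) = ((LBINT x. indicator C x * f (x + inverse (real (Suc n)) *\<^sub>R e)) - (LBINT x. indicator C x * f x)) / inverse (real (Suc n))"
      using sh If by (simp only: integral_divide_zero Bochner_Integration.integral_diff)
    then show ?thesis using sh by simp
  qed
  have "(\<lambda>n. LBINT x. ?q n x) \<longlonglongrightarrow> (LBINT x. indicator C x * f' x)"
  proof (rule integral_dominated_convergence[where w="\<lambda>x. indicator (cball 0 (b + norm e)) x * B"])
    show "(\<lambda>x. indicator C x * f' x) \<in> borel_measurable lborel" using If' by simp
    show "?q n \<in> borel_measurable lborel" for n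
    proof -
      have "?q n = (\<lambda>x. (indicator C x * f (x + inverse (real (Suc n)) *\<^sub>R e) - indicator C x * f x) / inverse (real (Suc n)))"
        by (auto simp: fun_eq_iff indicator_def)
      moreover have "\<dots> \<in> borel_measurable lborel" using sh If by (intro borel_measurable_divide borel_measurable_diff borel_measurable_const borel_measurable_integrable) blast+
      ultimately show ?thesis by simp
    qed
    show "integrable lborel (\<lambda>x. indicator (cball (0::'a) (b + norm e)) x * B)"
      by (intro integrable_mult_left integrable_real_indicator) (use emeasure_lborel_cball_finite[of "0::'a" "b + norm e"] in auto)
    have lim0: "filterlim (\<lambda>n. inverse (real (Suc n))) (at 0) sequentially"
      using LIMSEQ_inverse_real_of_nat by (simp add: filterlim_at del: of_nat_Suc)
    show "AE x in lborel. (\<lambda>n. ?q n x) \<longlonglongrightarrow> indicator C x * f' x"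
    proof (rule AE_I2)
      fix x show "(\<lambda>n. ?q n x) \<longlonglongrightarrow> indicator C x * f' x"
      proof (cases "x \<in> C")
        case True
        then have "((\<lambda>h. (f (x + h *\<^sub>R e) - f x) / h) \<longlongrightarrow> f' x) (at 0)"
          using d[OF True] by (simp add: DERIV_def)
        from filterlim_compose[OF this lim0] show ?thesis using True by simp
      qed simp
    qed
    fix n
    show "AE x in lborel. norm (?q n x) \<le> indicator (cball 0 (b + norm e)) x * B"
    proof (rule AE_I2)
      fix x :: 'a
      define h where "h = inverse (real (Suc n))"
      have q: "?q n x = indicator C x * ((f (x + h *\<^sub>R e) - f x) / h)" by (simp only: h_def)
      have h: "0 < h" "h \<le> 1" unfolding h_def by (auto simp: inverse_le_1_iff)
      show "norm (?q n x) \<le> indicator (cball 0 (b + norm e)) x * B"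
      proof (cases "x \<in> C")
        case x: True
        obtain s where s: "0 < s" "s < h" "f (x + h *\<^sub>R e) - f (x + 0 *\<^sub>R e) = (h - 0) * f' (x + s *\<^sub>R e)"
          using MVT2[OF h(1), of "\<lambda>t. f (x + t *\<^sub>R e)" "\<lambda>t. f' (x + t *\<^sub>R e)"] d'[OF x] by blast
        then have *: "(f (x + h *\<^sub>R e) - f x) / h = f' (x + s *\<^sub>R e)" using h by simp
        have xs: "x + s *\<^sub>R e \<in> C" using C(2)[OF x] .
        show ?thesis
        proof (cases "norm x \<le> b + norm e")
          case True
          then show ?thesis using x B'[OF xs] by (simp only: q *) simp
        next
          case False
          have "s * norm e \<le> 1 * norm e" using s h by (intro mult_right_mono) auto
          then have "norm (x + s *\<^sub>R e) > b"
            using False norm_triangle_ineq2[of x "- (s *\<^sub>R e)"] s by auto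
          then have "f' (x + s *\<^sub>R e) = 0" using z[OF xs] by simp
          then show ?thesis using B x by (simp only: q *) simp
        qed
      qed (use B in auto)
    qed
  qed
  then have "(\<lambda>n. 0 :: real) \<longlonglongrightarrow> (LBINT x. indicator C x * f' x)" by (simp only: q0)
  then show ?thesis by (simp add: LIMSEQ_const_iff)
qed

lemma bdry_pt_nth [simp]: "bdry_pt y $ None = 0" "bdry_pt y $ Some a = y $ a"
  by (auto simp: bdry_pt_def)

lemma UNIV_option_sum: "(\<Sum>i\<in>UNIV. f i) = f None + (\<Sum>a\<in>UNIV. f (Some a))" for f :: "'m::finite option \<Rightarrow> 'b::comm_monoid_add"
  by (simp add: UNIV_option_conv sum.reindex)

lemma UNIV_option_prod: "(\<Prod>i\<in>UNIV. f i) = f None * (\<Prod>a\<in>UNIV. f (Some a))" for f :: "'m::finite option \<Rightarrow> 'b::comm_monoid_mult"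
  by (simp add: UNIV_option_conv prod.reindex)

lemma continuous_bdry_pt [continuous_intros]: 
  "continuous_on S f \<Longrightarrow> continuous_on S (\<lambda>x. bdry_pt (f x :: real^'m::finite))"
  unfolding bdry_pt_def
proof (rule continuous_on_vec_lambda)
  fix i assume "continuous_on S f"
  then show "continuous_on S (\<lambda>x. case i of None \<Rightarrow> 0 | Some a \<Rightarrow> f x $ a)"
    by (cases i) (auto intro!: continuous_intros)
qed

lemma bdry_pt_measurable [measurable]: "bdry_pt \<in> borel_measurable borel"
  by (rule borel_measurable_continuous_onI) (intro continuous_intros)

lemma norm_bdry_pt [simp]: "norm (bdry_pt y) = norm y"
  by (simp add: norm_vec_def L2_set_def UNIV_option_sum)

text \<open>
  Boxes determine Lebesgue measure, and a box is the product of its normal and tangential parts.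
\<close>

lemma lborel_half_space_split:
  "lborel = distr (lborel :: (real \<times> (real^'m::finite)) measure) borel (\<lambda>(t, y). bdry_pt y + t *\<^sub>R axis None 1)"
proof (rule lborel_eqI)
  fix l u :: "real^('m option)" 
  let ?T = "\<lambda>(t, y::real^'m). bdry_pt y + t *\<^sub>R axis None 1"
  assume le: "\<And>b. b \<in> Basis \<Longrightarrow> l \<bullet> b \<le> u \<bullet> b"
  have le': "l $ i \<le> u $ i" for i
    using le[of "axis i 1"] by (simp add: inner_axis)
  let ?l = "\<chi> a. l $ Some a" and ?u = "\<chi> a. u $ Some a"
  have m: "?T \<in> borel_measurable borel"
    unfolding case_prod_unfold by (rule borel_measurable_continuous_onI) (intro continuous_intros)
  have "emeasure (distr lborel borel ?T) (box l u) = emeasure lborel (?T -` box l u \<inter> space lborel)"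
    by (subst emeasure_distr) (use m in auto)
  also have "?T -` box l u \<inter> space lborel = {l $ None<..<u $ None} \<times> box ?l ?u"
    by (auto simp: mem_box_cart axis_def split_option_all)
  also have "emeasure lborel \<dots> = emeasure lborel {l $ None<..<u $ None} * emeasure lborel (box ?l ?u)"
    unfolding lborel_prod[symmetric] by (rule lborel.emeasure_pair_measure_Times) auto
  also have "\<dots> = ennreal (u $ None - l $ None) * ennreal (\<Prod>a\<in>UNIV. (u - l) $ Some a)"
  proof -
    have "emeasure lborel (box ?l ?u) = (\<Prod>b\<in>Basis. (?u - ?l) \<bullet> b)"
      by (rule emeasure_lborel_box) (auto simp: Basis_vec_def inner_axis le')
    also have "(\<Prod>b\<in>Basis. (?u - ?l) \<bullet> b) = (\<Prod>a\<in>UNIV. (u - l) $ Some a)"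
      by (simp add: Basis_vec_def UNION_singleton_eq_range prod.reindex inj_on_def axis_eq_axis inner_axis)
    finally show ?thesis using le' by simp
  qed
  also have "\<dots> = ennreal (\<Prod>i\<in>UNIV. (u - l) $ i)"
    using le' by (simp add: UNIV_option_prod ennreal_mult prod_nonneg)
  also have "(\<Prod>i\<in>UNIV. (u - l) $ i) = (\<Prod>b\<in>Basis. (u - l) \<bullet> b)"
    by (simp add: Basis_vec_def UNION_singleton_eq_range prod.reindex inj_on_def axis_eq_axis inner_axis)
  finally show "emeasure (distr lborel borel ?T) (box l u) = (\<Prod>b\<in>Basis. (u - l) \<bullet> b)" .
qed simp

text \<open>
  The fundamental theorem of calculus on each line normal to the hyperplane, then Fubini.
\<close>

lemma integral_half_space_normal_derivative:
  fixes f f' :: "real^('m::finite option) \<Rightarrow> real"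
  assumes f: "continuous_on half_space f" and f': "continuous_on half_space f'"
    and d: "\<And>x. x \<in> half_space \<Longrightarrow> has_pd half_space None f (f' x) x"
    and z: "\<And>x. x \<in> half_space \<Longrightarrow> norm x > b \<Longrightarrow> f x = 0 \<and> f' x = 0"
  shows "(LBINT x. indicator half_space x * f' x) = - (LBINT y. f (bdry_pt y))"
proof -
  let ?T = "\<lambda>(t, y::real^'m). bdry_pt y + t *\<^sub>R axis None 1"
  have m: "?T \<in> borel_measurable borel"
    unfolding case_prod_unfold by (rule borel_measurable_continuous_onI) (intro continuous_intros)
  let ?H = "half_space :: (real^('m option)) set"
  have H: "closed ?H" unfolding half_space_def
    by (rule closed_Collect_le) (auto intro!: continuous_intros)
  let ?K = "?H \<inter> cball 0 b"
  have K: "compact ?K" using H by (simp add: closed_Int_compact)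
  let ?F = "\<lambda>x. indicator ?H x * f' x"
  have "integrable lborel (\<lambda>x. indicator ?K x *\<^sub>R f' x)"
    by (intro borel_integrable_compact K continuous_on_subset[OF f']) auto
  moreover have "(\<lambda>x. indicator ?K x *\<^sub>R f' x) = ?F"
    using z by (force simp: indicator_def fun_eq_iff)
  ultimately have I: "integrable lborel ?F" by simp
  then have Fm: "?F \<in> borel_measurable borel" by simp
  have J: "integrable (lborel \<Otimes>\<^sub>M lborel) (\<lambda>(t, y). ?F (?T (t, y)))"
    unfolding lborel_prod using I
    by (subst (asm) lborel_half_space_split, subst (asm) integrable_distr_eq)
      (use m Fm in \<open>auto simp: case_prod_unfold\<close>)
  have "(LBINT x. ?F x) = (LBINT p. ?F (?T p))"
    by (subst lborel_half_space_split, subst integral_distr) (use m Fm in auto)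
  also have "\<dots> = integral\<^sup>L (lborel \<Otimes>\<^sub>M lborel) (\<lambda>(t, y). ?F (?T (t, y)))"
    unfolding lborel_prod by (simp add: case_prod_unfold)
  also have "\<dots> = (LBINT y. LBINT t. ?F (?T (t, y)))"
    using lborel_pair.integral_snd[OF J] by (simp add: case_prod_unfold)
  also have "\<dots> = (LBINT y. - f (bdry_pt y))"
  proof (rule Bochner_Integration.integral_cong[OF refl])
    fix y :: "real^'m"
    let ?g = "\<lambda>t. f (bdry_pt y + t *\<^sub>R axis None 1)" and ?g' = "\<lambda>t. f' (bdry_pt y + t *\<^sub>R axis None 1)"
    have inH: "bdry_pt y + t *\<^sub>R axis None 1 \<in> ?H \<longleftrightarrow> t \<ge> 0" for t
      by (simp add: half_space_def)
    (* Beyond height c the function vanishes. *)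
    define c where "c = max 0 b + 1"
    have nb: "norm (bdry_pt y + t *\<^sub>R axis None 1) > b" if "t \<ge> c" for t
    proof -
      have "\<bar>(bdry_pt y + t *\<^sub>R axis None 1) $ None\<bar> \<le> norm (bdry_pt y + t *\<^sub>R axis None 1)"
        by (rule component_le_norm_cart)
      then show ?thesis using that by (auto simp: c_def)
    qed
    have c: "c > 0" by (simp add: c_def)
    have "(LBINT t. ?F (?T (t, y))) = (LBINT t. indicator {0..c} t *\<^sub>R ?g' t)"
    proof (rule Bochner_Integration.integral_cong[OF refl])
      fix t show "?F (?T (t, y)) = indicator {0..c} t *\<^sub>R ?g' t"
        using inH[of t] nb[of t] z[of "bdry_pt y + t *\<^sub>R axis None 1"] by (auto simp: indicator_def)
    qed
    also have "\<dots> = ?g c - ?g 0"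
    proof (rule integral_FTC_atLeastAtMost)
      show "continuous_on {0..c} ?g'"
        by (rule continuous_on_compose2[OF f']) (auto intro!: continuous_intros simp: inH)
      fix t assume t: "0 \<le> t" "t \<le> c"
      have "(?g has_real_derivative ?g' t) (at t within {t. bdry_pt y + t *\<^sub>R axis None 1 \<in> ?H})"
        by (rule has_pd_shift, rule d) (use inH t in auto)
      then show "(?g has_vector_derivative ?g' t) (at t within {0..c})"
        unfolding has_real_derivative_iff_has_vector_derivative
        by (rule has_vector_derivative_within_subset) (auto simp: inH)
    qed (use c in auto)
    also have "?g c = 0" using z[of "bdry_pt y + c *\<^sub>R axis None 1"] nb[of c] inH c by auto
    finally show "(LBINT t. ?F (?T (t, y))) = - f (bdry_pt y)" by simp
  qed
  finally show ?thesis by simp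
qed

lemma has_pd_cong:
  assumes "has_pd S i f d x" "x \<in> S" "\<And>y. y \<in> S \<Longrightarrow> f y = f' y"
  shows "has_pd S i f' d x"
  using assms unfolding has_pd_def
  by (elim has_field_derivative_transform_within[where d=1]) auto

lemma has_pd_mono: "has_pd S i f d x \<Longrightarrow> T \<subseteq> S \<Longrightarrow> has_pd T i f d x"
  unfolding has_pd_def by (erule DERIV_subset) auto

lemma has_pd_const: "has_pd S i (\<lambda>_. c) 0 x"
  unfolding has_pd_def by simp

lemma has_pd_coord: "has_pd S i (\<lambda>x. x $ k) (if i = k then 1 else 0) (x :: real^'n::finite)"
proof -
  have eq: "(\<lambda>t. (x + t *\<^sub>R axis i 1) $ k) = (\<lambda>t. x $ k + t * (if i = k then 1 else 0))"
    by (auto simp: axis_def fun_eq_iff)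
  show ?thesis unfolding has_pd_def eq by (rule derivative_eq_intros | simp)+
qed

lemma has_pd_add: "has_pd S i f d x \<Longrightarrow> has_pd S i g e x \<Longrightarrow> has_pd S i (\<lambda>y. f y + g y) (d + e) x"
  unfolding has_pd_def by (rule DERIV_add)

lemma has_pd_diff: "has_pd S i f d x \<Longrightarrow> has_pd S i g e x \<Longrightarrow> has_pd S i (\<lambda>y. f y - g y) (d - e) x"
  unfolding has_pd_def by (rule DERIV_diff)

lemma has_pd_minus: "has_pd S i f d x \<Longrightarrow> has_pd S i (\<lambda>y. - f y) (- d) x"
  unfolding has_pd_def by (rule DERIV_minus)

lemma has_pd_mult: "has_pd S i f d x \<Longrightarrow> has_pd S i g e x \<Longrightarrow> has_pd S i (\<lambda>y. f y * g y) (d * g x + f x * e) x"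
  unfolding has_pd_def by (drule (1) DERIV_mult) (simp add: mult.commute[of _ "f x"])

lemma has_pd_sum: "(\<And>k. k \<in> A \<Longrightarrow> has_pd S i (f k) (d k) x) \<Longrightarrow> has_pd S i (\<lambda>y. \<Sum>k\<in>A. f k y) (\<Sum>k\<in>A. d k) x"
  unfolding has_pd_def by (rule DERIV_sum)

lemma has_pd_chain:
  assumes "(h has_real_derivative h') (at (f x))" "has_pd S i f d x"
  shows "has_pd S i (\<lambda>y. h (f y)) (h' * d) x"
  using assms unfolding has_pd_def
  by (auto intro: DERIV_chain2[where g="\<lambda>t. f (x + t *\<^sub>R axis i 1)"])

lemma has_pd_norm: 
  assumes "x \<noteq> 0"
  shows "has_pd S i norm (x $ i / norm x) x"
proof -
  have "has_pd S i (\<lambda>x. \<Sum>k\<in>UNIV. x $ k * x $ k) (\<Sum>k\<in>UNIV. (if i = k then 1 else 0) * x $ k + x $ k * (if i = k then 1 else 0)) x"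
    by (intro has_pd_sum has_pd_mult has_pd_coord)
  also have "(\<Sum>k\<in>UNIV. (if i = k then 1 else 0) * x $ k + x $ k * (if i = k then 1 else 0)) = 2 * x $ i"
  proof -
    have "(\<Sum>k\<in>UNIV. (if i = k then 1 else 0) * x $ k + x $ k * (if i = k then 1 else 0)) 
      = (\<Sum>k\<in>UNIV. if i = k then 2 * x $ k else 0)"
      by (rule sum.cong) auto
    then show ?thesis by simp
  qed
  also have "(\<lambda>x. \<Sum>k\<in>UNIV. x $ k * x $ k) = (\<lambda>x::real^'a. (norm x)\<^sup>2)"
    by (auto simp: norm_vec_def L2_set_def sum_nonneg power2_eq_square)
  finally have 1: "has_pd S i (\<lambda>x. (norm x)\<^sup>2) (2 * x $ i) x" .
  have "has_pd S i (\<lambda>x. sqrt ((norm x)\<^sup>2)) (inverse (sqrt ((norm x)\<^sup>2)) / 2 * (2 * x $ i)) x"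
    by (rule has_pd_chain[OF DERIV_real_sqrt 1]) (use assms in auto)
  moreover have "inverse (sqrt ((norm x)\<^sup>2)) / 2 * (2 * x $ i) = x $ i / norm x"
    by (simp add: field_simps)
  ultimately show ?thesis by simp
qed

lemma is_cone_half_space: "is_cone half_space"
proof -
  have "closed (half_space :: (real^('m::finite option)) set)" unfolding half_space_def
    by (rule closed_Collect_le) (auto intro!: continuous_intros)
  then show ?thesis by (auto simp: is_cone_def half_space_def)
qed

lemma cutoff_continuous:
  fixes V :: "'a::euclidean_space \<Rightarrow> real"
  assumes V: "continuous_on (C - cball 0 1) V" and \<phi>: "continuous_on UNIV \<phi>" 
    and a: "1 < a" and z: "\<And>r. r \<notin> {a..c} \<Longrightarrow> \<phi> r = 0"
  shows "continuous_on C (\<lambda>x. \<phi> (norm x) * V x)"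
proof -
  let ?F = "\<lambda>x. \<phi> (norm x) * V x"
  have p: "continuous_on S (\<lambda>x::'a. \<phi> (norm x))" for S
    by (rule continuous_on_compose2[OF \<phi>]) (auto intro!: continuous_intros)
  have 1: "continuous_on (C - cball 0 1) ?F" by (intro continuous_intros p V)
  have "continuous_on (C \<inter> ball 0 a) (\<lambda>_::'a. 0 :: real)" by simp
  then have 2: "continuous_on (C \<inter> ball 0 a) ?F"
    by (rule continuous_on_eq) (use z in auto)
  have "C = (C - cball 0 1) \<union> (C \<inter> ball 0 a)" using a by auto
  moreover have "continuous_on ((C - cball 0 1) \<union> (C \<inter> ball 0 a)) ?F"
  proof (rule continuous_on_Un_local_open[OF _ _ 1 2])
    show "openin (top_of_set ((C - cball 0 1) \<union> (C \<inter> ball 0 a))) (C - cball 0 1)"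
      unfolding openin_open by (rule exI[of _ "- cball 0 1"]) (use a in auto)
    show "openin (top_of_set ((C - cball 0 1) \<union> (C \<inter> ball 0 a))) (C \<inter> ball 0 a)"
      unfolding openin_open by (rule exI[of _ "ball 0 a"]) (use a in auto)
  qed
  ultimately show ?thesis by simp
qed

text \<open>
  Partial derivatives only depend on the set near the point; this moves them between the half-space
  and the end.
\<close>

lemma has_pd_local:
  assumes "has_pd S i f d x" "open U" "x \<in> U" "T \<inter> U \<subseteq> S"  
  shows "has_pd T i f d x"
proof -
  let ?l = "\<lambda>t. x + t *\<^sub>R axis i 1"
  have U: "open (?l -` U)" by (rule open_vimage[OF assms(2)]) (intro continuous_intros)
  have 0: "0 \<in> ?l -` U" using assms(3) by simp
  have "((\<lambda>t. f (?l t)) has_real_derivative d) (at 0 within {t. ?l t \<in> T} \<inter> ?l -` U)"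
    using assms(1) unfolding has_pd_def by (rule DERIV_subset) (use assms(4) in auto)
  then show ?thesis unfolding has_pd_def
    by (subst at_within_nhd[OF 0 U, of _ "{t. ?l t \<in> T} \<inter> ?l -` U"]) auto
qed

text \<open>
  Because \<open>\<phi>\<close> vanishes near radius \<open>1\<close>, the product extends by \<open>0\<close> from the end to the whole cone.
\<close>

lemma cutoff_has_pd:
  assumes V: "\<And>x. x \<in> C - cball 0 1 \<Longrightarrow> has_pd (C - cball 0 1) k V (V' x) x"
    and \<phi>: "\<And>r. (\<phi> has_real_derivative \<phi>' r) (at r)"
    and a: "1 < a" and z: "\<And>r. r \<notin> {a..c} \<Longrightarrow> \<phi> r = 0 \<and> \<phi>' r = 0"
    and x: "x \<in> C"
  shows "has_pd C k (\<lambda>x. \<phi> (norm x) * V x) (\<phi>' (norm x) * (V x * (x $ k / norm x)) + \<phi> (norm x) * V' x) x"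
proof (cases "norm x > 1")
  case True
  then have xD: "x \<in> C - cball 0 1" using x by auto
  have n: "has_pd (C - cball 0 1) k (\<lambda>x. \<phi> (norm x)) (\<phi>' (norm x) * (x $ k / norm x)) x"
    by (rule has_pd_chain[OF \<phi> has_pd_norm]) (use True in auto)
  have "has_pd (C - cball 0 1) k (\<lambda>x. \<phi> (norm x) * V x) 
     (\<phi>' (norm x) * (V x * (x $ k / norm x)) + \<phi> (norm x) * V' x) x"
    using has_pd_mult[OF n V[OF xD]] by (simp add: mult_ac)
  then show ?thesis
    by (rule has_pd_local[where U="- cball 0 1"]) (use True in auto)
next
  case False
  have "has_pd (C \<inter> ball 0 a) k (\<lambda>x. 0) 0 x" by (rule has_pd_const)
  then have "has_pd (C \<inter> ball 0 a) k (\<lambda>x. \<phi> (norm x) * V x) 0 x"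
    by (rule has_pd_cong) (use False x a z in auto)
  then have "has_pd C k (\<lambda>x. \<phi> (norm x) * V x) 0 x"
    by (rule has_pd_local[where U="ball 0 a"]) (use False a in auto)
  moreover have "\<phi> (norm x) = 0" "\<phi>' (norm x) = 0" using z[of "norm x"] False a by auto
  ultimately show ?thesis by simp
qed

lemma cutoff_pd_continuous:
  fixes V V' :: "real^'n::finite \<Rightarrow> real"
  assumes V: "continuous_on (C - cball 0 1) V" and V': "continuous_on (C - cball 0 1) V'"
    and \<phi>: "\<And>r. (\<phi> has_real_derivative \<phi>' r) (at r)" and \<phi>': "continuous_on UNIV \<phi>'"
    and a: "1 < a" and z: "\<And>r. r \<notin> {a..c} \<Longrightarrow> \<phi> r = 0 \<and> \<phi>' r = 0"
  shows "continuous_on C (\<lambda>x. \<phi> (norm x) * V x)"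
    "continuous_on C (\<lambda>x. \<phi>' (norm x) * (V x * (x $ k / norm x)) + \<phi> (norm x) * V' x)"
proof -
  have \<phi>c: "continuous_on UNIV \<phi>"
    using \<phi> DERIV_isCont by (intro continuous_at_imp_continuous_on) blast
  show "continuous_on C (\<lambda>x. \<phi> (norm x) * V x)"
    by (rule cutoff_continuous[OF V \<phi>c a]) (use z in auto)
  show "continuous_on C (\<lambda>x. \<phi>' (norm x) * (V x * (x $ k / norm x)) + \<phi> (norm x) * V' x)"
    by (intro continuous_on_add cutoff_continuous[OF V' \<phi>c a] cutoff_continuous[OF _ \<phi>' a] continuous_intros V)
      (use z in auto)
qed

lemma cone_int_cong:
  assumes "\<And>x. x \<in> C \<Longrightarrow> norm x = r \<Longrightarrow> f x = g x"
  shows "cone_int C f r = cone_int C g r"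
  unfolding cone_int_def set_lebesgue_integral_def
  by (rule Bochner_Integration.integral_cong) (use assms in \<open>auto simp: indicator_def\<close>)

lemma cone_int_add:
  assumes "is_cone C" "continuous_on (C - cball 0 1) f" "continuous_on (C - cball 0 1) g" "r > 1"
  shows "cone_int C (\<lambda>x. f x + g x) r = cone_int C f r + cone_int C g r"
  unfolding cone_int_def using assms by (intro set_integral_add(2) cone_set_integrable)

lemma cone_int_cmult: "cone_int C (\<lambda>x. c * f x) r = c * cone_int C f r"
  unfolding cone_int_def by simp

text \<open>
  The derivative of the vanishing function \<open>t \<mapsto> \<integral>\<^sub>s\<^sup>t h\<close>.
\<close>

lemma integral_zero_imp_zero:
  fixes h :: "real \<Rightarrow> real"
  assumes h: "continuous_on {1<..} h" and z: "\<And>s t. 1 < s \<Longrightarrow> s \<le> t \<Longrightarrow> integral {s..t} h = 0" and r: "1 < r"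
  shows "h r = 0"
proof -
  define s where "s = (1 + r) / 2"
  have s: "1 < s" "s < r" using r by (auto simp: s_def)
  have "((\<lambda>t. integral {s..t} h) has_real_derivative h r) (at r within {s..r+1})"
    by (rule integral_has_real_derivative) (use s in \<open>auto intro: continuous_on_subset[OF h]\<close>)
  moreover have "((\<lambda>t. integral {s..t} h) has_real_derivative 0) (at r within {s..r+1})"
  proof -
    have "((\<lambda>t. 0::real) has_real_derivative 0) (at r within {s..r+1})" by simp
    then show ?thesis
      by (rule has_field_derivative_transform_within[where d=1]) (use s z in auto)
  qed
  moreover have "at r within {s..r+1} = at r" using s by (intro at_within_Icc_at) auto
  ultimately show ?thesis by (simp add: DERIV_unique)
qed

text \<open>
  A cone \<open>C\<close> on which integration by parts in direction \<open>k\<close> produces a boundary term with weight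
  \<open>\<beta> k\<close>; \<open>\<iota>\<close> parametrises the boundary by a Euclidean space and preserves norms, so that cut-offs
  \<open>\<phi>(|x|)\<close> restrict to cut-offs on the boundary.  The whole space is the case \<open>\<beta> = 0\<close>.
\<close>

locale cone_integration_by_parts =
  fixes C :: "(real^'n::finite) set" and \<iota> :: "'b::euclidean_space \<Rightarrow> real^'n" and \<beta> :: "'n \<Rightarrow> real"
  assumes cone: "is_cone C"
    and \<iota>: "continuous_on UNIV \<iota>" "\<And>y. \<iota> y \<in> C" "\<And>y. norm (\<iota> y) = norm y"
    and by_parts: "\<And>k f f' c. continuous_on C f \<Longrightarrow> continuous_on C f' \<Longrightarrow>
        (\<And>x. x \<in> C \<Longrightarrow> has_pd C k f (f' x) x) \<Longrightarrow>
        (\<And>x. x \<in> C \<Longrightarrow> norm x > c \<Longrightarrow> f x = 0 \<and> f' x = 0) \<Longrightarrow>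
        (LBINT x. indicator C x * f' x) = - (\<beta> k * (LBINT y. f (\<iota> y)))"
begin

lemma \<iota>_continuous: "continuous_on (C - cball 0 1) f \<Longrightarrow> continuous_on (UNIV - cball 0 1) (\<lambda>y. f (\<iota> y))"
  by (rule continuous_on_compose2[of "C - cball 0 1" f]) (use \<iota> in \<open>auto intro: continuous_on_subset\<close>)

text \<open>
  Integration by parts of the cut-off field \<open>\<phi>(|x|) V\<close> produces \<open>\<phi>' V\<cdot>x/|x| + \<phi> div V\<close>.
\<close>

theorem divergence_theorem:
  fixes V V' :: "'n \<Rightarrow> real^'n \<Rightarrow> real"
  assumes V: "\<And>k. continuous_on (C - cball 0 1) (V k)" and V': "\<And>k. continuous_on (C - cball 0 1) (V' k)"
    and d: "\<And>k x. x \<in> C - cball 0 1 \<Longrightarrow> has_pd (C - cball 0 1) k (V k) (V' k x) x"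
    and s: "1 < s" "s \<le> t"
  shows "cone_int C (\<lambda>x. \<Sum>k\<in>UNIV. V k x * (x $ k / norm x)) t
      - cone_int C (\<lambda>x. \<Sum>k\<in>UNIV. V k x * (x $ k / norm x)) s
     = integral {s..t} (\<lambda>r. cone_int C (\<lambda>x. \<Sum>k\<in>UNIV. V' k x) r
          + cone_int UNIV (\<lambda>y. \<Sum>k\<in>UNIV. \<beta> k * V k (\<iota> y)) r)"
proof (rule weak_radial_FTC[OF cone _ _ _ _ s])
  have U: "is_cone (UNIV :: 'b set)" by (simp add: is_cone_def)
  show p: "continuous_on (C - cball 0 1) (\<lambda>x. \<Sum>k\<in>UNIV. V k x * (x $ k / norm x))"
    using V by (auto intro!: continuous_intros)
  show q: "continuous_on (C - cball 0 1) (\<lambda>x. \<Sum>k\<in>UNIV. V' k x)"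
    using V' by (auto intro!: continuous_intros)
  show "continuous_on (UNIV - cball 0 1) (\<lambda>y. \<Sum>k\<in>UNIV. \<beta> k * V k (\<iota> y))"
    by (intro continuous_on_sum continuous_on_mult continuous_on_const \<iota>_continuous V)
  fix \<phi> \<phi>' :: "real \<Rightarrow> real" and a c :: real
  assume *: "1 < a" "\<And>r. (\<phi> has_real_derivative \<phi>' r) (at r)" "continuous_on UNIV \<phi>'"
    "\<And>r. r \<notin> {a..c} \<Longrightarrow> \<phi> r = 0 \<and> \<phi>' r = 0"
  have \<phi>c: "continuous_on UNIV \<phi>"
    using *(2) DERIV_isCont by (intro continuous_at_imp_continuous_on) blast
  let ?F = "\<lambda>k x. \<phi> (norm x) * V k x"
  let ?F' = "\<lambda>k x. \<phi>' (norm x) * (V k x * (x $ k / norm x)) + \<phi> (norm x) * V' k x"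
  have pd: "has_pd C k (?F k) (?F' k x) x" if "x \<in> C" for k x
    by (rule cutoff_has_pd[OF d *(2,1,4) that])
  note cont = cutoff_pd_continuous[OF V V' *(2,3,1,4)]
  have zero: "?F k x = 0 \<and> ?F' k x = 0" if "norm x > c" for k x
    using *(4)[of "norm x"] that by auto
  have int: "integrable lborel (\<lambda>x. indicator C x * ?F' k x)" for k
  proof -
    have cl: "closed C" using cone by (auto simp: is_cone_def)
    have "integrable lborel (\<lambda>x. indicator (C \<inter> cball 0 c) x *\<^sub>R ?F' k x)"
      by (intro borel_integrable_compact closed_Int_compact cl continuous_on_subset[OF cont(2)]) auto
    moreover have "(\<lambda>x. indicator (C \<inter> cball 0 c) x *\<^sub>R ?F' k x) = (\<lambda>x. indicator C x * ?F' k x)"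
      using zero by (force simp: indicator_def fun_eq_iff)
    ultimately show ?thesis by simp
  qed
  have bdry: "integrable lborel (\<lambda>y. \<phi> (norm y) * V k (\<iota> y))" for k
    using cone_integral_polar(1)[OF U \<iota>_continuous[OF V] \<phi>c *(1), of c k] *(4) by simp
  have "(LBINT x. \<Sum>k\<in>UNIV. indicator C x * ?F' k x) = (\<Sum>k\<in>UNIV. LBINT x. indicator C x * ?F' k x)"
    by (rule Bochner_Integration.integral_sum) (use int in blast)
  also have "\<dots> = (\<Sum>k\<in>UNIV. - (\<beta> k * (LBINT y. \<phi> (norm y) * V k (\<iota> y))))"
  proof (rule sum.cong[OF refl])
    fix k
    have "(LBINT x. indicator C x * ?F' k x) = - (\<beta> k * (LBINT y. ?F k (\<iota> y)))"
      by (rule by_parts[where c=c]) (use cont zero pd in blast)+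
    then show "(LBINT x. indicator C x * ?F' k x) = - (\<beta> k * (LBINT y. \<phi> (norm y) * V k (\<iota> y)))"
      by (simp only: \<iota>(3))
  qed
  also have "\<dots> = - (LBINT y. (\<Sum>k\<in>UNIV. \<beta> k * (\<phi> (norm y) * V k (\<iota> y))))"
    using bdry by (simp add: sum_negf)
  also have "(\<lambda>y. \<Sum>k\<in>UNIV. \<beta> k * (\<phi> (norm y) * V k (\<iota> y))) = (\<lambda>y. \<phi> (norm y) * (\<Sum>k\<in>UNIV. \<beta> k * V k (\<iota> y)))"
    by (simp only: sum_distrib_left mult.left_commute)
  finally have 1: "(LBINT x. \<Sum>k\<in>UNIV. indicator C x * ?F' k x) = - (LBINT y. \<phi> (norm y) * (\<Sum>k\<in>UNIV. \<beta> k * V k (\<iota> y)))" .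
  have "(\<lambda>x. \<Sum>k\<in>UNIV. indicator C x * ?F' k x) =
     (\<lambda>x. indicator C x * (\<phi>' (norm x) * (\<Sum>k\<in>UNIV. V k x * (x $ k / norm x)))
        + indicator C x * (\<phi> (norm x) * (\<Sum>k\<in>UNIV. V' k x)))"
    by (auto simp: fun_eq_iff sum_distrib_left sum.distrib distrib_left)
  then have "(LBINT x. \<Sum>k\<in>UNIV. indicator C x * ?F' k x) =
     (LBINT x. indicator C x * (\<phi>' (norm x) * (\<Sum>k\<in>UNIV. V k x * (x $ k / norm x))))
      + (LBINT x. indicator C x * (\<phi> (norm x) * (\<Sum>k\<in>UNIV. V' k x)))"
    using cone_integral_polar(1)[OF cone p *(3,1), of c]
      cone_integral_polar(1)[OF cone q \<phi>c *(1), of c] *(4)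
    by simp
  with 1 show "(LBINT x. indicator C x * (\<phi>' (norm x) * (\<Sum>k\<in>UNIV. V k x * (x $ k / norm x))))
      + (LBINT x. indicator C x * (\<phi> (norm x) * (\<Sum>k\<in>UNIV. V' k x)))
     + (LBINT y. \<phi> (norm y) * (\<Sum>k\<in>UNIV. \<beta> k * V k (\<iota> y))) = 0" by simp
qed

text \<open>
  For a field tangent to the spheres the flux through every sphere vanishes, so the continuous
  integrand of the divergence theorem has integral \<open>0\<close> over all intervals of radii.
\<close>

theorem tangential_divergence_theorem:
  fixes V V' :: "'n \<Rightarrow> real^'n \<Rightarrow> real"
  assumes V: "\<And>k. continuous_on (C - cball 0 1) (V k)" and V': "\<And>k. continuous_on (C - cball 0 1) (V' k)"
    and d: "\<And>k x. x \<in> C - cball 0 1 \<Longrightarrow> has_pd (C - cball 0 1) k (V k) (V' k x) x"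
    and tan: "\<And>x. x \<in> C - cball 0 1 \<Longrightarrow> (\<Sum>k\<in>UNIV. V k x * x $ k) = 0" and r: "1 < r"
  shows "cone_int C (\<lambda>x. \<Sum>k\<in>UNIV. V' k x) r + cone_int UNIV (\<lambda>y. \<Sum>k\<in>UNIV. \<beta> k * V k (\<iota> y)) r = 0"
proof (rule integral_zero_imp_zero[OF _ _ r])
  show "continuous_on {1<..} (\<lambda>r. cone_int C (\<lambda>x. \<Sum>k\<in>UNIV. V' k x) r
     + cone_int UNIV (\<lambda>y. \<Sum>k\<in>UNIV. \<beta> k * V k (\<iota> y)) r)"
    by (intro continuous_on_add cone_int_continuous cone continuous_on_sum continuous_on_mult continuous_on_const
        \<iota>_continuous V V') (simp add: is_cone_def)
  fix s t :: real assume st: "1 < s" "s \<le> t"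
  have "cone_int C (\<lambda>x. \<Sum>k\<in>UNIV. V k x * (x $ k / norm x)) u = cone_int C (\<lambda>x. 0) u" if "1 < u" for u
  proof (rule cone_int_cong)
    fix x assume "x \<in> C" "norm x = u"
    then have "x \<in> C - cball 0 1" using that by simp
    from tan[OF this] show "(\<Sum>k\<in>UNIV. V k x * (x $ k / norm x)) = 0"
      by (simp add: sum_divide_distrib[symmetric])
  qed
  then show "integral {s..t} (\<lambda>r. cone_int C (\<lambda>x. \<Sum>k\<in>UNIV. V' k x) r
     + cone_int UNIV (\<lambda>y. \<Sum>k\<in>UNIV. \<beta> k * V k (\<iota> y)) r) = 0"
    using divergence_theorem[OF V V' d st] st by (simp add: cone_int_def[of C "\<lambda>_. 0"])
qed

end

interpretation half_space: cone_integration_by_parts half_space bdry_pt "\<lambda>k. if None = k then 1 else 0"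
proof
  show "is_cone half_space" by (rule is_cone_half_space)
  show "continuous_on UNIV bdry_pt" by (intro continuous_intros)
  fix k :: "'m::finite option" and f f' :: "real^('m option) \<Rightarrow> real" and c
  let ?H = "half_space :: (real^('m option)) set"
  assume f: "continuous_on ?H f" "continuous_on ?H f'" and pd: "\<And>x. x \<in> ?H \<Longrightarrow> has_pd ?H k f (f' x) x"
    and z: "\<And>x. x \<in> ?H \<Longrightarrow> norm x > c \<Longrightarrow> f x = 0 \<and> f' x = 0"
  show "(LBINT x. indicator ?H x * f' x) = - ((if None = k then 1 else 0) * (LBINT y. f (bdry_pt y)))"
  proof (cases k)
    case None
    then show ?thesis using integral_half_space_normal_derivative[OF f _ z] pd by simp
  next
    case (Some b)
    have inH: "x + t *\<^sub>R axis (Some b) 1 \<in> ?H" if "x \<in> ?H" for x t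
      using that by (simp add: half_space_def axis_def)
    have "(LBINT x. indicator ?H x * f' x) = 0"
    proof (rule integral_translation_derivative[OF _ inH f _ z])
      fix x assume x: "x \<in> ?H"
      have "{t. x + t *\<^sub>R axis (Some b) 1 \<in> ?H} = UNIV" using inH[OF x] by auto
      then show "((\<lambda>t. f (x + t *\<^sub>R axis (Some b) 1)) has_real_derivative f' x) (at 0)"
        using pd[OF x] Some by (simp add: has_pd_def)
    qed (use is_cone_half_space in \<open>auto simp: is_cone_def\<close>)
    then show ?thesis using Some by simp
  qed
qed (auto simp: half_space_def)

interpretation whole_space: cone_integration_by_parts "UNIV :: (real^'n::finite) set" "\<lambda>y. y" "\<lambda>_. 0"
proof
  fix k :: 'n and f f' :: "real^'n \<Rightarrow> real" and c
  assume "continuous_on UNIV f" "continuous_on UNIV f'" "\<And>x. x \<in> UNIV \<Longrightarrow> has_pd UNIV k f (f' x) x"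
    "\<And>x. x \<in> UNIV \<Longrightarrow> norm x > c \<Longrightarrow> f x = 0 \<and> f' x = 0"
  then show "(LBINT x. indicator UNIV x * f' x) = - (0 * (LBINT y. f y))"
    using integral_translation_derivative[of UNIV "axis k 1" f f' c] by (simp add: has_pd_def)
qed (auto simp: is_cone_def)

lemma sum_delta_mult:
  fixes f :: "'n::finite \<Rightarrow> real"
  shows "(\<Sum>i\<in>UNIV. f i * (if k = i then 1 else 0)) = f k" "(\<Sum>i\<in>UNIV. (if k = i then 1 else 0) * f i) = f k"
  by (simp_all add: if_distrib[of "\<lambda>c. c * _"] if_distrib[of "\<lambda>c. _ * c"] cong: if_cong)

lemmas half_space_divergence_theorem =
  half_space.divergence_theorem[folded end_region_def, unfolded sum_delta_mult]
lemmas half_space_tangential_divergence =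
  half_space.tangential_divergence_theorem[folded end_region_def, unfolded sum_delta_mult]

lemma cone_int_zero: "cone_int C (\<lambda>_. 0) r = 0"
  by (simp add: cone_int_def)

lemmas exterior_divergence_theorem =
  whole_space.divergence_theorem[folded Compl_eq_Diff_UNIV,
    unfolded mult_zero_left sum.neutral_const cone_int_zero add_0_right]
lemmas exterior_tangential_divergence =
  whole_space.tangential_divergence_theorem[folded Compl_eq_Diff_UNIV,
    unfolded mult_zero_left sum.neutral_const cone_int_zero add_0_right]

section \<open>Partial derivatives on the end\<close>

lemma has_pd_imp_partial_deriv:
  assumes "has_pd S i f d x" "at 0 within {t. x + t *\<^sub>R axis i 1 \<in> S} \<noteq> bot"
  shows "partial_deriv S i f x = d"
  using assms unfolding has_pd_def partial_deriv_def has_real_derivative_iff_has_vector_derivative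
  by (auto intro: vector_derivative_within)

lemma differentiable_imp_has_pd:
  assumes "f differentiable (at x within S)"
  shows "\<exists>d. has_pd S i f d x"
proof -
  let ?l = "\<lambda>t::real. x + t *\<^sub>R axis i 1"
  obtain f' where f': "(f has_derivative f') (at x within S)" using assms unfolding differentiable_def by blast
  have l: "(?l has_derivative (\<lambda>t. t *\<^sub>R axis i 1)) (at 0 within {t. ?l t \<in> S})"
    by (auto intro!: derivative_eq_intros)
  have "(f has_derivative f') (at (?l 0) within ?l ` {t. ?l t \<in> S})"
    by (simp, rule has_derivative_subset[OF f']) auto
  from has_derivative_in_compose[OF l this]
  have "((\<lambda>t. f (?l t)) has_derivative (\<lambda>t. f' (t *\<^sub>R axis i 1))) (at 0 within {t. ?l t \<in> S})" .
  moreover have "(\<lambda>t. f' (t *\<^sub>R axis i 1)) = (*) (f' (axis i 1))"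
    using has_derivative_linear[OF f'] by (auto simp: linear_cmul fun_eq_iff)
  ultimately show ?thesis unfolding has_pd_def has_field_derivative_def by auto
qed

text \<open>
  One-sided derivatives at the boundary are unique because moving in the positive direction stays in
  the half-space, and moving a little stays outside the unit ball.
\<close>

lemma end_region_nontrivial:
  assumes "x \<in> end_region"
  shows "at 0 within {t. x + t *\<^sub>R axis i 1 \<in> end_region} \<noteq> bot"
proof -
  let ?l = "\<lambda>t::real. x + t *\<^sub>R axis i 1"
  have U: "open (?l -` (- cball 0 1))" by (rule open_vimage) (auto intro!: continuous_intros)
  have 0: "0 \<in> ?l -` (- cball 0 1)" using assms by (simp add: end_region_def)
  have "at 0 within {t. ?l t \<in> end_region} = at 0 within {t. ?l t \<in> half_space}"
    by (rule at_within_nhd[OF 0 U]) (auto simp: end_region_def)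
  moreover have "at (0::real) within {0..} \<le> at 0 within {t. ?l t \<in> half_space}"
    by (rule at_le) (use assms in \<open>auto simp: half_space_def end_region_def axis_def\<close>)
  moreover have "at (0::real) within {0..} \<noteq> bot"
    by (simp add: at_within_Ici_at_right)
  ultimately show ?thesis by (metis bot.extremum_uniqueI)
qed

lemma partial_deriv_end_eq:
  "has_pd end_region i f d x \<Longrightarrow> x \<in> end_region \<Longrightarrow> partial_deriv end_region i f x = d"
  using end_region_nontrivial has_pd_imp_partial_deriv by blast

lemma partial_deriv_end_has_pd:
  assumes "f differentiable_on end_region" "x \<in> end_region"
  shows "has_pd end_region i f (partial_deriv end_region i f x) x"
proof -
  obtain d where "has_pd end_region i f d x"
    using assms differentiable_imp_has_pd unfolding differentiable_on_def by blast
  then show ?thesis using partial_deriv_end_eq assms(2) by blast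
qed

text \<open>
  The mean value theorem applied twice to the second difference quotient; exchanging \<open>k\<close> and \<open>l\<close>
  leaves the second difference unchanged, whence the symmetry of mixed partial derivatives.
\<close>

lemma mixed_difference:
  fixes x :: "real^'n::finite"
  assumes ball: "ball x r \<subseteq> U" and h: "0 < h" "2 * h < r"
    and fk: "\<And>y. y \<in> U \<Longrightarrow> has_pd U k f (fk y) y"
    and fkl: "\<And>y. y \<in> U \<Longrightarrow> has_pd U l fk (fkl y) y"
    and U: "open U"
  shows "\<exists>p. dist x p \<le> 2 * h \<and> 
     f (x + h *\<^sub>R axis k 1 + h *\<^sub>R axis l 1) - f (x + h *\<^sub>R axis k 1) - f (x + h *\<^sub>R axis l 1) + f x = h * (h * fkl p)"
proof -
  let ?k = "axis k 1 :: real^'n" and ?l = "axis l 1 :: real^'n"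
  have near: "dist x (x + v + w) \<le> norm v + norm w" for v w
  proof -
    have "x - (x + v + w) = - (v + w)" by simp
    then show ?thesis unfolding dist_norm by (simp only: norm_minus_cancel norm_triangle_ineq)
  qed
  have inU: "x + s *\<^sub>R ?k + t *\<^sub>R ?l \<in> U" if "0 \<le> s" "s \<le> h" "0 \<le> t" "t \<le> h" for s t
  proof -
    have "dist x (x + s *\<^sub>R ?k + t *\<^sub>R ?l) \<le> norm (s *\<^sub>R ?k) + norm (t *\<^sub>R ?l)"
      by (rule near)
    then show ?thesis using ball that h by (force simp: mem_ball)
  qed
  have D: "((\<lambda>t. F (y + t *\<^sub>R axis i 1)) has_real_derivative F' (y + t0 *\<^sub>R axis i 1)) (at t0)"
    if "y + t0 *\<^sub>R axis i 1 \<in> U" "\<And>y. y \<in> U \<Longrightarrow> has_pd U i F (F' y) y" for F F' i y t0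
  proof -
    have "open ((\<lambda>t. y + t *\<^sub>R axis i 1) -` U)" by (rule open_vimage[OF U]) (intro continuous_intros)
    then have "at t0 within {t. y + t *\<^sub>R axis i 1 \<in> U} = at t0"
      using that(1) by (intro at_within_open) (auto simp: vimage_def)
    with has_pd_shift[OF that(2)[OF that(1)]] show ?thesis by simp
  qed
  have "((\<lambda>t. f (x + t *\<^sub>R ?k + h *\<^sub>R ?l) - f (x + t *\<^sub>R ?k)) has_real_derivative
       fk (x + t *\<^sub>R ?k + h *\<^sub>R ?l) - fk (x + t *\<^sub>R ?k)) (at t)" if "0 \<le> t" "t \<le> h" for t
  proof (rule DERIV_diff)
    show "((\<lambda>t. f (x + t *\<^sub>R ?k)) has_real_derivative fk (x + t *\<^sub>R ?k)) (at t)"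
      by (rule D) (use fk inU[of t 0] that h in auto)
    have "((\<lambda>t. f ((x + h *\<^sub>R ?l) + t *\<^sub>R ?k)) has_real_derivative fk ((x + h *\<^sub>R ?l) + t *\<^sub>R ?k)) (at t)"
      by (rule D) (use fk inU[of t h] that h in \<open>auto simp: ac_simps\<close>)
    then show "((\<lambda>t. f (x + t *\<^sub>R ?k + h *\<^sub>R ?l)) has_real_derivative fk (x + t *\<^sub>R ?k + h *\<^sub>R ?l)) (at t)"
      by (simp add: ac_simps)
  qed
  from MVT2[OF h(1) this] obtain s where s: "0 < s" "s < h"
    "f (x + h *\<^sub>R ?k + h *\<^sub>R ?l) - f (x + h *\<^sub>R ?k) - (f (x + 0 *\<^sub>R ?k + h *\<^sub>R ?l) - f (x + 0 *\<^sub>R ?k))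
      = (h - 0) * (fk (x + s *\<^sub>R ?k + h *\<^sub>R ?l) - fk (x + s *\<^sub>R ?k))" by blast
  have "((\<lambda>t. fk (x + s *\<^sub>R ?k + t *\<^sub>R ?l)) has_real_derivative fkl (x + s *\<^sub>R ?k + t *\<^sub>R ?l)) (at t)"
    if "0 \<le> t" "t \<le> h" for t
    by (rule D) (use fkl inU[of s t] s that in auto)
  from MVT2[OF h(1) this] obtain t where t: "0 < t" "t < h"
    "fk (x + s *\<^sub>R ?k + h *\<^sub>R ?l) - fk (x + s *\<^sub>R ?k + 0 *\<^sub>R ?l) = (h - 0) * fkl (x + s *\<^sub>R ?k + t *\<^sub>R ?l)" by blast
  have "dist x (x + s *\<^sub>R ?k + t *\<^sub>R ?l) \<le> norm (s *\<^sub>R ?k) + norm (t *\<^sub>R ?l)"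
    by (rule near)
  then have "dist x (x + s *\<^sub>R ?k + t *\<^sub>R ?l) \<le> 2 * h" using s t by simp
  moreover have "f (x + h *\<^sub>R ?k + h *\<^sub>R ?l) - f (x + h *\<^sub>R ?k) - f (x + h *\<^sub>R ?l) + f x 
      = h * (h * fkl (x + s *\<^sub>R ?k + t *\<^sub>R ?l))"
    using s(3) t(3) by simp
  ultimately show ?thesis by blast
qed

lemma mixed_partials_eq_open:
  fixes x :: "real^'n::finite"
  assumes U: "open U" "x \<in> U"
    and fk: "\<And>y. y \<in> U \<Longrightarrow> has_pd U k f (fk y) y"
    and fl: "\<And>y. y \<in> U \<Longrightarrow> has_pd U l f (fl y) y"
    and fkl: "\<And>y. y \<in> U \<Longrightarrow> has_pd U l fk (fkl y) y"
    and flk: "\<And>y. y \<in> U \<Longrightarrow> has_pd U k fl (flk y) y"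
    and c: "continuous_on U fkl" "continuous_on U flk"
  shows "fkl x = flk x"
proof (rule ccontr)
  assume ne: "fkl x \<noteq> flk x"
  define e where "e = \<bar>fkl x - flk x\<bar> / 2"
  have e: "e > 0" using ne by (simp add: e_def)
  obtain d1 where d1: "d1 > 0" "\<And>y. y \<in> U \<Longrightarrow> dist y x < d1 \<Longrightarrow> dist (fkl y) (fkl x) < e"
    using c(1) U(2) e unfolding continuous_on_iff by blast
  obtain d2 where d2: "d2 > 0" "\<And>y. y \<in> U \<Longrightarrow> dist y x < d2 \<Longrightarrow> dist (flk y) (flk x) < e"
    using c(2) U(2) e unfolding continuous_on_iff by blast
  obtain r where r: "r > 0" "ball x r \<subseteq> U" using U openE by blast
  define h where "h = min r (min d1 d2) / 4"
  have h: "0 < h" "2 * h < r" "2 * h < d1" "2 * h < d2" using r d1 d2 by (auto simp: h_def min_def)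
  obtain p where p: "dist x p \<le> 2 * h" 
     "f (x + h *\<^sub>R axis k 1 + h *\<^sub>R axis l 1) - f (x + h *\<^sub>R axis k 1) - f (x + h *\<^sub>R axis l 1) + f x = h * (h * fkl p)"
    using mixed_difference[OF r(2) h(1,2) fk fkl U(1)] by blast
  obtain q where q: "dist x q \<le> 2 * h" 
     "f (x + h *\<^sub>R axis l 1 + h *\<^sub>R axis k 1) - f (x + h *\<^sub>R axis l 1) - f (x + h *\<^sub>R axis k 1) + f x = h * (h * flk q)"
    using mixed_difference[OF r(2) h(1,2) fl flk U(1)] by blast
  have comm: "x + h *\<^sub>R axis l 1 + h *\<^sub>R axis k 1 = x + h *\<^sub>R axis k 1 + h *\<^sub>R axis l 1" by (simp add: ac_simps)
  have "h * (h * fkl p) = h * (h * flk q)" using p(2) q(2)[unfolded comm] by linarith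
  then have eq: "fkl p = flk q" using h by simp
  have "p \<in> U" "q \<in> U" using r(2) p(1) q(1) h(2) by (auto simp: subset_iff)
  then have "dist (fkl p) (fkl x) < e" "dist (flk q) (flk x) < e"
    using d1(2)[of p] d2(2)[of q] p(1) q(1) h by (auto simp: dist_commute)
  then show False using eq unfolding e_def dist_real_def by (simp add: abs_if split: if_splits)
qed

text \<open>
  The symmetry extends from the interior to the boundary hyperplane by continuity.
\<close>

lemma mixed_partials_eq_end_region:
  assumes x: "x \<in> end_region"
    and fk: "\<And>y. y \<in> end_region \<Longrightarrow> has_pd end_region k f (fk y) y"
    and fl: "\<And>y. y \<in> end_region \<Longrightarrow> has_pd end_region l f (fl y) y"
    and fkl: "\<And>y. y \<in> end_region \<Longrightarrow> has_pd end_region l fk (fkl y) y"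
    and flk: "\<And>y. y \<in> end_region \<Longrightarrow> has_pd end_region k fl (flk y) y"
    and c: "continuous_on end_region fkl" "continuous_on end_region flk"
  shows "fkl x = flk x"
proof -
  let ?U = "{x. x $ None > 0} - cball 0 1 :: (real^('a option)) set"
  have oU: "open ?U"
    by (intro open_Diff open_Collect_less) (auto intro!: continuous_intros)
  have sub: "?U \<subseteq> end_region" by (auto simp: end_region_def half_space_def)
  have eq: "fkl y = flk y" if "y \<in> ?U" for y
    by (rule mixed_partials_eq_open[OF oU that, of k f fk l fl])
      (use sub fk fl fkl flk c in \<open>blast intro: has_pd_mono continuous_on_subset\<close>)+
  (* Interior points that converge to x. *)
  define u where "u n = x + inverse (real (Suc n)) *\<^sub>R axis None 1" for n
  have uU: "u n \<in> ?U" for n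
  proof -
    let ?t = "inverse (real (Suc n))"
    have t: "?t > 0" by simp
    have xN: "x $ None \<ge> 0" "norm x > 1" using x by (auto simp: end_region_def half_space_def)
    have "(norm (u n))\<^sup>2 = (norm x)\<^sup>2 + 2 * (x \<bullet> (?t *\<^sub>R axis None 1)) + (norm (?t *\<^sub>R (axis None 1 :: real^('a option))))\<^sup>2"
      unfolding u_def power2_norm_eq_inner by (simp add: inner_add_left inner_add_right inner_commute)
    moreover have "x \<bullet> (?t *\<^sub>R axis None 1) \<ge> 0" using xN t by (simp add: inner_axis)
    ultimately have "(norm x)\<^sup>2 \<le> (norm (u n))\<^sup>2" by simp
    then have "norm x \<le> norm (u n)" by (rule power2_le_imp_le) simp
    moreover have "u n $ None > 0" using xN t unfolding u_def by (simp add: add_nonneg_pos)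
    ultimately show ?thesis using xN by auto
  qed
  have "(\<lambda>n. inverse (real (Suc n)) *\<^sub>R axis None 1 :: real^('a option)) \<longlonglongrightarrow> 0 *\<^sub>R axis None 1"
    by (intro tendsto_intros LIMSEQ_inverse_real_of_nat)
  from tendsto_add[OF tendsto_const[of x] this] have lim: "u \<longlonglongrightarrow> x" unfolding u_def by simp
  have uD: "u n \<in> end_region" for n using uU sub by blast
  have "(\<lambda>n. fkl (u n)) \<longlonglongrightarrow> fkl x" "(\<lambda>n. flk (u n)) \<longlonglongrightarrow> flk x"
    using continuous_on_tendsto_compose[OF c(1) lim x] continuous_on_tendsto_compose[OF c(2) lim x] uD by auto
  moreover have "(\<lambda>n. fkl (u n)) = (\<lambda>n. flk (u n))" using eq uU by auto
  ultimately show ?thesis using LIMSEQ_unique by metis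
qed

text \<open>
  The divergence of the field \<open>U\<close> of the introduction at one point, with \<open>D k i j\<close> for
  \<open>e\<^sub>i\<^sub>j\<^sub>,\<^sub>k\<close> and \<open>A l k i j\<close> for \<open>e\<^sub>i\<^sub>j\<^sub>,\<^sub>k\<^sub>l\<close>.  The left side is what the product rule yields; on the right,
  \<open>Ric\<close> is the linearised Ricci tensor.  The first-derivative terms contribute
  \<open>-1 + n + 1 - 2 = n - 2\<close> copies of \<open>V\<cdot>x\<close>.
\<close>

lemma divergence_superpotential_algebra:
  fixes A :: "'n::finite \<Rightarrow> 'n \<Rightarrow> 'n \<Rightarrow> 'n \<Rightarrow> real" and D :: "'n \<Rightarrow> 'n \<Rightarrow> 'n \<Rightarrow> real" and x :: "'n \<Rightarrow> real"
  assumes A1: "\<And>l k i j. A l k i j = A l k j i" and A2: "\<And>l k i j. A l k i j = A k l i j"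
    and D1: "\<And>k i j. D k i j = D k j i"
  defines "V \<equiv> \<lambda>i. \<Sum>j\<in>UNIV. D j i j - D i j j"
    and "W \<equiv> \<lambda>l i. \<Sum>j\<in>UNIV. A l j i j - A l i j j"
    and "\<delta> \<equiv> \<lambda>i k. if i = k then 1 else (0::real)"
    and "Ric \<equiv> \<lambda>i j. (\<Sum>k\<in>UNIV. A k i j k + A k j i k - A k k i j - A i j k k) / 2"
  shows "(\<Sum>k\<in>UNIV. (\<Sum>i\<in>UNIV. \<Sum>j\<in>UNIV. (A k i k j - A k k i j) * (x i * x j)
             + (D i k j - D k i j) * (\<delta> k i * x j + x i * \<delta> k j))
        + (\<delta> k k * (\<Sum>i\<in>UNIV. V i * x i) + x k * (\<Sum>i\<in>UNIV. W k i * x i + V i * \<delta> k i))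
        - (W k k * (\<Sum>i\<in>UNIV. x i * x i) + V k * (\<Sum>i\<in>UNIV. \<delta> k i * x i + x i * \<delta> k i)))
     = 2 * (\<Sum>i\<in>UNIV. \<Sum>j\<in>UNIV. Ric i j * (x i * x j)) - (\<Sum>i\<in>UNIV. Ric i i) * (\<Sum>i\<in>UNIV. x i * x i)
       + (real CARD('n) - 2) * (\<Sum>i\<in>UNIV. V i * x i)"
proof -
  let ?Vx = "\<Sum>i\<in>UNIV. V i * x i" and ?r = "\<Sum>i\<in>UNIV. x i * x i"
  have d1: "(\<Sum>i\<in>UNIV. f i * \<delta> k i) = f k" "(\<Sum>i\<in>UNIV. \<delta> k i * f i) = f k" for f k
    unfolding \<delta>_def by (simp_all add: if_distrib[of "\<lambda>c. c * _"] if_distrib[of "\<lambda>c. _ * c"] cong: if_cong)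
  have dkk: "\<delta> k k = 1" for k by (simp add: \<delta>_def)
  have R: "(\<Sum>i\<in>UNIV. Ric i i) = (\<Sum>k\<in>UNIV. W k k)"
  proof -
    have "(\<Sum>i\<in>UNIV. Ric i i) = (\<Sum>i\<in>UNIV. \<Sum>k\<in>UNIV. A k i i k - A k k i i / 2 - A i i k k / 2)"
      unfolding Ric_def by (simp add: sum_divide_distrib algebra_simps add_divide_distrib diff_divide_distrib)
    also have "\<dots> = (\<Sum>i\<in>UNIV. \<Sum>k\<in>UNIV. A k i i k) - (\<Sum>i\<in>UNIV. \<Sum>k\<in>UNIV. A k k i i / 2) - (\<Sum>i\<in>UNIV. \<Sum>k\<in>UNIV. A i i k k / 2)"
      by (simp add: sum_subtractf)
    also have "(\<Sum>i\<in>UNIV. \<Sum>k\<in>UNIV. A k k i i / 2) = (\<Sum>i\<in>UNIV. \<Sum>k\<in>UNIV. A i i k k / 2)"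
      by (rule sum.swap)
    also have "(\<Sum>i\<in>UNIV. \<Sum>k\<in>UNIV. A k i i k) = (\<Sum>i\<in>UNIV. \<Sum>k\<in>UNIV. A i k i k)"
      using A2 by simp
    finally show ?thesis unfolding W_def by (simp add: sum_subtractf sum_divide_distrib[symmetric])
  qed
  have T2: "(\<Sum>k\<in>UNIV. \<Sum>i\<in>UNIV. \<Sum>j\<in>UNIV. (D i k j - D k i j) * (\<delta> k i * x j + x i * \<delta> k j)) = - ?Vx"
  proof -
    have "(\<Sum>k\<in>UNIV. \<Sum>i\<in>UNIV. \<Sum>j\<in>UNIV. (D i k j - D k i j) * (\<delta> k i * x j + x i * \<delta> k j))
      = (\<Sum>k\<in>UNIV. \<Sum>i\<in>UNIV. \<delta> k i * (\<Sum>j\<in>UNIV. (D i k j - D k i j) * x j))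
        + (\<Sum>k\<in>UNIV. \<Sum>i\<in>UNIV. \<Sum>j\<in>UNIV. ((D i k j - D k i j) * x i) * \<delta> k j)"
      by (simp add: distrib_left sum.distrib sum_distrib_left mult_ac)
    also have "\<dots> = (\<Sum>k\<in>UNIV. \<Sum>i\<in>UNIV. (D i k k - D k i k) * x i)"
      unfolding d1 by simp
    also have "\<dots> = (\<Sum>i\<in>UNIV. \<Sum>k\<in>UNIV. (D i k k - D k i k) * x i)" by (rule sum.swap)
    also have "\<dots> = (\<Sum>i\<in>UNIV. - (V i * x i))"
      unfolding V_def by (intro sum.cong refl) (simp only: sum_distrib_right[symmetric] sum_subtractf, simp add: algebra_simps)
    also have "\<dots> = - ?Vx" by (rule sum_negf)
    finally show ?thesis .
  qed
  have T1: "(\<Sum>k\<in>UNIV. \<Sum>i\<in>UNIV. \<Sum>j\<in>UNIV. (A k i k j - A k k i j) * (x i * x j)) 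
      + (\<Sum>k\<in>UNIV. x k * (\<Sum>i\<in>UNIV. W k i * x i))
     = 2 * (\<Sum>i\<in>UNIV. \<Sum>j\<in>UNIV. Ric i j * (x i * x j))"
  proof -
    have a: "(\<Sum>k\<in>UNIV. \<Sum>i\<in>UNIV. \<Sum>j\<in>UNIV. (A k i k j - A k k i j) * (x i * x j))
      = (\<Sum>i\<in>UNIV. \<Sum>j\<in>UNIV. \<Sum>k\<in>UNIV. (A k i j k - A k k i j) * (x i * x j))"
      by (subst sum.swap, rule sum.cong[OF refl], subst sum.swap) (simp add: A1)
    have b: "(\<Sum>k\<in>UNIV. x k * (\<Sum>i\<in>UNIV. W k i * x i))
       = (\<Sum>i\<in>UNIV. \<Sum>j\<in>UNIV. \<Sum>k\<in>UNIV. (A k j i k - A i j k k) * (x i * x j))"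
    proof -
      have "(\<Sum>k\<in>UNIV. x k * (\<Sum>i\<in>UNIV. W k i * x i))
        = (\<Sum>i\<in>UNIV. \<Sum>j\<in>UNIV. \<Sum>k\<in>UNIV. (A i k j k - A i j k k) * (x i * x j))"
        unfolding W_def by (simp add: sum_distrib_left sum_distrib_right mult_ac)
      also have "\<dots> = (\<Sum>i\<in>UNIV. \<Sum>j\<in>UNIV. \<Sum>k\<in>UNIV. A i k j k * (x i * x j)) 
          - (\<Sum>i\<in>UNIV. \<Sum>j\<in>UNIV. \<Sum>k\<in>UNIV. A i j k k * (x i * x j))"
        by (simp add: sum_subtractf left_diff_distrib)
      also have "(\<Sum>i\<in>UNIV. \<Sum>j\<in>UNIV. \<Sum>k\<in>UNIV. A i k j k * (x i * x j)) 
         = (\<Sum>i\<in>UNIV. \<Sum>j\<in>UNIV. \<Sum>k\<in>UNIV. A k j i k * (x i * x j))"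
        by (subst sum.swap) (simp add: A2 mult_ac)
      finally show ?thesis by (simp add: sum_subtractf left_diff_distrib)
    qed
    have "2 * (\<Sum>i\<in>UNIV. \<Sum>j\<in>UNIV. Ric i j * (x i * x j))
       = (\<Sum>i\<in>UNIV. \<Sum>j\<in>UNIV. (2 * Ric i j) * (x i * x j))"
      by (simp add: sum_distrib_left mult_ac)
    also have "\<dots> = (\<Sum>i\<in>UNIV. \<Sum>j\<in>UNIV. \<Sum>k\<in>UNIV. (A k i j k + A k j i k - A k k i j - A i j k k) * (x i * x j))"
      by (simp add: Ric_def sum_distrib_right)
    finally show ?thesis unfolding a b
      by (simp add: sum.distrib[symmetric] algebra_simps)
  qed
  have "(\<Sum>k\<in>UNIV. (\<Sum>i\<in>UNIV. \<Sum>j\<in>UNIV. (A k i k j - A k k i j) * (x i * x j)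
             + (D i k j - D k i j) * (\<delta> k i * x j + x i * \<delta> k j))
        + (\<delta> k k * ?Vx + x k * (\<Sum>i\<in>UNIV. W k i * x i + V i * \<delta> k i))
        - (W k k * ?r + V k * (\<Sum>i\<in>UNIV. \<delta> k i * x i + x i * \<delta> k i)))
    = (\<Sum>k\<in>UNIV. \<Sum>i\<in>UNIV. \<Sum>j\<in>UNIV. (A k i k j - A k k i j) * (x i * x j))
      + (\<Sum>k\<in>UNIV. \<Sum>i\<in>UNIV. \<Sum>j\<in>UNIV. (D i k j - D k i j) * (\<delta> k i * x j + x i * \<delta> k j))
      + (real CARD('n) * ?Vx + (\<Sum>k\<in>UNIV. x k * (\<Sum>i\<in>UNIV. W k i * x i)) + ?Vx)
      - ((\<Sum>k\<in>UNIV. W k k) * ?r + 2 * ?Vx)"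
  proof -
    have "(\<Sum>i\<in>UNIV. W k i * x i + V i * \<delta> k i) = (\<Sum>i\<in>UNIV. W k i * x i) + V k" for k
      by (simp add: sum.distrib d1)
    moreover have "(\<Sum>i\<in>UNIV. \<delta> k i * x i + x i * \<delta> k i) = 2 * x k" for k
      by (simp only: sum.distrib d1)
    ultimately show ?thesis
      by (simp add: sum.distrib sum_subtractf dkk distrib_left sum_distrib_left[symmetric] sum_distrib_right[symmetric] mult_ac)
  qed
  then show ?thesis using T1 T2 R by (simp add: algebra_simps)
qed

section \<open>Exact flux identities for the linearised curvature\<close>

lemma bdry_pt_in_end_region: "y \<in> - cball 0 1 \<Longrightarrow> bdry_pt y \<in> end_region"
  by (simp add: end_region_def half_space_def)

lemma bdry_pt_translate: "bdry_pt (y + t *\<^sub>R axis a 1) = bdry_pt y + t *\<^sub>R axis (Some a) 1"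
  by (simp add: vec_eq_iff split_option_all) (simp add: axis_def)

lemma has_pd_bdry:
  assumes "has_pd end_region (Some a) f d (bdry_pt y)" "y \<in> - cball 0 1"
  shows "has_pd (- cball 0 1) a (\<lambda>y. f (bdry_pt y)) d y"
  using assms unfolding has_pd_def bdry_pt_translate
  by (elim DERIV_subset) (auto simp: end_region_def half_space_def bdry_pt_translate[symmetric])

text \<open>
  The setting of the exact identities: symmetric matrix fields that are twice continuously
  differentiable up to the boundary.  As the flat metric is constant, derivatives of \<open>g\<close> are derivatives of \<open>g - \<delta>\<close>.
\<close>

locale C2_end_metric =
  fixes g :: "real^('m::finite option) \<Rightarrow> real^('m option)^('m option)"
  assumes C2: "\<And>i j. Ck_on 2 end_region (\<lambda>x. g x $ i $ j)"
    and sym: "\<And>x i j. x \<in> end_region \<Longrightarrow> g x $ i $ j = g x $ j $ i"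
begin

definition dg :: "'m option \<Rightarrow> 'm option \<Rightarrow> 'm option \<Rightarrow> real^('m option) \<Rightarrow> real" where
  "dg k i j = partial_deriv end_region k (\<lambda>y. g y $ i $ j)"

definition ddg :: "'m option \<Rightarrow> 'm option \<Rightarrow> 'm option \<Rightarrow> 'm option \<Rightarrow> real^('m option) \<Rightarrow> real" where
  "ddg l k i j = partial_deriv end_region l (dg k i j)"

lemma C2': "(\<lambda>x. g x $ i $ j) differentiable_on end_region" 
  "dg k i j differentiable_on end_region" "continuous_on end_region (ddg l k i j)"
  using C2[of i j] unfolding numeral_2_eq_2 Ck_on.simps dg_def ddg_def by blast+

lemma g_cont: "continuous_on end_region (\<lambda>x. g x $ i $ j)"
  using C2'(1) differentiable_imp_continuous_on by blast

lemma dg_cont: "continuous_on end_region (dg k i j)"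
  using C2'(2) differentiable_imp_continuous_on by blast

lemmas ddg_cont = C2'(3)

lemma g_pd: "x \<in> end_region \<Longrightarrow> has_pd end_region k (\<lambda>x. g x $ i $ j) (dg k i j x) x"
  unfolding dg_def by (rule partial_deriv_end_has_pd[OF C2'(1)])

lemma dg_pd: "x \<in> end_region \<Longrightarrow> has_pd end_region l (dg k i j) (ddg l k i j x) x"
  unfolding ddg_def by (rule partial_deriv_end_has_pd[OF C2'(2)])

lemma dg_sym: "x \<in> end_region \<Longrightarrow> dg k i j x = dg k j i x"
  unfolding dg_def[of k j i]
  by (rule partial_deriv_end_eq[symmetric, OF has_pd_cong[OF g_pd]]) (auto simp: sym)

lemma ddg_sym: "x \<in> end_region \<Longrightarrow> ddg l k i j x = ddg l k j i x"
  unfolding ddg_def[of l k j i]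
  by (rule partial_deriv_end_eq[symmetric, OF has_pd_cong[OF dg_pd]]) (auto simp: dg_sym)

lemma ddg_commute: "x \<in> end_region \<Longrightarrow> ddg l k i j x = ddg k l i j x"
  by (rule mixed_partials_eq_end_region[of x k "\<lambda>x. g x $ i $ j" "dg k i j" l "dg l i j"])
    (auto intro: g_pd dg_pd ddg_cont)

text \<open>
  The integrand of the mass on the hemisphere is the flux of this field.  In what follows the prefix
  \<open>lin\<close> marks linearisations at the flat metric, and \<open>linEin\<close> and \<open>linAH\<close> are the linearised
  \<open>G(X, X)\<close> and \<open>(A - H g)(X, X)\<close>.
\<close>

definition massV :: "'m option \<Rightarrow> real^('m option) \<Rightarrow> real" where
  "massV i x = (\<Sum>j\<in>UNIV. dg j i j x - dg i j j x)"

definition div_massV :: "'m option \<Rightarrow> 'm option \<Rightarrow> real^('m option) \<Rightarrow> real" where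
  "div_massV l i x = (\<Sum>j\<in>UNIV. ddg l j i j x - ddg l i j j x)"

definition linRic :: "'m option \<Rightarrow> 'm option \<Rightarrow> real^('m option) \<Rightarrow> real" where
  "linRic i j x = (\<Sum>k\<in>UNIV. ddg k i j k x + ddg k j i k x - ddg k k i j x - ddg i j k k x) / 2"

definition linR :: "real^('m option) \<Rightarrow> real" where
  "linR x = (\<Sum>i\<in>UNIV. linRic i i x)"

definition linEin :: "real^('m option) \<Rightarrow> real" where
  "linEin x = (\<Sum>i\<in>UNIV. \<Sum>j\<in>UNIV. linRic i j x * (x $ i * x $ j)) - linR x / 2 * (\<Sum>i\<in>UNIV. x $ i * x $ i)"

definition linA :: "'m \<Rightarrow> 'm \<Rightarrow> real^'m \<Rightarrow> real" where
  "linA a b y = (dg (Some a) None (Some b) (bdry_pt y) + dg (Some b) None (Some a) (bdry_pt y)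
      - dg None (Some a) (Some b) (bdry_pt y)) / 2"

definition linH :: "real^'m \<Rightarrow> real" where
  "linH y = (\<Sum>a\<in>UNIV. linA a a y)"

definition linAH :: "real^'m \<Rightarrow> real" where
  "linAH y = (\<Sum>a\<in>UNIV. \<Sum>b\<in>UNIV. linA a b y * (y $ a * y $ b)) - linH y * (\<Sum>a\<in>UNIV. y $ a * y $ a)"

definition mass_flux :: "real \<Rightarrow> real" where
  "mass_flux r = cone_int half_space (\<lambda>x. \<Sum>i\<in>UNIV. massV i x * (x $ i / norm x)) r
     + cone_int UNIV (\<lambda>y. \<Sum>a\<in>UNIV. g (bdry_pt y) $ Some a $ None * (y $ a / norm y)) r"

lemma massV_cont: "continuous_on end_region (massV i)"
  unfolding massV_def[abs_def] by (intro continuous_intros dg_cont)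

lemma div_massV_cont: "continuous_on end_region (div_massV l i)"
  unfolding div_massV_def[abs_def] by (intro continuous_intros ddg_cont)

lemma massV_pd: "x \<in> end_region \<Longrightarrow> has_pd end_region l (massV i) (div_massV l i x) x"
  unfolding massV_def[abs_def] div_massV_def by (intro has_pd_sum has_pd_diff dg_pd)

lemma linRic_cont: "continuous_on end_region (linRic i j)"
  unfolding linRic_def[abs_def] by (intro continuous_intros ddg_cont) auto

lemma linR_cont: "continuous_on end_region linR"
  unfolding linR_def[abs_def] by (intro continuous_intros linRic_cont)

lemma linEin_cont: "continuous_on end_region linEin"
  unfolding linEin_def[abs_def] by (intro continuous_intros linRic_cont linR_cont) auto

lemma bdry_cont: "continuous_on end_region f \<Longrightarrow> continuous_on (- cball 0 1) (\<lambda>y. f (bdry_pt y))"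
  by (rule continuous_on_compose2[of end_region f]) (auto intro!: continuous_intros bdry_pt_in_end_region)

lemma G_cont: "continuous_on (- cball 0 1) (\<lambda>y. g (bdry_pt y) $ i $ j)"
  by (rule bdry_cont[OF g_cont])

lemma linA_cont: "continuous_on (- cball 0 1) (linA a b)"
  unfolding linA_def[abs_def] by (intro continuous_intros bdry_cont dg_cont) auto

lemma linH_cont: "continuous_on (- cball 0 1) linH"
  unfolding linH_def[abs_def] by (intro continuous_intros linA_cont)

lemma linAH_cont: "continuous_on (- cball 0 1) linAH"
  unfolding linAH_def[abs_def] by (intro continuous_intros linA_cont linH_cont)

text \<open>
  The linearised scalar curvature is the divergence of the mass integrand; this is why the mass
  integral converges.
\<close>

lemma linR_eq_div: "x \<in> end_region \<Longrightarrow> linR x = (\<Sum>k\<in>UNIV. div_massV k k x)"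
proof -
  assume x: "x \<in> end_region"
  have "linR x = (\<Sum>i\<in>UNIV. \<Sum>k\<in>UNIV. ddg k i i k x - ddg k k i i x / 2 - ddg i i k k x / 2)"
    unfolding linR_def linRic_def by (simp add: sum_divide_distrib algebra_simps add_divide_distrib diff_divide_distrib)
  also have "\<dots> = (\<Sum>i\<in>UNIV. \<Sum>k\<in>UNIV. ddg k i i k x) - (\<Sum>i\<in>UNIV. \<Sum>k\<in>UNIV. ddg k k i i x / 2) - (\<Sum>i\<in>UNIV. \<Sum>k\<in>UNIV. ddg i i k k x / 2)"
    by (simp add: sum_subtractf)
  also have "(\<Sum>i\<in>UNIV. \<Sum>k\<in>UNIV. ddg k k i i x / 2) = (\<Sum>i\<in>UNIV. \<Sum>k\<in>UNIV. ddg i i k k x / 2)"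
    by (rule sum.swap)
  also have "(\<Sum>i\<in>UNIV. \<Sum>k\<in>UNIV. ddg k i i k x) = (\<Sum>i\<in>UNIV. \<Sum>k\<in>UNIV. ddg i k i k x)"
    using ddg_commute[OF x] by simp
  finally show ?thesis unfolding div_massV_def by (simp add: sum_subtractf sum_divide_distrib[symmetric])
qed

lemma massV_None: "massV None x = (\<Sum>a\<in>UNIV. dg (Some a) None (Some a) x - dg None (Some a) (Some a) x)"
  unfolding massV_def by (simp add: UNIV_option_sum)

text \<open>
  The normal component of the mass field on the boundary and the tangential divergence of
  \<open>g\<^sub>a\<^sub>1\<close>, which comes from the boundary term of the mass, add up to \<open>2 H\<close> to first order.
\<close>

lemma mass_flux_increment:
  assumes st: "1 < s" "s \<le> t"
  shows "mass_flux t - mass_flux s 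
    = integral {s..t} (\<lambda>r. cone_int half_space linR r + cone_int UNIV (\<lambda>y. 2 * linH y) r)"
proof -
  let ?G = "\<lambda>a y. g (bdry_pt y) $ Some a $ None" 
  let ?dG = "\<lambda>a y. dg (Some a) (Some a) None (bdry_pt y)"
  have U: "is_cone (UNIV :: (real^'m) set)" by (simp add: is_cone_def)
  have D: "- cball 0 1 = UNIV - cball (0::real^'m) 1" by auto
  have 1: "cone_int half_space (\<lambda>x. \<Sum>k\<in>UNIV. massV k x * (x $ k / norm x)) t
      - cone_int half_space (\<lambda>x. \<Sum>k\<in>UNIV. massV k x * (x $ k / norm x)) s
     = integral {s..t} (\<lambda>r. cone_int half_space (\<lambda>x. \<Sum>k\<in>UNIV. div_massV k k x) r
          + cone_int UNIV (\<lambda>y. massV None (bdry_pt y)) r)"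
    by (rule half_space_divergence_theorem[OF massV_cont div_massV_cont massV_pd st])
  have 2: "cone_int UNIV (\<lambda>x. \<Sum>k\<in>UNIV. ?G k x * (x $ k / norm x)) t
      - cone_int UNIV (\<lambda>x. \<Sum>k\<in>UNIV. ?G k x * (x $ k / norm x)) s
     = integral {s..t} (cone_int UNIV (\<lambda>x. \<Sum>k\<in>UNIV. ?dG k x))"
  proof (rule exterior_divergence_theorem[OF _ _ _ st])
    show "continuous_on (- cball 0 1) (?G k)" for k by (rule bdry_cont[OF g_cont])
    show "continuous_on (- cball 0 1) (?dG k)" for k by (rule bdry_cont[OF dg_cont])
    show "has_pd (- cball 0 1) k (?G k) (?dG k y) y" if "y \<in> - cball 0 1" for k y
      by (rule has_pd_bdry[OF g_pd[OF bdry_pt_in_end_region[OF that]] that])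
  qed
  have c1: "continuous_on {1<..} (cone_int half_space linR)"
    by (rule cone_int_continuous[OF is_cone_half_space]) (use linR_cont in \<open>simp add: end_region_def\<close>)
  have cM: "continuous_on (UNIV - cball 0 1) (\<lambda>y. massV None (bdry_pt y))"
    using bdry_cont[OF massV_cont] by (simp add: D)
  have cdG: "continuous_on (UNIV - cball 0 1) (\<lambda>y. \<Sum>a\<in>UNIV. ?dG a y)"
    unfolding D[symmetric] by (intro continuous_intros bdry_cont dg_cont)
  have c2: "continuous_on {1<..} (cone_int UNIV (\<lambda>y. massV None (bdry_pt y)))"
    by (rule cone_int_continuous[OF U cM])
  have c3: "continuous_on {1<..} (cone_int UNIV (\<lambda>x. \<Sum>k\<in>UNIV. ?dG k x))"
    by (rule cone_int_continuous[OF U cdG])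
  have sub: "{s..t} \<subseteq> {1<..}" using st by auto
  have "mass_flux t - mass_flux s 
    = integral {s..t} (\<lambda>r. cone_int half_space (\<lambda>x. \<Sum>k\<in>UNIV. div_massV k k x) r
          + cone_int UNIV (\<lambda>y. massV None (bdry_pt y)) r) + integral {s..t} (cone_int UNIV (\<lambda>x. \<Sum>k\<in>UNIV. ?dG k x))"
    using 1 2 unfolding mass_flux_def by simp
  also have "integral {s..t} (\<lambda>r. cone_int half_space (\<lambda>x. \<Sum>k\<in>UNIV. div_massV k k x) r
          + cone_int UNIV (\<lambda>y. massV None (bdry_pt y)) r)
       = integral {s..t} (\<lambda>r. cone_int half_space linR r + cone_int UNIV (\<lambda>y. massV None (bdry_pt y)) r)"
  proof (rule integral_cong)
    fix r assume r: "r \<in> {s..t}"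
    have "cone_int half_space (\<lambda>x. \<Sum>k\<in>UNIV. div_massV k k x) r = cone_int half_space linR r"
      by (rule cone_int_cong, rule linR_eq_div[symmetric]) (use r st in \<open>auto simp: end_region_def\<close>)
    then show "cone_int half_space (\<lambda>x. \<Sum>k\<in>UNIV. div_massV k k x) r
          + cone_int UNIV (\<lambda>y. massV None (bdry_pt y)) r 
       = cone_int half_space linR r + cone_int UNIV (\<lambda>y. massV None (bdry_pt y)) r" by simp
  qed
  also have "\<dots> + integral {s..t} (cone_int UNIV (\<lambda>x. \<Sum>k\<in>UNIV. ?dG k x))
     = integral {s..t} (\<lambda>r. (cone_int half_space linR r + cone_int UNIV (\<lambda>y. massV None (bdry_pt y)) r)
           + cone_int UNIV (\<lambda>x. \<Sum>k\<in>UNIV. ?dG k x) r)"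
    by (rule integral_add[symmetric])
      (intro integrable_continuous_interval continuous_intros continuous_on_subset[OF c1 sub]
        continuous_on_subset[OF c2 sub] continuous_on_subset[OF c3 sub])+
  also have "\<dots> = integral {s..t} (\<lambda>r. cone_int half_space linR r + cone_int UNIV (\<lambda>y. 2 * linH y) r)"
  proof (rule integral_cong)
    fix r assume r: "r \<in> {s..t}"
    have "cone_int UNIV (\<lambda>y. massV None (bdry_pt y)) r + cone_int UNIV (\<lambda>x. \<Sum>k\<in>UNIV. ?dG k x) r
      = cone_int UNIV (\<lambda>y. massV None (bdry_pt y) + (\<Sum>k\<in>UNIV. ?dG k y)) r"
      by (rule cone_int_add[symmetric, OF U cM cdG]) (use r st in auto)
    also have "\<dots> = cone_int UNIV (\<lambda>y. 2 * linH y) r"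
    proof (rule cone_int_cong)
      fix y :: "real^'m" assume "norm y = r"
      then have y: "bdry_pt y \<in> end_region" by (intro bdry_pt_in_end_region) (use r st in auto)
      show "massV None (bdry_pt y) + (\<Sum>k\<in>UNIV. ?dG k y) = 2 * linH y"
        unfolding massV_None linH_def linA_def
        by (simp add: dg_sym[OF y, of _ "Some _" None] sum.distrib[symmetric] sum_distrib_left)
          (intro sum.cong refl, simp add: field_simps)
    qed
    finally show "cone_int half_space linR r + cone_int UNIV (\<lambda>y. massV None (bdry_pt y)) r
           + cone_int UNIV (\<lambda>x. \<Sum>k\<in>UNIV. ?dG k x) r
        = cone_int half_space linR r + cone_int UNIV (\<lambda>y. 2 * linH y) r" by simp
  qed
  finally show ?thesis .
qed

text \<open>
  The tangential divergence theorem for \<open>U\<close>.  Its factor \<open>r\<^sup>2\<close> is written as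
  \<open>\<Sum>\<^sub>i x\<^sub>i x\<^sub>i\<close>, which keeps the field polynomial in \<open>x\<close>.
\<close>

lemma hemisphere_superpotential_identity:
  assumes r: "1 < r"
  shows "cone_int half_space (\<lambda>x. 2 * linEin x + (real CARD('m) - 1) * (\<Sum>i\<in>UNIV. massV i x * x $ i)) r
    + cone_int UNIV (\<lambda>y. (\<Sum>a\<in>UNIV. \<Sum>b\<in>UNIV. (dg (Some a) None (Some b) (bdry_pt y) - dg None (Some a) (Some b) (bdry_pt y)) * (y $ a * y $ b))
         - massV None (bdry_pt y) * (\<Sum>a\<in>UNIV. y $ a * y $ a)) r = 0"
proof -
  let ?\<delta> = "\<lambda>i k. if i = k then 1 else (0::real)"
  define U where "U k x = (\<Sum>i\<in>UNIV. \<Sum>j\<in>UNIV. (dg i k j x - dg k i j x) * (x $ i * x $ j))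
     + x $ k * (\<Sum>i\<in>UNIV. massV i x * x $ i) - massV k x * (\<Sum>i\<in>UNIV. x $ i * x $ i)" for k x
  define U' where "U' k x = (\<Sum>i\<in>UNIV. \<Sum>j\<in>UNIV. (ddg k i k j x - ddg k k i j x) * (x $ i * x $ j)
             + (dg i k j x - dg k i j x) * (?\<delta> k i * x $ j + x $ i * ?\<delta> k j))
        + (?\<delta> k k * (\<Sum>i\<in>UNIV. massV i x * x $ i) + x $ k * (\<Sum>i\<in>UNIV. div_massV k i x * x $ i + massV i x * ?\<delta> k i))
        - (div_massV k k x * (\<Sum>i\<in>UNIV. x $ i * x $ i) + massV k x * (\<Sum>i\<in>UNIV. ?\<delta> k i * x $ i + x $ i * ?\<delta> k i))" for k x
  have pd: "has_pd end_region k (U k) (U' k x) x" if "x \<in> end_region" for k x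
    unfolding U_def[abs_def] U'_def
    by (intro has_pd_sum has_pd_diff has_pd_add has_pd_mult dg_pd massV_pd has_pd_coord that)
  have tan: "(\<Sum>k\<in>UNIV. U k x * x $ k) = 0" if x: "x \<in> end_region" for x
  proof -
    have "(\<Sum>k\<in>UNIV. \<Sum>i\<in>UNIV. \<Sum>j\<in>UNIV. dg i k j x * (x $ i * x $ j) * x $ k)
       = (\<Sum>k\<in>UNIV. \<Sum>i\<in>UNIV. \<Sum>j\<in>UNIV. dg k i j x * (x $ i * x $ j) * x $ k)"
      by (subst sum.swap) (simp add: mult_ac)
    then have "(\<Sum>k\<in>UNIV. \<Sum>i\<in>UNIV. \<Sum>j\<in>UNIV. (dg i k j x - dg k i j x) * (x $ i * x $ j) * x $ k) = 0"
      by (simp add: left_diff_distrib sum_subtractf)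
    moreover have "(\<Sum>k\<in>UNIV. U k x * x $ k) = 
        (\<Sum>k\<in>UNIV. \<Sum>i\<in>UNIV. \<Sum>j\<in>UNIV. (dg i k j x - dg k i j x) * (x $ i * x $ j) * x $ k)
        + (\<Sum>k\<in>UNIV. x $ k * x $ k) * (\<Sum>i\<in>UNIV. massV i x * x $ i)
        - (\<Sum>k\<in>UNIV. massV k x * x $ k) * (\<Sum>i\<in>UNIV. x $ i * x $ i)"
    proof -
      have "U k x * x $ k = (\<Sum>i\<in>UNIV. \<Sum>j\<in>UNIV. (dg i k j x - dg k i j x) * (x $ i * x $ j) * x $ k)
        + (x $ k * x $ k) * (\<Sum>i\<in>UNIV. massV i x * x $ i)
        - (massV k x * x $ k) * (\<Sum>i\<in>UNIV. x $ i * x $ i)" for k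
      proof -
        let ?S = "\<Sum>i\<in>UNIV. \<Sum>j\<in>UNIV. (dg i k j x - dg k i j x) * (x $ i * x $ j)"
        have "?S * x $ k = (\<Sum>i\<in>UNIV. \<Sum>j\<in>UNIV. (dg i k j x - dg k i j x) * (x $ i * x $ j) * x $ k)"
          by (simp only: sum_distrib_right)
        moreover have "(S + x $ k * M - m * q) * x $ k = S * x $ k + (x $ k * x $ k) * M - (m * x $ k) * q"
          for S M m q :: real by (simp add: algebra_simps)
        ultimately show ?thesis unfolding U_def by simp
      qed
      then show ?thesis by (simp add: sum.distrib sum_subtractf sum_distrib_right)
    qed
    ultimately show ?thesis by simp
  qed
  have "cone_int half_space (\<lambda>x. \<Sum>k\<in>UNIV. U' k x) r + cone_int UNIV (\<lambda>y. U None (bdry_pt y)) r = 0"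
  proof (rule half_space_tangential_divergence[OF _ _ pd tan r])
    show "continuous_on end_region (U k)" for k
      unfolding U_def[abs_def] by (intro continuous_intros dg_cont massV_cont)
    show "continuous_on end_region (U' k)" for k
      unfolding U'_def[abs_def] by (intro continuous_intros dg_cont ddg_cont massV_cont div_massV_cont)
  qed
  also have "cone_int half_space (\<lambda>x. \<Sum>k\<in>UNIV. U' k x) r = 
     cone_int half_space (\<lambda>x. 2 * linEin x + (real CARD('m) - 1) * (\<Sum>i\<in>UNIV. massV i x * x $ i)) r"
  proof (rule cone_int_cong)
    fix x :: "real^('m option)" assume "x \<in> half_space" "norm x = r"
    then have x: "x \<in> end_region" using r by (simp add: end_region_def)
    have card: "real CARD('m option) - 2 = real CARD('m) - 1" by simp
    have "(\<Sum>k\<in>UNIV. U' k x) = 2 * (\<Sum>i\<in>UNIV. \<Sum>j\<in>UNIV. linRic i j x * (x $ i * x $ j)) 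
       - (\<Sum>i\<in>UNIV. linRic i i x) * (\<Sum>i\<in>UNIV. x $ i * x $ i)
       + (real CARD('m option) - 2) * (\<Sum>i\<in>UNIV. massV i x * x $ i)"
      unfolding U'_def linRic_def massV_def div_massV_def
      by (rule divergence_superpotential_algebra[of "\<lambda>l k i j. ddg l k i j x" "\<lambda>k i j. dg k i j x" "\<lambda>i. x $ i"])
        (rule ddg_sym[OF x] ddg_commute[OF x] dg_sym[OF x])+
    also have "\<dots> = 2 * linEin x + (real CARD('m) - 1) * (\<Sum>i\<in>UNIV. massV i x * x $ i)"
      unfolding linEin_def linR_def card by (simp add: algebra_simps)
    finally show "(\<Sum>k\<in>UNIV. U' k x) = 2 * linEin x + (real CARD('m) - 1) * (\<Sum>i\<in>UNIV. massV i x * x $ i)" .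
  qed
  also have "(\<lambda>y. U None (bdry_pt y)) = (\<lambda>y. (\<Sum>a\<in>UNIV. \<Sum>b\<in>UNIV. (dg (Some a) None (Some b) (bdry_pt y) - dg None (Some a) (Some b) (bdry_pt y)) * (y $ a * y $ b))
         - massV None (bdry_pt y) * (\<Sum>a\<in>UNIV. y $ a * y $ a))"
    unfolding U_def by (simp add: UNIV_option_sum)
  finally show ?thesis .
qed

text \<open>
  The tangential divergence theorem for \<open>Z\<close> on the spheres of the boundary hyperplane, whose
  dimension is \<open>n - 1\<close>.
\<close>

lemma boundary_sphere_identity:
  assumes r: "1 < r"
  shows "cone_int UNIV (\<lambda>y. (\<Sum>a\<in>UNIV. \<Sum>b\<in>UNIV. dg (Some a) None (Some b) (bdry_pt y) * (y $ a * y $ b))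
     - (\<Sum>a\<in>UNIV. dg (Some a) None (Some a) (bdry_pt y)) * (\<Sum>a\<in>UNIV. y $ a * y $ a)
     + (real CARD('m) - 1) * (\<Sum>a\<in>UNIV. g (bdry_pt y) $ Some a $ None * y $ a)) r = 0"
proof -
  let ?\<delta> = "\<lambda>i k. if i = k then 1 else (0::real)"
  let ?G = "\<lambda>a y. g (bdry_pt y) $ Some a $ None" 
  let ?dG = "\<lambda>b a y. dg (Some b) (Some a) None (bdry_pt y)"
  define Z where "Z b y = (\<Sum>a\<in>UNIV. ?G a y * y $ a) * y $ b - ?G b y * (\<Sum>c\<in>UNIV. y $ c * y $ c)" for b y
  define Z' where "Z' b y = (\<Sum>a\<in>UNIV. ?dG b a y * y $ a + ?G a y * ?\<delta> b a) * y $ b + (\<Sum>a\<in>UNIV. ?G a y * y $ a) * ?\<delta> b b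
      - (?dG b b y * (\<Sum>c\<in>UNIV. y $ c * y $ c) + ?G b y * (\<Sum>c\<in>UNIV. ?\<delta> b c * y $ c + y $ c * ?\<delta> b c))" for b y
  have Gpd: "has_pd (- cball 0 1) b (?G a) (?dG b a y) y" if "y \<in> - cball 0 1" for a b y
    by (rule has_pd_bdry[OF g_pd[OF bdry_pt_in_end_region[OF that]] that])
  have pd: "has_pd (- cball 0 1) k (Z k) (Z' k y) y" if "y \<in> - cball 0 1" for k y
    unfolding Z_def[abs_def] Z'_def
    by (intro has_pd_sum has_pd_diff has_pd_add has_pd_mult Gpd has_pd_coord that)
  have "cone_int UNIV (\<lambda>y. \<Sum>k\<in>UNIV. Z' k y) r = 0"
  proof (rule exterior_tangential_divergence[OF _ _ pd _ r])
    show "continuous_on (- cball 0 1) (Z k)" for k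
      unfolding Z_def[abs_def]
      by ((rule G_cont bdry_cont[OF dg_cont])+ | rule bdry_cont[OF massV_cont] continuous_on_add continuous_on_diff continuous_on_mult
          continuous_on_sum continuous_on_const | rule continuous_on_component continuous_on_id)+
    show "continuous_on (- cball 0 1) (Z' k)" for k
      unfolding Z'_def[abs_def] by ((rule G_cont bdry_cont[OF dg_cont])+ | rule bdry_cont[OF massV_cont] continuous_on_add continuous_on_diff continuous_on_mult
          continuous_on_sum continuous_on_const | rule continuous_on_component continuous_on_id)+
    show "(\<Sum>k\<in>UNIV. Z k y * y $ k) = 0" for y
    proof -
      have "(\<Sum>k\<in>UNIV. Z k y * y $ k) = (\<Sum>a\<in>UNIV. ?G a y * y $ a) * (\<Sum>k\<in>UNIV. y $ k * y $ k) 
         - (\<Sum>k\<in>UNIV. ?G k y * y $ k) * (\<Sum>c\<in>UNIV. y $ c * y $ c)"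
      proof -
        have "(M * z - c * q) * z = M * (z * z) - (c * z) * q" for M z c q :: real
          by (simp add: algebra_simps)
        then show ?thesis
          unfolding Z_def by (simp only: sum_subtractf sum_distrib_left[symmetric] sum_distrib_right[symmetric])
      qed
      then show ?thesis by simp
    qed
  qed
  also have "cone_int UNIV (\<lambda>y. \<Sum>k\<in>UNIV. Z' k y) r = 
     cone_int UNIV (\<lambda>y. (\<Sum>a\<in>UNIV. \<Sum>b\<in>UNIV. dg (Some a) None (Some b) (bdry_pt y) * (y $ a * y $ b))
     - (\<Sum>a\<in>UNIV. dg (Some a) None (Some a) (bdry_pt y)) * (\<Sum>a\<in>UNIV. y $ a * y $ a)
     + (real CARD('m) - 1) * (\<Sum>a\<in>UNIV. g (bdry_pt y) $ Some a $ None * y $ a)) r"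
  proof (rule cone_int_cong)
    fix y :: "real^'m" assume "norm y = r"
    then have y: "bdry_pt y \<in> end_region" by (intro bdry_pt_in_end_region) (use r in auto)
    let ?r = "\<Sum>c\<in>UNIV. y $ c * y $ c" and ?Gy = "\<Sum>a\<in>UNIV. ?G a y * y $ a"
    have "Z' b y = (\<Sum>a\<in>UNIV. ?dG b a y * (y $ b * y $ a)) + ?Gy - ?dG b b y * ?r - ?G b y * y $ b" for b
    proof -
      have "(\<Sum>a\<in>UNIV. ?dG b a y * y $ a + ?G a y * ?\<delta> b a) = (\<Sum>a\<in>UNIV. ?dG b a y * y $ a) + ?G b y"
        by (simp only: sum.distrib sum_delta_mult)
      moreover have "(\<Sum>c\<in>UNIV. ?\<delta> b c * y $ c + y $ c * ?\<delta> b c) = y $ b + y $ b"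
        by (simp only: sum.distrib sum_delta_mult)
      moreover have "(\<Sum>a\<in>UNIV. ?dG b a y * y $ a) * y $ b = (\<Sum>a\<in>UNIV. ?dG b a y * (y $ b * y $ a))"
        unfolding sum_distrib_right by (simp only: mult_ac)
      ultimately show ?thesis unfolding Z'_def by (simp add: algebra_simps)
    qed
    then have "(\<Sum>b\<in>UNIV. Z' b y) = (\<Sum>b\<in>UNIV. \<Sum>a\<in>UNIV. ?dG b a y * (y $ b * y $ a))
        + real CARD('m) * ?Gy - (\<Sum>b\<in>UNIV. ?dG b b y) * ?r - ?Gy"
      by (simp add: sum.distrib sum_subtractf sum_distrib_right)
    also have "\<dots> = (\<Sum>a\<in>UNIV. \<Sum>b\<in>UNIV. dg (Some a) None (Some b) (bdry_pt y) * (y $ a * y $ b))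
     - (\<Sum>a\<in>UNIV. dg (Some a) None (Some a) (bdry_pt y)) * ?r + (real CARD('m) - 1) * ?Gy"
      by (simp add: dg_sym[OF y, of _ "Some _" None] algebra_simps)
    finally show "(\<Sum>b\<in>UNIV. Z' b y) = \<dots>" .
  qed
  finally show ?thesis .
qed

text \<open>
  The integrand \<open>2 linAH\<close> is the sum of the boundary terms of the two preceding identities and
  \<open>- (n - 2) g\<^sub>a\<^sub>1 y\<^sub>a\<close>, where \<open>n - 2\<close> appears as one less than the dimension of the hyperplane.
\<close>

theorem linear_flux_identity:
  assumes r: "1 < r"
  shows "cone_int half_space (\<lambda>x. linEin x / norm x) r + cone_int UNIV (\<lambda>y. linAH y / norm y) r
     = - (real CARD('m) - 1) / 2 * mass_flux r"
proof -
  let ?n = "real CARD('m) - 1"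
  let ?Vx = "\<lambda>x. \<Sum>i\<in>UNIV. massV i x * x $ i" 
  let ?Gy = "\<lambda>y. \<Sum>a\<in>UNIV. g (bdry_pt y) $ Some a $ None * y $ a"
  let ?B1 = "\<lambda>y. (\<Sum>a\<in>UNIV. \<Sum>b\<in>UNIV. (dg (Some a) None (Some b) (bdry_pt y) - dg None (Some a) (Some b) (bdry_pt y)) * (y $ a * y $ b))
         - massV None (bdry_pt y) * (\<Sum>a\<in>UNIV. y $ a * y $ a)"
  let ?B2 = "\<lambda>y. (\<Sum>a\<in>UNIV. \<Sum>b\<in>UNIV. dg (Some a) None (Some b) (bdry_pt y) * (y $ a * y $ b))
     - (\<Sum>a\<in>UNIV. dg (Some a) None (Some a) (bdry_pt y)) * (\<Sum>a\<in>UNIV. y $ a * y $ a)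
     + ?n * ?Gy y"
  have U: "is_cone (UNIV :: (real^'m) set)" by (simp add: is_cone_def)
  have D: "- cball 0 1 = UNIV - cball (0::real^'m) 1" by auto
  have E: "end_region = half_space - cball (0::real^('m option)) 1" by (rule end_region_def)
  have cV: "continuous_on end_region ?Vx" by (intro continuous_intros massV_cont)
  have cG: "continuous_on (- cball 0 1) ?Gy"
    by ((rule G_cont bdry_cont[OF dg_cont])+ | rule bdry_cont[OF massV_cont] continuous_on_add continuous_on_diff continuous_on_mult
          continuous_on_sum continuous_on_const | rule continuous_on_component continuous_on_id)+
  have cB1: "continuous_on (- cball 0 1) ?B1" by (intro continuous_intros bdry_cont dg_cont massV_cont)
  have cB2: "continuous_on (- cball 0 1) ?B2"
    by ((rule G_cont bdry_cont[OF dg_cont])+ | rule bdry_cont[OF massV_cont] continuous_on_add continuous_on_diff continuous_on_mult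
          continuous_on_sum continuous_on_const | rule continuous_on_component continuous_on_id)+
  have 1: "2 * cone_int half_space linEin r + ?n * cone_int half_space ?Vx r + cone_int UNIV ?B1 r = 0"
  proof -
    have "cone_int half_space (\<lambda>x. 2 * linEin x + ?n * ?Vx x) r 
       = cone_int half_space (\<lambda>x. 2 * linEin x) r + cone_int half_space (\<lambda>x. ?n * ?Vx x) r"
      by (rule cone_int_add[OF is_cone_half_space _ _ r]; unfold E[symmetric])
        (intro continuous_intros linEin_cont cV)+
    then show ?thesis
      using hemisphere_superpotential_identity[OF r] by (simp add: cone_int_cmult)
  qed
  have 2: "cone_int UNIV ?B2 r = 0" by (rule boundary_sphere_identity[OF r])
  have "cone_int UNIV (\<lambda>y. 2 * linAH y) r = cone_int UNIV (\<lambda>y. (?B1 y + ?B2 y) + (- ?n) * ?Gy y) r"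
  proof (rule cone_int_cong)
    fix y :: "real^'m" assume "norm y = r"
    let ?r = "\<Sum>c\<in>UNIV. y $ c * y $ c"
    let ?N = "\<lambda>a b. dg (Some a) None (Some b) (bdry_pt y)" and ?D = "\<lambda>a b. dg None (Some a) (Some b) (bdry_pt y)"
    have "(\<Sum>a\<in>UNIV. \<Sum>b\<in>UNIV. ?N b a * (y $ a * y $ b)) = (\<Sum>a\<in>UNIV. \<Sum>b\<in>UNIV. ?N a b * (y $ a * y $ b))"
      by (subst sum.swap) (simp add: mult_ac)
    moreover have "2 * (\<Sum>a\<in>UNIV. \<Sum>b\<in>UNIV. linA a b y * (y $ a * y $ b)) 
       = (\<Sum>a\<in>UNIV. \<Sum>b\<in>UNIV. (2 * linA a b y) * (y $ a * y $ b))"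
      by (simp add: sum_distrib_left mult_ac)
    moreover have "\<dots> = (\<Sum>a\<in>UNIV. \<Sum>b\<in>UNIV. ?N a b * (y $ a * y $ b)) + (\<Sum>a\<in>UNIV. \<Sum>b\<in>UNIV. ?N b a * (y $ a * y $ b))
        - (\<Sum>a\<in>UNIV. \<Sum>b\<in>UNIV. ?D a b * (y $ a * y $ b))"
    proof -
      have "2 * linA a b y = ?N a b + ?N b a - ?D a b" for a b by (simp add: linA_def)
      then show ?thesis by (simp only: distrib_right left_diff_distrib sum.distrib sum_subtractf)
    qed
    moreover have "2 * linH y = 2 * (\<Sum>a\<in>UNIV. ?N a a) - (\<Sum>a\<in>UNIV. ?D a a)"
    proof -
      have "2 * linA a a y = 2 * ?N a a - ?D a a" for a by (simp add: linA_def)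
      then show ?thesis unfolding linH_def by (simp only: sum_distrib_left sum_subtractf)
    qed
    moreover have "massV None (bdry_pt y) = (\<Sum>a\<in>UNIV. ?N a a) - (\<Sum>a\<in>UNIV. ?D a a)"
      by (simp add: massV_None sum_subtractf)
    moreover have "(\<Sum>a\<in>UNIV. \<Sum>b\<in>UNIV. (?N a b - ?D a b) * (y $ a * y $ b)) 
       = (\<Sum>a\<in>UNIV. \<Sum>b\<in>UNIV. ?N a b * (y $ a * y $ b)) - (\<Sum>a\<in>UNIV. \<Sum>b\<in>UNIV. ?D a b * (y $ a * y $ b))"
      by (simp add: left_diff_distrib sum_subtractf)
    moreover have "2 * (SA - H * q) = ((SND - M * q) + (SN - HN * q + n * G)) + (- n) * G"
      if "SN' = SN" "2 * SA = S2" "S2 = SN + SN' - SD" "2 * H = 2 * HN - HD" "M = HN - HD" "SND = SN - SD"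
      for SA H q SND M SN HN n G SN' S2 SD HD :: real
    proof -
      have e: "SA = SN - SD / 2" "H = HN - HD / 2" using that by auto
      show ?thesis unfolding e that(5,6) by (simp add: algebra_simps)
    qed
    ultimately show "2 * linAH y = (?B1 y + ?B2 y) + (- ?n) * ?Gy y"
      unfolding linAH_def by blast
  qed
  also have "\<dots> = cone_int UNIV ?B1 r + cone_int UNIV ?B2 r + (- ?n) * cone_int UNIV ?Gy r"
  proof -
    have "cone_int UNIV (\<lambda>y. (?B1 y + ?B2 y) + (- ?n) * ?Gy y) r 
        = cone_int UNIV (\<lambda>y. ?B1 y + ?B2 y) r + cone_int UNIV (\<lambda>y. (- ?n) * ?Gy y) r"
      by (rule cone_int_add[OF U _ _ r]; unfold D[symmetric])
        (intro continuous_on_add[OF cB1 cB2] continuous_on_mult_left[OF cG])+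
    moreover have "cone_int UNIV (\<lambda>y. ?B1 y + ?B2 y) r = cone_int UNIV ?B1 r + cone_int UNIV ?B2 r"
      by (rule cone_int_add[OF U _ _ r]; unfold D[symmetric]) (rule cB1 cB2)+
    ultimately show ?thesis by (simp only: cone_int_cmult)
  qed
  finally have 3: "2 * cone_int UNIV linAH r = cone_int UNIV ?B1 r - ?n * cone_int UNIV ?Gy r"
    using 2 unfolding cone_int_cmult by linarith
  have norm: "cone_int C (\<lambda>x. f x / norm x) r = cone_int C f r / r" for C f
  proof -
    have "cone_int C (\<lambda>x. f x / norm x) r = cone_int C (\<lambda>x. inverse r * f x) r"
      by (rule cone_int_cong) (simp add: divide_inverse mult.commute)
    then show ?thesis by (simp add: cone_int_cmult divide_inverse mult.commute)
  qed
  have "mass_flux r = (cone_int half_space ?Vx r + cone_int UNIV ?Gy r) / r"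
    unfolding mass_flux_def times_divide_eq_right sum_divide_distrib[symmetric] norm by (simp add: add_divide_distrib)
  moreover have "2 * (cone_int half_space linEin r + cone_int UNIV linAH r) 
      = - ?n * (cone_int half_space ?Vx r + cone_int UNIV ?Gy r)"
    using 1 3 by (simp add: algebra_simps)
  moreover have "P / r + Q / r = - n / 2 * M" if "M = (v + w) / r" "2 * (P + Q) = - n * (v + w)"
    for P Q n M v w :: real
  proof -
    have "P + Q = - n * (v + w) / 2" using that(2) by simp
    then have "(P + Q) / r = - n / 2 * ((v + w) / r)" by simp
    then show ?thesis by (simp only: that(1) add_divide_distrib[symmetric])
  qed
  ultimately show ?thesis unfolding norm by blast
qed

end

section \<open>Positive definite matrices: unit normals and induced densities\<close>

definition spd :: "real^'n^'n::finite \<Rightarrow> bool" where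
  "spd m \<longleftrightarrow> transpose m = m \<and> (\<forall>v. v \<noteq> 0 \<longrightarrow> form m v v > 0)"

lemma spd_invertible: assumes "spd m" shows "invertible m"
proof -
  have "v = 0" if "m *v v = 0" for v
    using assms that unfolding spd_def form_def by force
  then have "\<exists>B. B ** m = mat 1" using matrix_left_invertible_ker by blast
  then show ?thesis by (simp add: invertible_left_inverse)
qed

lemma matrix_inv_invertible:
  assumes "invertible m" shows "m ** matrix_inv m = mat 1" "matrix_inv m ** m = mat 1"
  using someI_ex[OF assms[unfolded invertible_def]] unfolding matrix_inv_def by auto

text \<open>
  Cramer's rule makes continuity, differentiability and asymptotics of the inverse matrix follow from
  those of determinants.
\<close>

lemma matrix_inv_cramer:
  fixes m :: "real^'n^'n::finite"
  assumes "invertible m"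
  shows "matrix_inv m $ k $ j = det (\<chi> r c. if c = k then axis j 1 $ r else m $ r $ c) / det m"
proof -
  have "m *v (matrix_inv m *v axis j 1) = axis j 1"
    by (simp add: matrix_vector_mul_assoc matrix_inv_invertible[OF assms])
  moreover have "det m \<noteq> 0" using assms by (simp add: invertible_det_nz)
  ultimately have "matrix_inv m *v axis j 1 = (\<chi> k. det(\<chi> r c. if c=k then axis j 1 $r else m$r$c) / det m)"
    using cramer by blast
  moreover have "(matrix_inv m *v axis j 1) $ k = matrix_inv m $ k $ j"
    by (simp add: matrix_vector_mult_basis column_def)
  ultimately show ?thesis by simp
qed

lemma matrix_inv_pos:
  assumes "spd m" "d \<noteq> 0" shows "d \<bullet> (matrix_inv m *v d) > 0"
proof -
  note I = matrix_inv_invertible[OF spd_invertible[OF assms(1)]]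
  let ?v = "matrix_inv m *v d"
  have mv: "m *v ?v = d" by (simp add: matrix_vector_mul_assoc I)
  then have "?v \<noteq> 0" using assms(2) by auto
  then have "form m ?v ?v > 0" using assms(1) by (simp add: spd_def)
  then show ?thesis by (simp add: form_def mv inner_commute)
qed

text \<open>
  A vector that is \<open>m\<close>-orthogonal to the hyperplane \<open>d\<^sup>\<bottom>\<close> is mapped by \<open>m\<close> to a multiple of \<open>d\<close>.
\<close>

lemma unit_normal_eq:
  assumes "spd m" "d \<noteq> 0"
  shows "unit_normal m d = (1 / sqrt (d \<bullet> (matrix_inv m *v d))) *\<^sub>R (matrix_inv m *v d)"
proof -
  note I = matrix_inv_invertible[OF spd_invertible[OF assms(1)]]
  define q where "q = d \<bullet> (matrix_inv m *v d)"
  have q: "q > 0" unfolding q_def by (rule matrix_inv_pos[OF assms])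
  have sym: "form m v w = (m *v v) \<bullet> w" for v w
    using assms(1) unfolding spd_def form_def by (metis dot_lmul_matrix inner_commute transpose_matrix_vector)
  let ?v = "(1 / sqrt q) *\<^sub>R (matrix_inv m *v d)"
  have mv: "m *v ?v = (1 / sqrt q) *\<^sub>R d" by (simp add: matrix_vector_mult_scaleR matrix_vector_mul_assoc I)
  have vd: "?v \<bullet> d = q / sqrt q" by (simp add: q_def inner_commute)
  show ?thesis
    unfolding unit_normal_def q_def[symmetric]
  proof (rule the_equality)
    show "form m ?v ?v = 1 \<and> (\<forall>w. w \<bullet> d = 0 \<longrightarrow> form m ?v w = 0) \<and> ?v \<bullet> d > 0"
      unfolding sym mv using q vd by (auto simp: inner_commute real_sqrt_mult[symmetric])
  next
    fix v assume v: "form m v v = 1 \<and> (\<forall>w. w \<bullet> d = 0 \<longrightarrow> form m v w = 0) \<and> v \<bullet> d > 0"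
    define c where "c = (m *v v) \<bullet> d / (d \<bullet> d)"
    define w where "w = m *v v - c *\<^sub>R d"
    have wd: "w \<bullet> d = 0" using assms(2) by (simp add: w_def c_def inner_diff_left)
    then have "(m *v v) \<bullet> w = 0" using v sym by auto
    then have "w \<bullet> w = 0" using wd by (simp add: w_def inner_diff_left inner_commute)
    then have "m *v v = c *\<^sub>R d" by (simp add: w_def)
    then have "matrix_inv m *v (m *v v) = c *\<^sub>R (matrix_inv m *v d)" by (simp add: matrix_vector_mult_scaleR)
    then have vc: "v = c *\<^sub>R (matrix_inv m *v d)" by (simp add: matrix_vector_mul_assoc I)
    then have "v \<bullet> d = c * q" by (simp add: q_def inner_commute)
    then have c0: "c > 0" using v q by (simp add: zero_less_mult_iff)
    have "form m v v = c * (d \<bullet> v)" using \<open>m *v v = c *\<^sub>R d\<close> by (simp add: sym)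
    also have "\<dots> = c\<^sup>2 * q" using \<open>v \<bullet> d = c * q\<close> by (simp add: inner_commute power2_eq_square)
    finally have "c\<^sup>2 * q = 1" using v by simp
    then have "c\<^sup>2 = 1 / q" using q by (simp add: field_simps)
    then have "c = 1 / sqrt q" using c0 by (metis real_sqrt_divide real_sqrt_one real_sqrt_unique less_imp_le)
    then show "v = ?v" using vc by simp
  qed
qed

text \<open>
  Extend \<open>B\<close> by the direction of \<open>d\<close> to an orthonormal basis of the space.  In this basis the Gram
  determinant is a principal minor of \<open>m\<close>, hence \<open>det m\<close> times a diagonal entry of the inverse.  The
  right side does not depend on \<open>B\<close>; this is what makes the induced density continuous in the point.
\<close>

lemma gram_determinant:
  fixes m :: "real^'n^'n::finite"
  assumes m: "spd m" and d: "d \<noteq> 0" and B: "pairwise orthogonal B" "\<forall>v\<in>B. norm v = 1" "span B = {w. w \<bullet> d = 0}"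
  shows "(\<Sum>p | p permutes B. of_int (sign p) * (\<Prod>v\<in>B. form m v (p v))) = det m * (d \<bullet> (matrix_inv m *v d)) / (d \<bullet> d)"
proof -
  note I = matrix_inv_invertible[OF spd_invertible[OF m]]
  define u where "u = d /\<^sub>R norm d"
  have u: "norm u = 1" using d by (simp add: u_def)
  have Bd: "v \<bullet> d = 0" if "v \<in> B" for v using B(3) span_base[OF that] by auto
  then have Bu: "v \<bullet> u = 0" if "v \<in> B" for v using that by (simp add: u_def)
  have uB: "u \<notin> B" using Bu u by (metis norm_eq_zero inner_eq_zero_iff zero_neq_one)
  let ?C = "insert u B"
  have orth: "pairwise orthogonal ?C"
    using B(1) Bu by (auto simp: pairwise_insert orthogonal_def inner_commute)
  have ind: "independent ?C"
    by (rule pairwise_orthogonal_independent[OF orth]) (use B(2) u in auto)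
  have "x \<in> span ?C" for x
  proof -
    have "(x - (x \<bullet> u) *\<^sub>R u) \<bullet> d = 0"
      using d by (simp add: u_def inner_diff_left dot_square_norm power2_eq_square field_simps)
    then have "x - (x \<bullet> u) *\<^sub>R u \<in> span B" using B(3) by simp
    moreover have "span B \<subseteq> span ?C" by (rule span_mono) auto
    ultimately have "x - (x \<bullet> u) *\<^sub>R u \<in> span ?C" by (rule rev_subsetD)
    moreover have "(x \<bullet> u) *\<^sub>R u \<in> span ?C" by (simp add: span_scale span_base)
    ultimately have "(x - (x \<bullet> u) *\<^sub>R u) + (x \<bullet> u) *\<^sub>R u \<in> span ?C" by (rule span_add)
    then show ?thesis by simp
  qed
  then have sp: "span ?C = UNIV" by auto
  have fC: "finite ?C" by (rule independent_imp_finite[OF ind])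
  have "card ?C = CARD('n)"
    using basis_card_eq_dim[of ?C UNIV] ind sp by (simp add: dim_UNIV)
  then obtain \<beta> :: "'n \<Rightarrow> real^'n" where \<beta>: "bij_betw \<beta> UNIV ?C"
    using finite_same_card_bij[of "UNIV :: 'n set" ?C] fC by auto
  obtain i0 where i0: "\<beta> i0 = u" using \<beta> by (metis bij_betw_imp_surj_on insertI1 imageE)
  let ?S = "UNIV - {i0}"
  have inj: "inj \<beta>" using \<beta> by (simp add: bij_betw_def)
  have \<beta>S: "bij_betw \<beta> ?S B"
  proof -
    have "\<beta> ` ?S = \<beta> ` UNIV - \<beta> ` {i0}" using inj by (simp add: image_set_diff)
    also have "\<dots> = B" using \<beta> i0 uB by (simp add: bij_betw_def)
    finally show ?thesis using inj by (auto simp: bij_betw_def inj_on_def)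
  qed
  have on: "\<beta> i \<bullet> \<beta> j = (if i = j then 1 else 0)" for i j
  proof -
    have mem: "\<beta> i \<in> ?C" "\<beta> j \<in> ?C" using \<beta> by (auto simp: bij_betw_def)
    moreover have "norm v = 1" if "v \<in> ?C" for v using that B(2) u by auto
    moreover have "\<beta> i \<bullet> \<beta> j = 0" if "i \<noteq> j"
      using pairwiseD[OF orth mem] that inj by (auto simp: orthogonal_def inj_def)
    ultimately show ?thesis by (auto simp: dot_square_norm)
  qed
  (* The orthogonal matrix with rows \<beta> i; M and N are m and its inverse in the basis \<beta>. *)
  define Q where "Q = (\<chi> i. \<beta> i)"
  have QQ: "Q ** transpose Q = mat 1"
    by (simp add: vec_eq_iff matrix_matrix_mult_def transpose_def mat_def Q_def on[unfolded inner_vec_def, simplified])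
  then have QQ': "transpose Q ** Q = mat 1" by (simp add: matrix_left_right_inverse)
  define M where "M = Q ** m ** transpose Q"
  define N where "N = Q ** matrix_inv m ** transpose Q"
  have conj: "(Q ** A ** transpose Q) $ i $ j = \<beta> i \<bullet> (A *v \<beta> j)" for A i j
  proof -
    have "(Q ** A ** transpose Q) $ i $ j = (Q ** (A ** transpose Q)) $ i $ j" by (simp add: matrix_mul_assoc)
    also have "\<dots> = (\<Sum>k\<in>UNIV. \<beta> i $ k * (\<Sum>l\<in>UNIV. A $ k $ l * \<beta> j $ l))"
      by (simp add: matrix_matrix_mult_def transpose_def Q_def)
    finally show ?thesis by (simp add: inner_vec_def matrix_vector_mult_def)
  qed
  have Mij: "M $ i $ j = form m (\<beta> i) (\<beta> j)" for i j unfolding M_def conj form_def ..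
  have MN: "M ** N = mat 1"
  proof -
    have "M ** N = Q ** m ** (transpose Q ** Q) ** matrix_inv m ** transpose Q"
      unfolding M_def N_def by (simp add: matrix_mul_assoc)
    also have "\<dots> = Q ** (m ** matrix_inv m) ** transpose Q" unfolding QQ' by (simp add: matrix_mul_assoc)
    also have "\<dots> = mat 1" unfolding I by (simp add: QQ)
    finally show ?thesis .
  qed
  have dM: "det M = det m"
  proof -
    have "det Q * det (transpose Q) = 1" using QQ by (metis det_I det_mul)
    then show ?thesis unfolding M_def det_mul by (simp add: mult_ac)
  qed
  have dm: "det m \<noteq> 0" using spd_invertible[OF m] by (simp add: invertible_det_nz)
  (* Cramer's rule for the entry of N at i0; in the Leibniz expansion of this determinant only the
     permutations that fix i0 survive, and \<beta> identifies them with the permutations of B. *)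
  let ?A = "\<chi> r c. if c = i0 then axis i0 1 $ r else M $ r $ c"
  have "M *v (N *v axis i0 1) = axis i0 1" by (simp add: matrix_vector_mul_assoc MN)
  moreover have "det M \<noteq> 0" using dm dM by simp
  ultimately have "N *v axis i0 1 = (\<chi> k. det(\<chi> r c. if c=k then axis i0 1 $r else M$r$c) / det M)"
    using cramer[of M "N *v axis i0 1" "axis i0 1"] by blast
  moreover have "(N *v axis i0 1) $ i0 = N $ i0 $ i0"
    by (simp add: matrix_vector_mult_basis column_def)
  ultimately have "N $ i0 $ i0 = det ?A / det M" by simp
  then have detA: "det ?A = det m * (u \<bullet> (matrix_inv m *v u))"
    using dm dM unfolding N_def conj i0 by (simp add: field_simps)
  have "det ?A = (\<Sum>p | p permutes UNIV. of_int (sign p) * (\<Prod>i\<in>UNIV. ?A $ i $ p i))"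
    by (simp add: det_def)
  also have "\<dots> = (\<Sum>p | p permutes ?S. of_int (sign p) * (\<Prod>i\<in>UNIV. ?A $ i $ p i))"
  proof (rule sum.mono_neutral_right)
    show "{p. p permutes ?S} \<subseteq> {p. p permutes (UNIV :: 'n set)}" by (auto intro: permutes_subset)
    show "\<forall>p\<in>{p. p permutes UNIV} - {p. p permutes ?S}. of_int (sign p) * (\<Prod>i\<in>UNIV. ?A $ i $ p i) = 0"
    proof
      fix p assume p: "p \<in> {p. p permutes UNIV} - {p. p permutes ?S}"
      have ne: "p i0 \<noteq> i0"
      proof
        assume "p i0 = i0"
        then have "p permutes ?S" using p by (intro permutes_superset[of p UNIV ?S]) auto
        with p show False by simp
      qed
      have "surj p" using p permutes_surj by auto
      then obtain i where i: "p i = i0" by (metis surjD)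
      with ne have "i \<noteq> i0" by auto
      then have "?A $ i $ p i = 0" using i by (simp add: axis_def)
      then have "(\<Prod>i\<in>UNIV. ?A $ i $ p i) = 0" by (meson UNIV_I finite prod_zero)
      then show "of_int (sign p) * (\<Prod>i\<in>UNIV. ?A $ i $ p i) = 0" by simp
    qed
  qed (simp add: finite_permutations)
  also have "\<dots> = (\<Sum>p | p permutes ?S. of_int (sign p) * (\<Prod>i\<in>?S. M $ i $ p i))"
  proof (rule sum.cong[OF refl])
    fix p assume p: "p \<in> {p. p permutes ?S}"
    then have pi0: "p i0 = i0" by (auto simp: permutes_def)
    have pi: "p i \<noteq> i0" if "i \<noteq> i0" for i
    proof
      assume "p i = i0"
      with pi0 have "p i = p i0" by simp
      moreover have "inj p" using p permutes_inj by blast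
      ultimately have "i = i0" by (rule injD[rotated])
      with that show False ..
    qed
    have "(\<Prod>i\<in>UNIV. ?A $ i $ p i) = ?A $ i0 $ p i0 * (\<Prod>i\<in>?S. ?A $ i $ p i)"
      by (rule prod.remove) auto
    also have "?A $ i0 $ p i0 = 1" by (simp add: pi0)
    also have "(\<Prod>i\<in>?S. ?A $ i $ p i) = (\<Prod>i\<in>?S. M $ i $ p i)"
      by (rule prod.cong) (use pi in auto)
    finally show "of_int (sign p) * (\<Prod>i\<in>UNIV. ?A $ i $ p i) = of_int (sign p) * (\<Prod>i\<in>?S. M $ i $ p i)" by simp
  qed
  also have "\<dots> = (\<Sum>p | p permutes B. of_int (sign p) * (\<Prod>v\<in>B. form m v (p v)))"
  proof -
    let ?f = "\<lambda>p x. if x \<in> B then \<beta> (p (inv_into ?S \<beta> x)) else x"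
    have fp: "?f p = map_permutation ?S \<beta> p" for p
      using \<beta>S by (auto simp: map_permutation_def restrict_id_def bij_betw_def fun_eq_iff)
    have "(\<Sum>p | p permutes ?S. of_int (sign p) * (\<Prod>i\<in>?S. M $ i $ p i))
      = (\<Sum>p | p permutes ?S. of_int (sign (?f p)) * (\<Prod>v\<in>B. form m v (?f p v)))"
    proof (rule sum.cong[OF refl])
      fix p assume p: "p \<in> {p. p permutes ?S}"
      have "sign (?f p) = sign p"
        unfolding fp by (rule sign_map_permutation) (use p inj in \<open>auto simp: inj_on_def inj_def\<close>)
      moreover have "(\<Prod>v\<in>B. form m v (?f p v)) = (\<Prod>i\<in>?S. form m (\<beta> i) (?f p (\<beta> i)))"
        by (rule prod.reindex_bij_betw[OF \<beta>S, symmetric])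
      moreover have "\<dots> = (\<Prod>i\<in>?S. M $ i $ p i)"
      proof (rule prod.cong[OF refl])
        fix i assume i: "i \<in> ?S"
        then have "\<beta> i \<in> B" using \<beta>S by (auto simp: bij_betw_def)
        moreover have "inv_into ?S \<beta> (\<beta> i) = i" using \<beta>S i by (rule bij_betw_inv_into_left)
        ultimately show "form m (\<beta> i) (?f p (\<beta> i)) = M $ i $ p i" by (simp add: Mij)
      qed
      ultimately show "of_int (sign p) * (\<Prod>i\<in>?S. M $ i $ p i) = of_int (sign (?f p)) * (\<Prod>v\<in>B. form m v (?f p v))" by simp
    qed
    also have "\<dots> = (\<Sum>p | p permutes B. of_int (sign p) * (\<Prod>v\<in>B. form m v (p v)))"
      using sum.reindex_bij_betw[OF bij_betw_permutations[OF \<beta>S], of "\<lambda>p. of_int (sign p) * (\<Prod>v\<in>B. form m v (p v))"]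
      by simp
    finally show ?thesis .
  qed
  finally have "(\<Sum>p | p permutes B. of_int (sign p) * (\<Prod>v\<in>B. form m v (p v))) = det m * (u \<bullet> (matrix_inv m *v u))"
    using detA by simp
  also have "u \<bullet> (matrix_inv m *v u) = (d \<bullet> (matrix_inv m *v d)) / (d \<bullet> d)"
    unfolding u_def using d by (simp add: matrix_vector_mult_scaleR dot_square_norm power2_eq_square field_simps)
  finally show ?thesis by simp
qed

lemma induced_density_eq:
  fixes m :: "real^'n^'n::finite"
  assumes m: "spd m" and d: "d \<noteq> 0"
  shows "induced_density m d = sqrt (det m * (d \<bullet> (matrix_inv m *v d)) / (d \<bullet> d))"
proof -
  let ?P = "\<lambda>B. pairwise orthogonal B \<and> (\<forall>v\<in>B. norm v = 1) \<and> span B = {w. w \<bullet> d = 0}"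
  have "subspace {w. w \<bullet> d = 0}" by (auto simp: subspace_def inner_add_left)
  from orthonormal_basis_subspace[OF this] obtain B where "?P B" by (metis (no_types, lifting))
  then have "?P (SOME B. ?P B)" by (rule someI)
  then show ?thesis unfolding induced_density_def Let_def using gram_determinant[OF m d] by auto
qed

section \<open>Growth orders at infinity\<close>

text \<open>
  Functions that grow at most like \<open>|x|\<^sup>s\<close> along the filter \<open>F\<close>.  Under products the exponents add, and
  \<open>0\<close> is the exponent of bounded functions.
\<close>

definition growth :: "'a::real_normed_vector filter \<Rightarrow> real \<Rightarrow> ('a \<Rightarrow> real) set" where
  "growth F s = O[F](\<lambda>x. norm x powr s)"

lemma growth_norm_ge: "F \<le> at_infinity \<Longrightarrow> \<forall>\<^sub>F x in F. norm x \<ge> b"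
  unfolding le_filter_def by (auto simp: eventually_at_infinity)

lemma growth_mono:
  assumes F: "F \<le> at_infinity" and f: "f \<in> growth F a" and "a \<le> b"
  shows "f \<in> growth F b"
proof -
  have "\<forall>\<^sub>F x in F. norm (norm x powr a) \<le> 1 * norm (norm x powr b)"
    using growth_norm_ge[OF F, of 1] by eventually_elim (use assms(3) in \<open>auto intro: powr_mono\<close>)
  then have "(\<lambda>x. norm x powr a) \<in> O[F](\<lambda>x. norm x powr b)" by (rule bigoI)
  with f show ?thesis unfolding growth_def by (rule landau_o.big_trans)
qed

lemma growth_mult:
  assumes "F \<le> at_infinity" "f \<in> growth F a" "g \<in> growth F b" "a + b \<le> c"
  shows "(\<lambda>x. f x * g x) \<in> growth F c"
proof -
  have "(\<lambda>x. f x * g x) \<in> growth F (a + b)"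
    using landau_o.big.mult[OF assms(2,3)[unfolded growth_def]] unfolding growth_def by (simp add: powr_add)
  then show ?thesis using growth_mono assms(1,4) by blast
qed

lemma growth_add: "f \<in> growth F s \<Longrightarrow> g \<in> growth F s \<Longrightarrow> (\<lambda>x. f x + g x) \<in> growth F s"
  unfolding growth_def by (rule sum_in_bigo)

lemma growth_diff: "f \<in> growth F s \<Longrightarrow> g \<in> growth F s \<Longrightarrow> (\<lambda>x. f x - g x) \<in> growth F s"
  unfolding growth_def by (rule sum_in_bigo)

lemma growth_uminus: "f \<in> growth F s \<Longrightarrow> (\<lambda>x. - f x) \<in> growth F s"
  unfolding growth_def by simp

lemma growth_cmult: "f \<in> growth F s \<Longrightarrow> (\<lambda>x. c * f x) \<in> growth F s"
  unfolding growth_def by (cases "c = 0") auto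

lemma growth_sum: "(\<And>k. k \<in> A \<Longrightarrow> f k \<in> growth F s) \<Longrightarrow> (\<lambda>x. \<Sum>k\<in>A. f k x) \<in> growth F s"
  unfolding growth_def by (rule big_sum_in_bigo)

lemma growth_cong: "f \<in> growth F s \<Longrightarrow> \<forall>\<^sub>F x in F. f x = h x \<Longrightarrow> h \<in> growth F s"
  unfolding growth_def by (subst (asm) landau_o.big.in_cong)

lemma growth_const: 
  assumes "F \<le> at_infinity" shows "(\<lambda>_. c) \<in> growth F 0"
  unfolding growth_def
proof (rule bigoI)
  show "\<forall>\<^sub>F x in F. norm c \<le> norm c * norm (norm x powr 0)"
    using growth_norm_ge[OF assms, of 1] by eventually_elim auto
qed

lemma growth_approx_bounded:
  assumes "F \<le> at_infinity" "(\<lambda>x. f x - c) \<in> growth F s" "s \<le> 0"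
  shows "f \<in> growth F 0"
  using growth_add[OF growth_mono[OF assms] growth_const[OF assms(1), of c]] by simp

lemma growth_approx_close:
  assumes F: "F \<le> at_infinity" and "(\<lambda>x. f x - h x) \<in> growth F s" "h \<in> growth F s'" "s \<le> s'"
  shows "f \<in> growth F s'"
  using growth_add[OF growth_mono[OF F assms(2,4)] assms(3)] by simp

lemma growth_coord: fixes F :: "(real^'n::finite) filter"
  assumes "F \<le> at_infinity" shows "(\<lambda>x. x $ i) \<in> growth F 1"
  unfolding growth_def
proof (rule bigoI)
  show "\<forall>\<^sub>F x in F. norm (x $ i) \<le> 1 * norm (norm x powr 1)"
    using growth_norm_ge[OF assms, of 1] by eventually_elim (auto intro: component_le_norm_cart)
qed

lemma growth_unit_coord: fixes F :: "(real^'n::finite) filter"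
  assumes "F \<le> at_infinity" shows "(\<lambda>x. x $ i / norm x) \<in> growth F 0"
  unfolding growth_def
proof (rule bigoI)
  show "\<forall>\<^sub>F x in F. norm (x $ i / norm x) \<le> 1 * norm (norm x powr 0)"
    using growth_norm_ge[OF assms, of 1] by eventually_elim (auto intro: component_le_norm_cart)
qed

lemma growth_tendsto_zero:
  assumes F: "F \<le> at_infinity" and f: "f \<in> growth F s" and s: "s < 0"
  shows "(f \<longlongrightarrow> 0) F"
proof -
  have "filterlim (\<lambda>x::'a. norm x) at_top F"
    using filterlim_mono[OF filterlim_norm_at_top order.refl F] by simp
  then have "((\<lambda>x. norm x powr s) \<longlongrightarrow> 0) F" by (rule tendsto_neg_powr[OF s])
  then have t: "((\<lambda>x. c * norm x powr s) \<longlongrightarrow> 0) F" for c by (rule tendsto_mult_right_zero)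
  from f obtain c where "\<forall>\<^sub>F x in F. norm (f x) \<le> c * norm (norm x powr s)"
    unfolding growth_def by (elim landau_o.bigE) auto
  then have "\<forall>\<^sub>F x in F. norm (f x) \<le> c * norm x powr s" by simp
  then show ?thesis by (rule Lim_null_comparison[OF _ t])
qed

lemma growth_approx_tendsto:
  assumes "F \<le> at_infinity" "(\<lambda>x. f x - c) \<in> growth F s" "s < 0"
  shows "(f \<longlongrightarrow> c) F"
  using growth_tendsto_zero[OF assms] Lim_null by blast

text \<open>
  A product of factors close to constants differs from the product of the constants to the same order,
  since the other factors are bounded.
\<close>

lemma growth_prod_approx:
  assumes F: "F \<le> at_infinity" and s: "s < 0" and "finite A"
    and f: "\<And>k. k \<in> A \<Longrightarrow> (\<lambda>x. f k x - c k) \<in> growth F s"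
  shows "(\<lambda>x. (\<Prod>k\<in>A. f k x) - (\<Prod>k\<in>A. c k)) \<in> growth F s"
  using \<open>finite A\<close> f
proof (induction A)
  case empty
  show ?case by (simp add: growth_def)
next
  case (insert k A)
  let ?P = "\<lambda>x. \<Prod>k\<in>A. f k x" and ?C = "\<Prod>k\<in>A. c k"
  have IH: "(\<lambda>x. ?P x - ?C) \<in> growth F s" using insert by auto
  have fk: "(\<lambda>x. f k x - c k) \<in> growth F s" using insert by auto
  have "?P \<in> growth F 0" by (rule growth_approx_bounded[OF F IH]) (use s in simp)
  from growth_mult[OF F fk this] have 1: "(\<lambda>x. (f k x - c k) * ?P x) \<in> growth F s" by simp
  have "(\<lambda>x. (f k x - c k) * ?P x + c k * (?P x - ?C)) \<in> growth F s"
    by (rule growth_add[OF 1 growth_cmult[OF IH]])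
  then show ?case using insert by (simp add: algebra_simps)
qed

lemma growth_inverse_approx:
  assumes F: "F \<le> at_infinity" and s: "s < 0" and f: "(\<lambda>x. f x - 1) \<in> growth F s"
  shows "(\<lambda>x. inverse (f x) - 1) \<in> growth F s"
proof -
  have t: "(f \<longlongrightarrow> 1) F" by (rule growth_approx_tendsto[OF F f s])
  have ne: "\<forall>\<^sub>F x in F. f x \<noteq> 0" using tendsto_imp_eventually_ne[OF t] by simp
  have "((\<lambda>x. inverse (f x)) \<longlongrightarrow> inverse 1) F" by (rule tendsto_inverse[OF t]) simp
  then have "(\<lambda>x. inverse (f x)) \<in> O[F](\<lambda>_. 1)" by (intro bigoI_tendsto[where c="inverse 1"]) auto
  moreover have "(\<lambda>_. 1) \<in> O[F](\<lambda>x. norm x powr 0)" using growth_const[OF F, of 1] by (simp add: growth_def)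
  ultimately have "(\<lambda>x. inverse (f x)) \<in> growth F 0" unfolding growth_def by (rule landau_o.big_trans)
  from growth_mult[OF F growth_uminus[OF f] this, of s]
  have "(\<lambda>x. - (f x - 1) * inverse (f x)) \<in> growth F s" by simp
  then show ?thesis
    by (rule growth_cong) (use ne in eventually_elim, auto simp: field_simps)
qed

lemma growth_sqrt_approx:
  assumes F: "F \<le> at_infinity" and s: "s < 0" and f: "(\<lambda>x. f x - 1) \<in> growth F s"
  shows "(\<lambda>x. sqrt (f x) - 1) \<in> growth F s"
proof -
  have t: "(f \<longlongrightarrow> 1) F" by (rule growth_approx_tendsto[OF F f s])
  have "\<forall>\<^sub>F x in F. f x > 0" using order_tendstoD(1)[OF t, of 0] by simp
  then have "\<forall>\<^sub>F x in F. norm (sqrt (f x) - 1) \<le> 1 * norm (f x - 1)"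
  proof eventually_elim
    case (elim x)
    have "f x - 1 = (sqrt (f x) - 1) * (sqrt (f x) + 1)" using elim by (simp add: algebra_simps)
    then have "norm (f x - 1) = norm (sqrt (f x) - 1) * (sqrt (f x) + 1)" using elim by (simp add: abs_mult)
    moreover have "norm (sqrt (f x) - 1) * 1 \<le> norm (sqrt (f x) - 1) * (sqrt (f x) + 1)"
      using elim by (intro mult_left_mono) auto
    ultimately show ?case by simp
  qed
  then have "(\<lambda>x. sqrt (f x) - 1) \<in> O[F](\<lambda>x. f x - 1)" by (rule bigoI)
  then show ?thesis using f unfolding growth_def by (rule landau_o.big_trans)
qed

lemma growth_mult_approx:
  assumes F: "F \<le> at_infinity" and s: "s < 0" and f: "(\<lambda>x. f x - 1) \<in> growth F s" and h: "(\<lambda>x. h x - 1) \<in> growth F s"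
  shows "(\<lambda>x. f x * h x - 1) \<in> growth F s"
proof -
  have "(\<lambda>x. (f x - 1) * h x + (h x - 1)) \<in> growth F s"
    by (rule growth_add[OF growth_mult[OF F f growth_approx_bounded[OF F h]] h]) (use s in auto)
  then show ?thesis by (simp add: algebra_simps)
qed

text \<open>
  Matrix fields that differ from the identity by \<open>O(|x|\<^sup>s)\<close> with \<open>s < 0\<close>.
\<close>

definition near_id :: "'a::real_normed_vector filter \<Rightarrow> real \<Rightarrow> ('a \<Rightarrow> real^'n^'n::finite) \<Rightarrow> bool" where
  "near_id F s m \<longleftrightarrow> F \<le> at_infinity \<and> s < 0 \<and> (\<forall>i j. (\<lambda>x. m x $ i $ j - mat 1 $ i $ j) \<in> growth F s)"

lemma near_id_det:
  fixes m :: "'a::real_normed_vector \<Rightarrow> real^'n^'n::finite"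
  assumes "near_id F s m" shows "(\<lambda>x. det (m x) - 1) \<in> growth F s"
proof -
  have F: "F \<le> at_infinity" and s: "s < 0" and e: "\<And>i j. (\<lambda>x. m x $ i $ j - mat 1 $ i $ j) \<in> growth F s"
    using assms by (auto simp: near_id_def)
  have "(\<lambda>x. (\<Sum>p | p permutes (UNIV :: 'n set). of_int (sign p) * ((\<Prod>i\<in>UNIV. m x $ i $ p i) - (\<Prod>i\<in>UNIV. mat 1 $ i $ p i)))) \<in> growth F s"
    by (intro growth_sum growth_cmult growth_prod_approx[OF F s] e) auto
  moreover have "(\<Sum>p | p permutes (UNIV :: 'n set). of_int (sign p) * ((\<Prod>i\<in>UNIV. m x $ i $ p i) - (\<Prod>i\<in>UNIV. mat 1 $ i $ p i)))
     = det (m x) - det (mat 1 :: real^'n^'n)" for x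
    by (simp add: det_def right_diff_distrib sum_subtractf)
  ultimately show ?thesis by simp
qed

text \<open>
  The inverse is bounded by Cramer's rule, and then \<open>m\<^sup>-\<^sup>1 - 1 = (1 - m) m\<^sup>-\<^sup>1\<close>.
\<close>

lemma near_id_inverse:
  fixes m :: "'a::real_normed_vector \<Rightarrow> real^'n^'n::finite"
  assumes "near_id F s m" shows "near_id F s (\<lambda>x. matrix_inv (m x))"
proof -
  have F: "F \<le> at_infinity" and s: "s < 0" and e: "\<And>i j. (\<lambda>x. m x $ i $ j - mat 1 $ i $ j) \<in> growth F s"
    using assms by (auto simp: near_id_def)
  note d = near_id_det[OF assms]
  have "((\<lambda>x. det (m x)) \<longlongrightarrow> 1) F" by (rule growth_approx_tendsto[OF F d s])
  then have ne: "\<forall>\<^sub>F x in F. det (m x) \<noteq> 0" using tendsto_imp_eventually_ne by fastforce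
  have b: "(\<lambda>x. matrix_inv (m x) $ k $ j) \<in> growth F 0" for k j
  proof -
    let ?N = "\<lambda>x. \<chi> r c. if c = k then axis j 1 $ r else m x $ r $ c"
    define C :: "'n \<Rightarrow> 'n \<Rightarrow> real" where "C i l = (if l = k then axis j 1 $ i else mat 1 $ i $ l)" for i l
    have C: "(\<lambda>x. ?N x $ i $ l - C i l) \<in> growth F s" for i l
      unfolding C_def using e[of i l] by (auto simp: growth_def)
    have "(\<lambda>x. (\<Prod>i\<in>UNIV. ?N x $ i $ p i)) \<in> growth F 0" for p
      by (rule growth_approx_bounded[OF F growth_prod_approx[OF F s _ C]]) (use s in auto)
    then have N: "(\<lambda>x. det (?N x)) \<in> growth F 0"
      unfolding det_def by (intro growth_sum growth_cmult)
    have "(\<lambda>x. inverse (det (m x))) \<in> growth F 0"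
      by (rule growth_approx_bounded[OF F growth_inverse_approx[OF F s d]]) (use s in auto)
    from growth_mult[OF F N this, of 0] have "(\<lambda>x. det (?N x) * inverse (det (m x))) \<in> growth F 0" by simp
    then show ?thesis
      by (rule growth_cong) (use ne in eventually_elim, auto simp: matrix_inv_cramer invertible_det_nz divide_inverse)
  qed
  have "(\<lambda>x. matrix_inv (m x) $ i $ j - mat 1 $ i $ j) \<in> growth F s" for i j
  proof -
    have "(\<lambda>x. \<Sum>l\<in>UNIV. (- (m x $ i $ l - mat 1 $ i $ l)) * matrix_inv (m x) $ l $ j) \<in> growth F s"
      by (intro growth_sum growth_mult[OF F growth_uminus[OF e] b]) auto
    then show ?thesis
    proof (rule growth_cong)
      show "\<forall>\<^sub>F x in F. (\<Sum>l\<in>UNIV. (- (m x $ i $ l - mat 1 $ i $ l)) * matrix_inv (m x) $ l $ j)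
         = matrix_inv (m x) $ i $ j - mat 1 $ i $ j"
        using ne
      proof eventually_elim
        case (elim x)
        have "(\<Sum>l\<in>UNIV. (- (m x $ i $ l - mat 1 $ i $ l)) * matrix_inv (m x) $ l $ j)
          = (mat 1 ** matrix_inv (m x)) $ i $ j - (m x ** matrix_inv (m x)) $ i $ j"
          unfolding matrix_matrix_mult_def by (simp add: sum_subtractf left_diff_distrib)
        then show ?case using elim by (simp add: matrix_inv_invertible invertible_det_nz)
      qed
    qed
  qed
  then show ?thesis using F s by (simp add: near_id_def)
qed

lemma norm_square_cart: "(norm x)\<^sup>2 = (\<Sum>i\<in>UNIV. x $ i * x $ i)" for x :: "real^'n::finite"
  by (simp add: norm_vec_def L2_set_def sum_nonneg power2_eq_square)

text \<open>
  With \<open>\<eta> = x / |x|\<close>, the unit normal is \<open>m\<^sup>-\<^sup>1 \<eta> / \<surd>q\<close> and the density \<open>\<surd>(det m q)\<close> for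
  \<open>q = \<eta> \<bullet> m\<^sup>-\<^sup>1 \<eta>\<close>, and all of these are close to their Euclidean values.
\<close>

lemma near_id_unit_normal_density:
  fixes m :: "real^'n \<Rightarrow> real^'n^'n::finite"
  assumes m: "near_id F s m" and spd: "\<forall>\<^sub>F x in F. spd (m x)"
  shows "(\<lambda>x. unit_normal (m x) x $ i * induced_density (m x) x - x $ i / norm x) \<in> growth F s"
proof -
  have F: "F \<le> at_infinity" and s: "s < 0" using m by (auto simp: near_id_def)
  let ?h = "\<lambda>x. matrix_inv (m x)"
  let ?n = "\<lambda>x i. x $ i / norm x"
  have h: "\<And>i j. (\<lambda>x. ?h x $ i $ j - mat 1 $ i $ j) \<in> growth F s"
    using near_id_inverse[OF m] by (auto simp: near_id_def)
  have nb: "(\<lambda>x. ?n x i) \<in> growth F 0" for i by (rule growth_unit_coord[OF F])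
  define hn where "hn i x = (\<Sum>j\<in>UNIV. ?h x $ i $ j * ?n x j)" for i x
  define q where "q x = (\<Sum>i\<in>UNIV. ?n x i * hn i x)" for x
  have x0: "\<forall>\<^sub>F x in F. x \<noteq> 0" using growth_norm_ge[OF F, of 1] by eventually_elim auto
  have hn: "(\<lambda>x. hn i x - ?n x i) \<in> growth F s" for i
  proof -
    have "(\<lambda>x. \<Sum>j\<in>UNIV. (?h x $ i $ j - mat 1 $ i $ j) * ?n x j) \<in> growth F s"
      by (intro growth_sum growth_mult[OF F h nb]) auto
    moreover have "(\<Sum>j\<in>UNIV. (?h x $ i $ j - mat 1 $ i $ j) * ?n x j) = hn i x - ?n x i" for x
    proof -
      have "(\<Sum>j\<in>UNIV. mat 1 $ i $ j * ?n x j) = ?n x i"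
        unfolding mat_def by (simp only: vec_lambda_beta sum_delta_mult)
      then show ?thesis unfolding hn_def by (simp only: left_diff_distrib sum_subtractf)
    qed
    ultimately show ?thesis by simp
  qed
  have q: "(\<lambda>x. q x - 1) \<in> growth F s"
  proof -
    have "(\<lambda>x. \<Sum>i\<in>UNIV. ?n x i * (hn i x - ?n x i)) \<in> growth F s"
      by (intro growth_sum growth_mult[OF F nb hn]) auto
    then show ?thesis
    proof (rule growth_cong)
      show "\<forall>\<^sub>F x in F. (\<Sum>i\<in>UNIV. ?n x i * (hn i x - ?n x i)) = q x - 1"
        using x0
      proof eventually_elim
        case (elim x)
        have "(\<Sum>i\<in>UNIV. ?n x i * ?n x i) = (\<Sum>i\<in>UNIV. x $ i * x $ i) / (norm x)\<^sup>2"
          by (simp add: sum_divide_distrib power2_eq_square)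
        also have "\<dots> = 1" using elim by (simp add: norm_square_cart[symmetric])
        finally show ?case unfolding q_def by (simp add: right_diff_distrib sum_subtractf)
      qed
    qed
  qed
  have iq: "(\<lambda>x. inverse (sqrt (q x)) - 1) \<in> growth F s" by (rule growth_inverse_approx[OF F s growth_sqrt_approx[OF F s q]])
  have dens: "(\<lambda>x. sqrt (det (m x) * q x) - 1) \<in> growth F s"
    by (rule growth_sqrt_approx[OF F s growth_mult_approx[OF F s near_id_det[OF m] q]])
  let ?c = "\<lambda>x. inverse (sqrt (q x)) * sqrt (det (m x) * q x)"
  have c: "(\<lambda>x. ?c x - 1) \<in> growth F s" by (rule growth_mult_approx[OF F s iq dens])
  have "(\<lambda>x. (hn i x - ?n x i) * ?c x + ?n x i * (?c x - 1)) \<in> growth F s"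
    by (intro growth_add growth_mult[OF F hn growth_approx_bounded[OF F c]] growth_mult[OF F nb c]) (use s in auto)
  then show ?thesis
  proof (rule growth_cong)
    show "\<forall>\<^sub>F x in F. (hn i x - ?n x i) * ?c x + ?n x i * (?c x - 1)
       = unit_normal (m x) x $ i * induced_density (m x) x - x $ i / norm x"
      using x0 spd
    proof eventually_elim
      case (elim x)
      have hx: "(?h x *v x) $ i = norm x * hn i x" for i
        using elim(1) by (simp add: hn_def matrix_vector_mult_def sum_distrib_left)
      have qx: "x \<bullet> (?h x *v x) = (norm x)\<^sup>2 * q x"
        using elim(1) by (simp add: inner_vec_def hx q_def sum_distrib_left power2_eq_square mult_ac)
      have "unit_normal (m x) x $ i = hn i x * inverse (sqrt (q x))"
        unfolding unit_normal_eq[OF elim(2,1)] qx using elim(1)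
        by (simp add: hx real_sqrt_mult divide_inverse)
      moreover have "induced_density (m x) x = sqrt (det (m x) * q x)"
        unfolding induced_density_eq[OF elim(2,1)] qx using elim(1)
        by (simp add: dot_square_norm)
      ultimately show ?case by (simp add: algebra_simps)
    qed
  qed
qed

text \<open>
  Both flux integrands have this shape.  Replacing the metric by the Euclidean one and \<open>T\<close> by its linear
  part \<open>L\<close> changes them by products of two small quantities; the additional power of \<open>|x|\<close> is the
  position vector.
\<close>

lemma flux_integrand_asymp:
  fixes m T :: "real^'n \<Rightarrow> real^'n^'n::finite" and L :: "'n \<Rightarrow> 'n \<Rightarrow> real^'n \<Rightarrow> real"
  assumes m: "near_id F s m" and spd: "\<forall>\<^sub>F x in F. spd (m x)"
    and T: "\<And>i j. (\<lambda>x. T x $ i $ j - L i j x) \<in> growth F (a + s)" and L: "\<And>i j. L i j \<in> growth F a"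
  shows "(\<lambda>x. form (T x) x (unit_normal (m x) x) * induced_density (m x) x
     - (\<Sum>i\<in>UNIV. \<Sum>j\<in>UNIV. L i j x * (x $ i * x $ j)) / norm x) \<in> growth F (a + s + 1)"
proof -
  have F: "F \<le> at_infinity" and s: "s < 0" using m by (auto simp: near_id_def)
  define \<nu> where "\<nu> i x = unit_normal (m x) x $ i * induced_density (m x) x" for i x
  have \<nu>: "(\<lambda>x. \<nu> i x - x $ i / norm x) \<in> growth F s" for i
    unfolding \<nu>_def by (rule near_id_unit_normal_density[OF m spd])
  have \<nu>b: "\<nu> i \<in> growth F 0" for i
    by (rule growth_approx_close[OF F \<nu> growth_unit_coord[OF F]]) (use s in simp)
  have "(\<lambda>x. \<Sum>i\<in>UNIV. \<Sum>j\<in>UNIV. x $ i * ((T x $ i $ j - L i j x) * \<nu> j x + L i j x * (\<nu> j x - x $ j / norm x))) \<in> growth F (a + s + 1)"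
    by (intro growth_sum growth_mult[OF F growth_coord[OF F] growth_add[OF growth_mult[OF F T \<nu>b] growth_mult[OF F L \<nu>]]]) auto
  moreover have "(\<Sum>i\<in>UNIV. \<Sum>j\<in>UNIV. x $ i * ((T x $ i $ j - L i j x) * \<nu> j x + L i j x * (\<nu> j x - x $ j / norm x)))
    = form (T x) x (unit_normal (m x) x) * induced_density (m x) x
     - (\<Sum>i\<in>UNIV. \<Sum>j\<in>UNIV. L i j x * (x $ i * x $ j)) / norm x" for x
  proof -
    have "(\<Sum>i\<in>UNIV. \<Sum>j\<in>UNIV. x $ i * ((T x $ i $ j - L i j x) * \<nu> j x + L i j x * (\<nu> j x - x $ j / norm x)))
      = (\<Sum>i\<in>UNIV. \<Sum>j\<in>UNIV. x $ i * (T x $ i $ j * unit_normal (m x) x $ j) * induced_density (m x) x 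
            - L i j x * (x $ i * x $ j) / norm x)"
      by (intro sum.cong refl) (simp add: \<nu>_def algebra_simps)
    also have "\<dots> = (\<Sum>i\<in>UNIV. \<Sum>j\<in>UNIV. x $ i * (T x $ i $ j * unit_normal (m x) x $ j)) * induced_density (m x) x
       - (\<Sum>i\<in>UNIV. \<Sum>j\<in>UNIV. L i j x * (x $ i * x $ j)) / norm x"
      by (simp only: sum_subtractf sum_distrib_right sum_divide_distrib)
    also have "(\<Sum>i\<in>UNIV. \<Sum>j\<in>UNIV. x $ i * (T x $ i $ j * unit_normal (m x) x $ j)) = form (T x) x (unit_normal (m x) x)"
      by (simp add: form_def inner_vec_def matrix_vector_mult_def sum_distrib_left)
    finally show ?thesis .
  qed
  ultimately show ?thesis by simp
qed

section \<open>Curvature of an asymptotically flat end\<close>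

lemma continuous_on_det:
  fixes m :: "'a::topological_space \<Rightarrow> real^'n^'n::finite"
  assumes "\<And>i j. continuous_on S (\<lambda>x. m x $ i $ j)"
  shows "continuous_on S (\<lambda>x. det (m x))"
  unfolding det_def by (intro continuous_on_sum continuous_on_mult continuous_on_const continuous_on_prod assms)

lemma continuous_on_matrix_inv:
  fixes m :: "'a::topological_space \<Rightarrow> real^'n^'n::finite"
  assumes m: "\<And>i j. continuous_on S (\<lambda>x. m x $ i $ j)" and inv: "\<And>x. x \<in> S \<Longrightarrow> invertible (m x)"
  shows "continuous_on S (\<lambda>x. matrix_inv (m x) $ k $ j)"
proof -
  let ?N = "\<lambda>x. \<chi> r c. if c = k then axis j 1 $ r else m x $ r $ c"
  have "continuous_on S (\<lambda>x. ?N x $ i $ l)" for i l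
    using m[of i l] by (cases "l = k") auto
  then have "continuous_on S (\<lambda>x. det (?N x) / det (m x))"
    using inv by (intro continuous_on_divide continuous_on_det m) (auto simp: invertible_det_nz)
  then show ?thesis by (rule continuous_on_eq) (simp add: matrix_inv_cramer inv)
qed

lemma continuous_on_unit_normal_density:
  fixes m :: "real^'n \<Rightarrow> real^'n^'n::finite"
  assumes m: "\<And>i j. continuous_on S (\<lambda>x. m x $ i $ j)" and spd: "\<And>x. x \<in> S \<Longrightarrow> spd (m x)" and 0: "0 \<notin> S"
  shows "continuous_on S (\<lambda>x. unit_normal (m x) x $ i)" "continuous_on S (\<lambda>x. induced_density (m x) x)"
proof -
  have x0: "x \<noteq> 0" if "x \<in> S" for x using that 0 by auto
  note h = continuous_on_matrix_inv[OF m spd_invertible[OF spd]]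
  have hx: "continuous_on S (\<lambda>x. (matrix_inv (m x) *v x) $ k)" for k
    unfolding matrix_vector_mult_def vec_lambda_beta
    by (intro continuous_on_sum continuous_on_mult h) (auto intro!: continuous_intros)
  have q: "continuous_on S (\<lambda>x. x \<bullet> (matrix_inv (m x) *v x))"
  proof (intro continuous_on_inner continuous_on_id)
    have "continuous_on S (\<lambda>x. \<chi> i. (matrix_inv (m x) *v x) $ i)"
      by (rule continuous_on_vec_lambda) (rule hx)
    then show "continuous_on S (\<lambda>x. matrix_inv (m x) *v x)" by simp
  qed
  have "continuous_on S (\<lambda>x. (1 / sqrt (x \<bullet> (matrix_inv (m x) *v x))) * (matrix_inv (m x) *v x) $ i)"
    using matrix_inv_pos[OF spd x0]
    by (intro continuous_on_mult continuous_on_divide continuous_on_const continuous_on_real_sqrt q hx) force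
  then show "continuous_on S (\<lambda>x. unit_normal (m x) x $ i)"
    by (rule continuous_on_eq) (simp add: unit_normal_eq spd x0)
  have "continuous_on S (\<lambda>x. sqrt (det (m x) * (x \<bullet> (matrix_inv (m x) *v x)) / (x \<bullet> x)))"
    using x0 by (intro continuous_on_mult continuous_on_divide continuous_on_real_sqrt q continuous_on_det m continuous_on_inner continuous_on_id) auto
  then show "continuous_on S (\<lambda>x. induced_density (m x) x)"
    by (rule continuous_on_eq) (simp add: induced_density_eq spd x0)
qed

lemma has_pd_prod_ex:
  assumes "\<And>k. k \<in> A \<Longrightarrow> \<exists>d. has_pd S i (f k) d x"
  shows "\<exists>d. has_pd S i (\<lambda>y. \<Prod>k\<in>A. f k y) d x"
  using assms
proof (induction A rule: infinite_finite_induct)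
  case (insert k A)
  then obtain d e where "has_pd S i (f k) d x" "has_pd S i (\<lambda>y. \<Prod>k\<in>A. f k y) e x" by blast
  from has_pd_mult[OF this] show ?case using insert by auto
qed (auto intro: has_pd_const)

text \<open>
  Only the existence of the derivative is of interest here: its value for the inverse matrix follows from
  \<open>g h = 1\<close>.
\<close>

lemma has_pd_det_ex:
  fixes m :: "real^'k \<Rightarrow> real^'n^'n::finite"
  assumes "\<And>r c. \<exists>d. has_pd S i (\<lambda>y. m y $ r $ c) d (x :: real^'k::finite)"
  shows "\<exists>d. has_pd S i (\<lambda>y. det (m y)) d x"
proof -
  have "\<forall>p. \<exists>d. has_pd S i (\<lambda>y. \<Prod>r\<in>UNIV. m y $ r $ p r) d x"
    by (intro allI has_pd_prod_ex assms)
  from choice[OF this] obtain D where "\<And>p. has_pd S i (\<lambda>y. \<Prod>r\<in>UNIV. m y $ r $ p r) (D p) x" by auto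
  then have "has_pd S i (\<lambda>y. det (m y)) (\<Sum>p | p permutes UNIV. 0 * (\<Prod>r\<in>UNIV. m x $ r $ p r) + of_int (sign p) * D p) x"
    unfolding det_def by (intro has_pd_sum has_pd_mult has_pd_const)
  then show ?thesis by blast
qed

text \<open>
  Convergence to infinity within the half-space, uniformly in the direction.
\<close>

definition endF :: "(real^('m::finite option)) filter" where
  "endF = inf at_infinity (principal half_space)"

lemma endF_le: "endF \<le> at_infinity" by (simp add: endF_def)

lemma eventually_end_region: "\<forall>\<^sub>F x in endF. x \<in> end_region"
proof -
  have "\<forall>\<^sub>F x in at_infinity. norm (x :: real^('m::finite option)) \<ge> 2" by (auto simp: eventually_at_infinity)
  then show ?thesis unfolding endF_def eventually_inf_principal
    by eventually_elim (auto simp: end_region_def)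
qed

lemma filterlim_bdry_pt: "filterlim bdry_pt endF at_infinity"
proof -
  have "filterlim (\<lambda>y::real^'m::finite. norm (bdry_pt y)) at_top at_infinity"
    by (simp add: filterlim_norm_at_top)
  then have "filterlim (bdry_pt :: real^'m \<Rightarrow> _) at_infinity at_infinity"
    by (rule filterlim_norm_at_top_imp_at_infinity)
  moreover have "\<forall>\<^sub>F y::real^'m in at_infinity. bdry_pt y \<in> half_space" by (simp add: half_space_def)
  ultimately show ?thesis unfolding endF_def by (simp add: filterlim_inf filterlim_principal)
qed

lemma growth_bdry:
  assumes "f \<in> growth endF s" shows "(\<lambda>y. f (bdry_pt y)) \<in> growth at_infinity s"
proof -
  have "(\<lambda>y. f (bdry_pt y)) \<in> O[at_infinity](\<lambda>y. norm (bdry_pt y) powr s)"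
    by (rule landau_o.big.compose[OF assms[unfolded growth_def] filterlim_bdry_pt])
  then show ?thesis by (simp add: growth_def)
qed

lemma mat_delta: "mat 1 $ i $ j = (if i = j then 1 else 0)" by (simp add: mat_def)

lemma sum_mat_delta:
  fixes f :: "'n::finite \<Rightarrow> real"
  shows "(\<Sum>i\<in>UNIV. f i * mat 1 $ k $ i) = f k" "(\<Sum>i\<in>UNIV. mat 1 $ k $ i * f i) = f k"
    "(\<Sum>i\<in>UNIV. f i * mat 1 $ i $ k) = f k" "(\<Sum>i\<in>UNIV. mat 1 $ i $ k * f i) = f k"
proof -
  show "(\<Sum>i\<in>UNIV. f i * mat 1 $ k $ i) = f k" "(\<Sum>i\<in>UNIV. mat 1 $ k $ i * f i) = f k"
    unfolding mat_delta by (rule sum_delta_mult)+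
  have "mat 1 $ i $ k = (mat 1 $ k $ i :: real)" for i by (simp add: mat_delta)
  then show "(\<Sum>i\<in>UNIV. f i * mat 1 $ i $ k) = f k" "(\<Sum>i\<in>UNIV. mat 1 $ i $ k * f i) = f k"
    unfolding mat_delta by (simp_all only: mat_delta[symmetric], simp_all only: mat_delta sum_delta_mult)
qed

lemma sum_minus_delta:
  fixes f H :: "'n::finite \<Rightarrow> real"
  shows "(\<Sum>l\<in>UNIV. (H l - mat 1 $ k $ l) * f l) = (\<Sum>l\<in>UNIV. H l * f l) - f k"
  by (simp only: left_diff_distrib sum_subtractf sum_mat_delta)

text \<open>
  Subtracting a multiple of the identity, as in \<open>Ric - R/2 \<delta>\<close> and \<open>A - H \<delta>\<close>.
\<close>

lemma sum_minus_trace: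
  fixes A :: "'n::finite \<Rightarrow> 'n \<Rightarrow> real"
  shows "(\<Sum>i\<in>UNIV. \<Sum>j\<in>UNIV. (A i j - c * mat 1 $ i $ j) * (x i * x j))
     = (\<Sum>i\<in>UNIV. \<Sum>j\<in>UNIV. A i j * (x i * x j)) - c * (\<Sum>i\<in>UNIV. x i * x i)"
proof -
  have "(A i j - c * mat 1 $ i $ j) * (x i * x j) = A i j * (x i * x j) - c * (x i * (mat 1 $ i $ j * x j))" for i j
    by (simp add: algebra_simps)
  then show ?thesis by (simp only: sum_subtractf sum_distrib_left[symmetric] sum_mat_delta)
qed

text \<open>
  With decay in the form \<open>O\<close>, it is the strict inequality \<open>2\<tau> > n - 2\<close> that makes the quadratic terms
  negligible.
\<close>

locale AF_end = C2_end_metric +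
  fixes \<tau> :: real
  assumes tau: "\<tau> > 0"
    and posdef: "\<And>x v. x \<in> end_region \<Longrightarrow> v \<noteq> 0 \<Longrightarrow> form (g x) v v > 0"
    and decay0: "\<And>i j. (\<lambda>x. g x $ i $ j - mat 1 $ i $ j) \<in> growth endF (- \<tau>)"
    and decay1: "\<And>k i j. dg k i j \<in> growth endF (- \<tau> - 1)"
    and decay2: "\<And>l k i j. ddg l k i j \<in> growth endF (- \<tau> - 2)"
begin

lemma spd_g: "x \<in> end_region \<Longrightarrow> spd (g x)"
  unfolding spd_def using posdef sym by (auto simp: vec_eq_iff transpose_def)

text \<open>
  The inverse metric.  The following definitions give the inverse metric, the Christoffel symbols \<open>gam\<close>,
  the Ricci tensor and the scalar curvature by explicit formulas in \<open>g\<close>, \<open>dg\<close> and \<open>ddg\<close>; the prefix \<open>d\<close> marks a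
  partial derivative, with its direction as first argument.  Continuity and decay are then read off
  term by term.
\<close>

definition h where "h i j x = matrix_inv (g x) $ i $ j"

lemma h_cont: "continuous_on end_region (h i j)"
  unfolding h_def[abs_def] by (rule continuous_on_matrix_inv[OF g_cont spd_invertible[OF spd_g]])

lemma gh: "x \<in> end_region \<Longrightarrow> (\<Sum>l\<in>UNIV. g x $ i $ l * h l j x) = mat 1 $ i $ j"
  using matrix_inv_invertible(1)[OF spd_invertible[OF spd_g]]
  unfolding h_def by (simp add: matrix_matrix_mult_def vec_eq_iff)

lemma hg: "x \<in> end_region \<Longrightarrow> (\<Sum>l\<in>UNIV. h i l x * g x $ l $ j) = mat 1 $ i $ j"
  using matrix_inv_invertible(2)[OF spd_invertible[OF spd_g]]
  unfolding h_def by (simp add: matrix_matrix_mult_def vec_eq_iff)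

definition dh where "dh k a j x = - (\<Sum>i\<in>UNIV. \<Sum>l\<in>UNIV. h a i x * (dg k i l x * h l j x))"

text \<open>
  Differentiate \<open>g h = 1\<close> and multiply by \<open>h\<close>.
\<close>

lemma h_pd:
  assumes x: "x \<in> end_region"
  shows "has_pd end_region k (h a j) (dh k a j x) x"
proof -
  have "\<exists>d. has_pd end_region k (h a j) d x" for a j
  proof -
    let ?N = "\<lambda>x. \<chi> r c. if c = a then axis j 1 $ r else g x $ r $ c"
    have "\<exists>d. has_pd end_region k (\<lambda>y. ?N y $ r $ c) d x" for r c
      using g_pd[OF x, of k r c] by (cases "c = a") (auto intro: has_pd_const)
    from has_pd_det_ex[of end_region k ?N x, OF this]
    obtain d where d: "has_pd end_region k (\<lambda>y. det (?N y)) d x" by blast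
    obtain e where e: "has_pd end_region k (\<lambda>y. det (g y)) e x"
      using has_pd_det_ex[of end_region k g x] g_pd[OF x] by blast
    have "det (g x) \<noteq> 0" using spd_invertible[OF spd_g[OF x]] by (simp add: invertible_det_nz)
    from has_pd_chain[OF DERIV_inverse[OF this] e] d
    have "\<exists>c. has_pd end_region k (\<lambda>y. det (?N y) * inverse (det (g y))) c x" using has_pd_mult by blast
    then obtain c where "has_pd end_region k (\<lambda>y. det (?N y) * inverse (det (g y))) c x" by blast
    then have "has_pd end_region k (h a j) c x"
      by (rule has_pd_cong[OF _ x]) (simp add: h_def matrix_inv_cramer[OF spd_invertible[OF spd_g]] divide_inverse)
    then show ?thesis by blast
  qed
  then obtain D where D: "\<And>a j. has_pd end_region k (h a j) (D a j) x" by metis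
  have z: "(\<Sum>l\<in>UNIV. dg k i l x * h l j x + g x $ i $ l * D l j) = 0" for i
  proof -
    have 1: "has_pd end_region k (\<lambda>y. \<Sum>l\<in>UNIV. g y $ i $ l * h l j y) (\<Sum>l\<in>UNIV. dg k i l x * h l j x + g x $ i $ l * D l j) x"
      by (intro has_pd_sum has_pd_mult g_pd[OF x] D)
    have "has_pd end_region k (\<lambda>y. mat 1 $ i $ j) 0 x" by (rule has_pd_const)
    then have "has_pd end_region k (\<lambda>y. \<Sum>l\<in>UNIV. g y $ i $ l * h l j y) 0 x"
      by (rule has_pd_cong[OF _ x]) (simp add: gh)
    from partial_deriv_end_eq[OF this x] partial_deriv_end_eq[OF 1 x] show ?thesis by simp
  qed
  have "D a j = (\<Sum>l\<in>UNIV. mat 1 $ a $ l * D l j)" by (simp only: sum_mat_delta)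
  also have "\<dots> = (\<Sum>l\<in>UNIV. (\<Sum>i\<in>UNIV. h a i x * g x $ i $ l) * D l j)" by (simp add: hg[OF x])
  also have "\<dots> = (\<Sum>i\<in>UNIV. \<Sum>l\<in>UNIV. h a i x * (g x $ i $ l * D l j))"
    unfolding sum_distrib_right by (subst sum.swap) (simp only: mult.assoc)
  also have "\<dots> = (\<Sum>i\<in>UNIV. h a i x * (\<Sum>l\<in>UNIV. g x $ i $ l * D l j))" by (simp only: sum_distrib_left)
  also have "\<dots> = (\<Sum>i\<in>UNIV. h a i x * - (\<Sum>l\<in>UNIV. dg k i l x * h l j x))"
  proof (intro sum.cong refl)
    fix i show "h a i x * (\<Sum>l\<in>UNIV. g x $ i $ l * D l j) = h a i x * - (\<Sum>l\<in>UNIV. dg k i l x * h l j x)"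
      using z[of i] by (simp add: sum.distrib add_eq_0_iff)
  qed
  also have "\<dots> = dh k a j x" unfolding dh_def by (simp add: sum_distrib_left sum_negf)
  finally show ?thesis using D[of a j] by simp
qed

lemma dh_cont: "continuous_on end_region (dh k a j)"
  unfolding dh_def[abs_def] by (intro continuous_intros h_cont dg_cont)

definition gam where
  "gam k i j x = (1/2) * (\<Sum>l\<in>UNIV. h k l x * (dg i j l x + dg j i l x - dg l i j x))"

definition dgam where
  "dgam m k i j x = (1/2) * (\<Sum>l\<in>UNIV. dh m k l x * (dg i j l x + dg j i l x - dg l i j x)
      + h k l x * (ddg m i j l x + ddg m j i l x - ddg m l i j x))"

lemma christoffel_eq: "christoffel end_region g k i j = gam k i j"
  unfolding christoffel_def gam_def dg_def h_def by (rule ext) simp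

lemma gam_pd: 
  assumes x: "x \<in> end_region" shows "has_pd end_region m (gam k i j) (dgam m k i j x) x"
proof -
  have "has_pd end_region m (\<lambda>x. (1/2) * (\<Sum>l\<in>UNIV. h k l x * (dg i j l x + dg j i l x - dg l i j x)))
    (0 * (\<Sum>l\<in>UNIV. h k l x * (dg i j l x + dg j i l x - dg l i j x)) + (1/2) * (\<Sum>l\<in>UNIV. dh m k l x * (dg i j l x + dg j i l x - dg l i j x)
      + h k l x * (ddg m i j l x + ddg m j i l x - ddg m l i j x))) x"
    by (rule has_pd_mult has_pd_const has_pd_sum has_pd_add has_pd_diff h_pd[OF x] dg_pd[OF x])+
  then show ?thesis unfolding gam_def[abs_def] dgam_def by simp
qed

lemma gam_cont: "continuous_on end_region (gam k i j)"
  unfolding gam_def[abs_def] by (intro continuous_intros h_cont dg_cont)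

lemma dgam_cont: "continuous_on end_region (dgam m k i j)"
  unfolding dgam_def[abs_def] by (intro continuous_intros h_cont dh_cont dg_cont ddg_cont)

definition ric where
  "ric i j x = (\<Sum>k\<in>UNIV. dgam k k i j x - dgam i k k j x
       + (\<Sum>l\<in>UNIV. gam k k l x * gam l i j x - gam k i l x * gam l k j x))"

definition scal where "scal x = (\<Sum>i\<in>UNIV. \<Sum>j\<in>UNIV. h i j x * ric i j x)"

lemma ricci_eq: "x \<in> end_region \<Longrightarrow> ricci end_region g x $ i $ j = ric i j x"
  unfolding ricci_def ric_def christoffel_eq by (simp add: partial_deriv_end_eq[OF gam_pd])

lemma scalar_curv_eq: "x \<in> end_region \<Longrightarrow> scalar_curv end_region g x = scal x"
  unfolding scalar_curv_def scal_def by (simp add: ricci_eq h_def)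

lemma einstein_eq: "x \<in> end_region \<Longrightarrow> einstein end_region g x $ i $ j = ric i j x - scal x / 2 * g x $ i $ j"
  unfolding einstein_def by (simp add: ricci_eq scalar_curv_eq)

lemma ric_cont: "continuous_on end_region (ric i j)"
  unfolding ric_def[abs_def] by (intro continuous_intros gam_cont dgam_cont)

lemma scal_cont: "continuous_on end_region scal"
  unfolding scal_def[abs_def] by (intro continuous_intros h_cont ric_cont)

lemma einstein_cont: "continuous_on end_region (\<lambda>x. einstein end_region g x $ i $ j)"
proof -
  have "continuous_on end_region (\<lambda>x. ric i j x - scal x / 2 * g x $ i $ j)"
    by (rule continuous_on_diff continuous_on_mult continuous_on_divide continuous_on_const ric_cont scal_cont g_cont | simp)+
  then show ?thesis by (rule continuous_on_eq) (simp add: einstein_eq)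
qed

lemma near_g: "near_id endF (- \<tau>) g"
  using endF_le tau decay0 by (simp add: near_id_def)

lemma h_approx: "(\<lambda>x. h i j x - mat 1 $ i $ j) \<in> growth endF (- \<tau>)"
  using near_id_inverse[OF near_g] by (simp add: near_id_def h_def)

lemma h_bounded: "h i j \<in> growth endF 0"
  by (rule growth_approx_bounded[OF endF_le h_approx]) (use tau in simp)

lemma dh_bounded: "dh k a j \<in> growth endF (- \<tau> - 1)"
  unfolding dh_def[abs_def]
  by (intro growth_uminus growth_sum growth_mult[OF endF_le h_bounded growth_mult[OF endF_le decay1 h_bounded]]) auto

lemma dh_lin: "(\<lambda>x. dh k a j x + dg k a j x) \<in> growth endF (- 2 * \<tau> - 1)"
proof -
  have "(\<lambda>x. - (\<Sum>i\<in>UNIV. \<Sum>l\<in>UNIV. (h a i x - mat 1 $ a $ i) * (dg k i l x * h l j x))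
      - (\<Sum>l\<in>UNIV. dg k a l x * (h l j x - mat 1 $ l $ j))) \<in> growth endF (- 2 * \<tau> - 1)"
    by (intro growth_diff growth_uminus growth_sum growth_mult[OF endF_le h_approx growth_mult[OF endF_le decay1 h_bounded order.refl]] growth_mult[OF endF_le decay1 h_approx]) auto
  moreover have "- (\<Sum>i\<in>UNIV. \<Sum>l\<in>UNIV. (h a i x - mat 1 $ a $ i) * (dg k i l x * h l j x))
      - (\<Sum>l\<in>UNIV. dg k a l x * (h l j x - mat 1 $ l $ j)) = dh k a j x + dg k a j x" for x
  proof -
    have "(\<Sum>i\<in>UNIV. \<Sum>l\<in>UNIV. (h a i x - mat 1 $ a $ i) * (dg k i l x * h l j x)) 
       = - dh k a j x - (\<Sum>i\<in>UNIV. mat 1 $ a $ i * (\<Sum>l\<in>UNIV. dg k i l x * h l j x))"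
      by (simp only: dh_def left_diff_distrib sum_subtractf sum_distrib_left minus_minus)
    also have "\<dots> = - dh k a j x - (\<Sum>l\<in>UNIV. dg k a l x * h l j x)" by (simp only: sum_mat_delta)
    finally have 1: "(\<Sum>i\<in>UNIV. \<Sum>l\<in>UNIV. (h a i x - mat 1 $ a $ i) * (dg k i l x * h l j x)) 
       = - dh k a j x - (\<Sum>l\<in>UNIV. dg k a l x * h l j x)" .
    have 2: "(\<Sum>l\<in>UNIV. dg k a l x * (h l j x - mat 1 $ l $ j)) = (\<Sum>l\<in>UNIV. dg k a l x * h l j x) - dg k a j x"
      by (simp only: right_diff_distrib sum_subtractf sum_mat_delta)
    show ?thesis unfolding 1 2 by simp
  qed
  ultimately show ?thesis by simp
qed

text \<open>
  The linear parts of \<open>gam\<close> and \<open>dgam\<close>.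
\<close>

definition lgam where "lgam k i j x = (1/2) * (dg i j k x + dg j i k x - dg k i j x)"
definition ldgam where "ldgam m k i j x = (1/2) * (ddg m i j k x + ddg m j i k x - ddg m k i j x)"

lemma gam_lin: "(\<lambda>x. gam k i j x - lgam k i j x) \<in> growth endF (- 2 * \<tau> - 1)"
proof -
  have "(\<lambda>x. (1/2) * (\<Sum>l\<in>UNIV. (h k l x - mat 1 $ k $ l) * (dg i j l x + dg j i l x - dg l i j x))) \<in> growth endF (- 2 * \<tau> - 1)"
    by (intro growth_cmult growth_sum growth_mult[OF endF_le h_approx growth_diff[OF growth_add[OF decay1 decay1] decay1]]) auto
  then show ?thesis
    unfolding sum_minus_delta by (simp only: gam_def lgam_def right_diff_distrib[of "1/2"])
qed

lemma gam_bounded: "gam k i j \<in> growth endF (- \<tau> - 1)"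
  unfolding gam_def[abs_def]
  by (intro growth_cmult growth_sum growth_mult[OF endF_le h_bounded growth_diff[OF growth_add[OF decay1 decay1] decay1]]) auto

lemma dgam_lin: "(\<lambda>x. dgam m k i j x - ldgam m k i j x) \<in> growth endF (- 2 * \<tau> - 2)"
proof -
  have "(\<lambda>x. (1/2) * (\<Sum>l\<in>UNIV. dh m k l x * (dg i j l x + dg j i l x - dg l i j x)
      + (h k l x - mat 1 $ k $ l) * (ddg m i j l x + ddg m j i l x - ddg m l i j x))) \<in> growth endF (- 2 * \<tau> - 2)"
    by (intro growth_cmult growth_sum growth_add growth_mult[OF endF_le dh_bounded growth_diff[OF growth_add[OF decay1 decay1] decay1]]
       growth_mult[OF endF_le h_approx growth_diff[OF growth_add[OF decay2 decay2] decay2]]) auto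
  then show ?thesis
    unfolding sum.distrib sum_minus_delta
    by (simp only: dgam_def ldgam_def sum.distrib right_diff_distrib[of "1/2"] add_diff_eq distrib_left[of "1/2"])
qed

lemma linRic_bound: "linRic i j \<in> growth endF (- \<tau> - 2)"
proof -
  have "(\<lambda>x. (1/2) * (\<Sum>k\<in>UNIV. ddg k i j k x + ddg k j i k x - ddg k k i j x - ddg i j k k x)) \<in> growth endF (- \<tau> - 2)"
    by (intro growth_cmult growth_sum growth_diff growth_add decay2)
  then show ?thesis by (simp add: linRic_def[abs_def])
qed

text \<open>
  The products of Christoffel symbols are quadratic, and the contraction \<open>\<Gamma>\<^sup>k\<^sub>k\<^sub>j\<close> is \<open>g\<^sub>k\<^sub>k\<^sub>,\<^sub>j / 2\<close> to first order
  by the symmetry of the metric.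
\<close>

lemma ric_lin: "(\<lambda>x. ric i j x - linRic i j x) \<in> growth endF (- 2 * \<tau> - 2)"
proof -
  have "(\<lambda>x. \<Sum>k\<in>UNIV. (dgam k k i j x - ldgam k k i j x) - (dgam i k k j x - ldgam i k k j x)
       + (\<Sum>l\<in>UNIV. gam k k l x * gam l i j x - gam k i l x * gam l k j x)) \<in> growth endF (- 2 * \<tau> - 2)"
    by (intro growth_sum growth_add growth_diff dgam_lin growth_mult[OF endF_le gam_bounded gam_bounded]) auto
  then show ?thesis
  proof (rule growth_cong)
    show "\<forall>\<^sub>F x in endF. (\<Sum>k\<in>UNIV. (dgam k k i j x - ldgam k k i j x) - (dgam i k k j x - ldgam i k k j x)
       + (\<Sum>l\<in>UNIV. gam k k l x * gam l i j x - gam k i l x * gam l k j x)) = ric i j x - linRic i j x"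
      using eventually_end_region
    proof eventually_elim
      case (elim x)
      have "linRic i j x = (\<Sum>k\<in>UNIV. ldgam k k i j x - ldgam i k k j x)"
        unfolding linRic_def ldgam_def sum_divide_distrib
        by (intro sum.cong refl) (simp add: ddg_sym[OF elim, of i _ _ j])
      then show ?case unfolding ric_def by (simp add: sum_subtractf sum.distrib algebra_simps)
    qed
  qed
qed

lemma ric_bounded: "ric i j \<in> growth endF (- \<tau> - 2)"
  by (rule growth_approx_close[OF endF_le ric_lin linRic_bound]) (use tau in simp)

lemma linR_bound: "linR \<in> growth endF (- \<tau> - 2)"
  unfolding linR_def[abs_def] by (intro growth_sum linRic_bound)

lemma scal_lin: "(\<lambda>x. scal x - linR x) \<in> growth endF (- 2 * \<tau> - 2)"
proof -
  have "(\<lambda>x. (\<Sum>i\<in>UNIV. \<Sum>j\<in>UNIV. (h i j x - mat 1 $ i $ j) * ric i j x) + (\<Sum>i\<in>UNIV. ric i i x - linRic i i x)) \<in> growth endF (- 2 * \<tau> - 2)"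
    by (intro growth_add growth_sum growth_mult[OF endF_le h_approx ric_bounded] ric_lin) auto
  then show ?thesis
    by (simp only: scal_def linR_def left_diff_distrib sum_subtractf sum_mat_delta) simp
qed

lemma scal_bounded: "scal \<in> growth endF (- \<tau> - 2)"
  by (rule growth_approx_close[OF endF_le scal_lin linR_bound]) (use tau in simp)

lemma einstein_lin: "(\<lambda>x. einstein end_region g x $ i $ j - (linRic i j x - linR x / 2 * mat 1 $ i $ j)) \<in> growth endF (- 2 * \<tau> - 2)"
proof -
  have "(\<lambda>x. (ric i j x - linRic i j x) - ((1/2) * (scal x * (g x $ i $ j - mat 1 $ i $ j)) + (1/2 * mat 1 $ i $ j) * (scal x - linR x)))
     \<in> growth endF (- 2 * \<tau> - 2)"
    by (intro growth_diff growth_add growth_cmult ric_lin scal_lin growth_mult[OF endF_le scal_bounded decay0]) auto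
  then show ?thesis
    by (rule growth_cong) (use eventually_end_region in eventually_elim, simp add: einstein_eq field_simps)
qed

lemma eventually_spd: "\<forall>\<^sub>F x in endF. spd (g x)"
  using eventually_end_region by eventually_elim (rule spd_g)

text \<open>
  The integrand on the hemisphere with respect to the Euclidean surface measure.
\<close>

definition einstein_density where
  "einstein_density x = form (einstein end_region g x) x (unit_normal (g x) x) * induced_density (g x) x"

lemma einstein_density_lin: "(\<lambda>x. einstein_density x - linEin x / norm x) \<in> growth endF (- 2 * \<tau> - 1)"
proof -
  let ?L = "\<lambda>i j x. linRic i j x - linR x / 2 * mat 1 $ i $ j"
  have L: "?L i j \<in> growth endF (- \<tau> - 2)" for i j
  proof -
    have "(\<lambda>x. linRic i j x - (1/2 * mat 1 $ i $ j) * linR x) \<in> growth endF (- \<tau> - 2)"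
      by (intro growth_diff growth_cmult linRic_bound linR_bound)
    then show ?thesis by (simp add: mult_ac)
  qed
  have "(\<lambda>x. einstein_density x - (\<Sum>i\<in>UNIV. \<Sum>j\<in>UNIV. ?L i j x * (x $ i * x $ j)) / norm x) \<in> growth endF ((- \<tau> - 2) + (- \<tau>) + 1)"
    unfolding einstein_density_def
    by (rule flux_integrand_asymp[OF near_g eventually_spd _ L]) (use einstein_lin in \<open>simp add: algebra_simps\<close>)
  moreover have "(\<Sum>i\<in>UNIV. \<Sum>j\<in>UNIV. ?L i j x * (x $ i * x $ j)) = linEin x" for x
    unfolding linEin_def by (rule sum_minus_trace)
  moreover have "(- \<tau> - 2) + (- \<tau>) + 1 = - 2 * \<tau> - 1" by simp
  ultimately show ?thesis by (simp only:)
qed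

lemma einstein_density_cont: "continuous_on end_region einstein_density"
proof -
  have "0 \<notin> end_region" by (simp add: end_region_def)
  note c = continuous_on_unit_normal_density[OF g_cont spd_g this]
  have x: "continuous_on end_region (\<lambda>x. x $ k)" for k by (intro continuous_intros)
  show ?thesis
    unfolding einstein_density_def[abs_def] form_def inner_vec_def matrix_vector_mult_def vec_lambda_beta inner_real_def
    by (intro continuous_on_mult continuous_on_sum einstein_cont c x)
qed

text \<open>
  The outward unit normal along hyperplanes \<open>x\<^sub>1 = const\<close> is \<open>mu = - sq h\<^sub>k\<^sub>1\<close> with \<open>sq = 1 / \<surd>h\<^sub>1\<^sub>1\<close>.  It and
  the second fundamental form \<open>sff\<close> are given by these formulas on the whole end, so that the decay
  estimates can be made there and restricted to the boundary afterwards.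
\<close>

definition sq where "sq x = inverse (sqrt (h None None x))"
definition mu where "mu k x = - (h k None x * sq x)"
definition dmu where
  "dmu a k x = - (dh a k None x * sq x + h k None x * (- (sq x ^ 3 / 2) * dh a None None x))"

lemma hNN: "x \<in> end_region \<Longrightarrow> h None None x > 0"
proof -
  assume x: "x \<in> end_region"
  have "axis None 1 \<noteq> (0 :: real^('a option))" by simp
  from matrix_inv_pos[OF spd_g[OF x] this] show ?thesis
    by (simp add: h_def matrix_vector_mult_basis column_def inner_axis inner_axis')
qed

lemma outward_normal_eq: "x \<in> end_region \<Longrightarrow> outward_normal (g x) $ k = mu k x"
proof -
  assume x: "x \<in> end_region"
  let ?e = "axis None 1 :: real^('a option)"
  have hv: "matrix_inv (g x) *v (- ?e) = - (\<chi> i. h i None x)"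
    by (simp add: vec_eq_iff h_def matrix_vector_mult_def axis_def if_distrib[of "\<lambda>c. _ * c"] sum_negf cong: if_cong)
  have q: "(- ?e) \<bullet> (matrix_inv (g x) *v (- ?e)) = h None None x"
    unfolding hv by (simp add: inner_axis inner_axis')
  have "- ?e \<noteq> 0" by simp
  note u = unit_normal_eq[OF spd_g[OF x] this, unfolded q, unfolded hv]
  show ?thesis unfolding outward_normal_def u by (simp add: mu_def sq_def divide_inverse mult.commute)
qed

lemma sq_pd:
  assumes x: "x \<in> end_region"
  shows "has_pd end_region a sq (- (sq x ^ 3 / 2) * dh a None None x) x"
proof -
  let ?z = "h None None x"
  have z: "?z > 0" by (rule hNN[OF x])
  have "((\<lambda>y. inverse (sqrt y)) has_real_derivative - (inverse (sqrt ?z) ^ 3 / 2)) (at ?z)"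
  proof -
    have "sqrt ?z \<noteq> 0" using z by simp
    from DERIV_chain2[OF DERIV_inverse[OF this] DERIV_real_sqrt[OF z]]
    have "((\<lambda>y. inverse (sqrt y)) has_real_derivative - (inverse (sqrt ?z) ^ Suc (Suc 0)) * (inverse (sqrt ?z) / 2)) (at ?z)" .
    moreover have "- (i ^ Suc (Suc 0)) * (i / 2) = - (i ^ 3 / 2)" for i :: real
      by (simp add: power3_eq_cube)
    ultimately show ?thesis by (simp only:)
  qed
  from has_pd_chain[OF this h_pd[OF x]] show ?thesis unfolding sq_def[abs_def] .
qed

lemma mu_pd: "x \<in> end_region \<Longrightarrow> has_pd end_region a (mu k) (dmu a k x) x"
  unfolding mu_def[abs_def] dmu_def by (intro has_pd_minus has_pd_mult h_pd sq_pd)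

definition sff where
  "sff a b x = (\<Sum>k\<in>UNIV. (dmu (Some a) k x + (\<Sum>l\<in>UNIV. gam k (Some a) l x * mu l x)) * g x $ k $ Some b)"

lemma second_ff_eq:
  assumes x: "x \<in> end_region" shows "second_ff end_region g x $ a $ b = sff a b x"
proof -
  have "partial_deriv end_region (Some a) (\<lambda>y. outward_normal (g y) $ k) x = dmu (Some a) k x" for k
    by (rule partial_deriv_end_eq[OF has_pd_cong[OF mu_pd[OF x] x] x]) (simp add: outward_normal_eq)
  then show ?thesis unfolding second_ff_def sff_def christoffel_eq by (simp add: outward_normal_eq[OF x])
qed

lemma spd_tang: "x \<in> end_region \<Longrightarrow> spd (tang (g x))"
proof -
  assume x: "x \<in> end_region"
  have "form (tang (g x)) v v = form (g x) (bdry_pt v) (bdry_pt v)" for v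
    by (simp add: form_def inner_vec_def matrix_vector_mult_def tang_def UNIV_option_sum)
  moreover have "bdry_pt v \<noteq> 0" if "v \<noteq> 0" for v :: "real^'a" using that norm_bdry_pt[of v] by (metis norm_eq_zero)
  ultimately have "form (tang (g x)) v v > 0" if "v \<noteq> 0" for v using posdef[OF x] that by simp
  then show ?thesis unfolding spd_def using sym[OF x] by (auto simp: vec_eq_iff transpose_def tang_def)
qed

definition th where "th a b x = matrix_inv (tang (g x)) $ a $ b"
definition mc where "mc x = (\<Sum>a\<in>UNIV. \<Sum>b\<in>UNIV. th a b x * sff a b x)"

lemma mean_curv_eq: "x \<in> end_region \<Longrightarrow> mean_curv end_region g x = mc x"
  unfolding mean_curv_def mc_def by (simp add: second_ff_eq th_def)

lemma sq_cont: "continuous_on end_region sq"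
  unfolding sq_def[abs_def]
  by (intro continuous_on_inverse continuous_on_real_sqrt h_cont) (use hNN in force)

lemma mu_cont: "continuous_on end_region (mu k)"
  unfolding mu_def[abs_def] by (intro continuous_intros h_cont sq_cont)

lemma dmu_cont: "continuous_on end_region (dmu a k)"
  unfolding dmu_def[abs_def] by (intro continuous_intros h_cont sq_cont dh_cont) auto

lemma sff_cont: "continuous_on end_region (sff a b)"
  unfolding sff_def[abs_def] by (intro continuous_on_sum continuous_on_mult continuous_on_add dmu_cont gam_cont mu_cont g_cont)

lemma tang_cont: "continuous_on end_region (\<lambda>x. tang (g x) $ a $ b)"
  using g_cont by (simp add: tang_def)

lemma th_cont: "continuous_on end_region (th a b)"
  unfolding th_def[abs_def] by (rule continuous_on_matrix_inv[OF tang_cont spd_invertible[OF spd_tang]])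

lemma mc_cont: "continuous_on end_region mc"
  unfolding mc_def[abs_def] by (intro continuous_on_sum continuous_on_mult th_cont sff_cont)

lemma near_tang: "near_id endF (- \<tau>) (\<lambda>x. tang (g x))"
  unfolding near_id_def
proof (intro conjI allI)
  fix a b show "(\<lambda>x. tang (g x) $ a $ b - mat 1 $ a $ b) \<in> growth endF (- \<tau>)"
    using decay0[of "Some a" "Some b"] by (simp add: tang_def mat_delta)
qed (use endF_le tau in auto)

lemma th_approx: "(\<lambda>x. th a b x - mat 1 $ a $ b) \<in> growth endF (- \<tau>)"
  using near_id_inverse[OF near_tang] by (simp add: near_id_def th_def)

lemma sq_approx: "(\<lambda>x. sq x - 1) \<in> growth endF (- \<tau>)"
  unfolding sq_def using h_approx[of None None] tau
  by (intro growth_inverse_approx[OF endF_le _ growth_sqrt_approx[OF endF_le]]) (auto simp: mat_delta)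

lemma sq_bounded: "sq \<in> growth endF 0"
  by (rule growth_approx_bounded[OF endF_le sq_approx]) (use tau in simp)

lemma mu_approx: "(\<lambda>x. mu k x + mat 1 $ k $ None) \<in> growth endF (- \<tau>)"
proof -
  have "(\<lambda>x. - ((h k None x - mat 1 $ k $ None) * sq x + mat 1 $ k $ None * (sq x - 1))) \<in> growth endF (- \<tau>)"
    by (intro growth_uminus growth_add growth_mult[OF endF_le h_approx sq_bounded] growth_cmult sq_approx) auto
  then show ?thesis by (simp add: mu_def algebra_simps)
qed

lemma mu_bounded: "mu k \<in> growth endF 0"
  by (rule growth_approx_bounded[OF endF_le, of _ "- mat 1 $ k $ None" "- \<tau>"]) (use tau mu_approx in auto)

lemma dsq_bounded: "(\<lambda>x. - (sq x ^ 3 / 2) * dh a None None x) \<in> growth endF (- \<tau> - 1)"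
proof -
  have "(\<lambda>x. (- (1/2)) * ((sq x * (sq x * sq x)) * dh a None None x)) \<in> growth endF (- \<tau> - 1)"
    by (intro growth_cmult growth_mult[OF endF_le growth_mult[OF endF_le sq_bounded growth_mult[OF endF_le sq_bounded sq_bounded order.refl] order.refl] dh_bounded]) auto
  then show ?thesis by (simp add: power3_eq_cube mult_ac)
qed

lemma dmu_bounded: "dmu a k \<in> growth endF (- \<tau> - 1)"
  unfolding dmu_def[abs_def]
  by (intro growth_uminus growth_add growth_mult[OF endF_le dh_bounded sq_bounded] growth_mult[OF endF_le h_bounded dsq_bounded]) auto

text \<open>
  The tangential components of the normal are small, so differentiating the normalising factor only
  produces quadratic terms; what remains is \<open>- h\<^sub>b\<^sub>1\<^sub>,\<^sub>a\<close>, which is \<open>g\<^sub>b\<^sub>1\<^sub>,\<^sub>a\<close> to first order.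
\<close>

lemma dmu_lin: "(\<lambda>x. dmu a (Some b) x - dg a (Some b) None x) \<in> growth endF (- 2 * \<tau> - 1)"
proof -
  have hbN: "h (Some b) None \<in> growth endF (- \<tau>)" using h_approx[of "Some b" None] by (simp add: mat_delta)
  have "(\<lambda>x. - (dh a (Some b) None x * (sq x - 1)) - (dh a (Some b) None x + dg a (Some b) None x)
     - h (Some b) None x * (- (sq x ^ 3 / 2) * dh a None None x)) \<in> growth endF (- 2 * \<tau> - 1)"
    by (intro growth_diff growth_uminus growth_mult[OF endF_le dh_bounded sq_approx] dh_lin growth_mult[OF endF_le hbN dsq_bounded]) auto
  then show ?thesis by (simp add: dmu_def algebra_simps)
qed

text \<open>
  The formula of \<open>linA\<close> on the whole end.
\<close>

definition linA' where
  "linA' a b x = (dg (Some a) None (Some b) x + dg (Some b) None (Some a) x - dg None (Some a) (Some b) x) / 2"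

lemma linA'_bound: "linA' a b \<in> growth endF (- \<tau> - 1)"
proof -
  have "(\<lambda>x. (1/2) * (dg (Some a) None (Some b) x + dg (Some b) None (Some a) x - dg None (Some a) (Some b) x)) \<in> growth endF (- \<tau> - 1)"
    by (intro growth_cmult growth_diff growth_add decay1)
  then show ?thesis by (simp add: linA'_def[abs_def])
qed

text \<open>
  To first order \<open>A\<^sub>a\<^sub>b = \<mu>\<^sub>b\<^sub>,\<^sub>a - \<Gamma>\<^sup>b\<^sub>a\<^sub>1\<close>.
\<close>

lemma sff_lin: "(\<lambda>x. sff a b x - linA' a b x) \<in> growth endF (- 2 * \<tau> - 1)"
proof -
  define X where "X k x = dmu (Some a) k x + (\<Sum>l\<in>UNIV. gam k (Some a) l x * mu l x)" for k x
  have Xb: "X k \<in> growth endF (- \<tau> - 1)" for k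
    unfolding X_def[abs_def] by (intro growth_add growth_sum dmu_bounded growth_mult[OF endF_le gam_bounded mu_bounded]) auto
  have 1: "(\<lambda>x. (\<Sum>k\<in>UNIV. X k x * (g x $ k $ Some b - mat 1 $ k $ Some b))) \<in> growth endF (- 2 * \<tau> - 1)"
    by (intro growth_sum growth_mult[OF endF_le Xb decay0]) auto
  have 2: "(\<lambda>x. (\<Sum>l\<in>UNIV. gam (Some b) (Some a) l x * (mu l x + mat 1 $ l $ None))) \<in> growth endF (- 2 * \<tau> - 1)"
    by (intro growth_sum growth_mult[OF endF_le gam_bounded mu_approx]) auto
  have "(\<lambda>x. (\<Sum>k\<in>UNIV. X k x * (g x $ k $ Some b - mat 1 $ k $ Some b))
     + (\<Sum>l\<in>UNIV. gam (Some b) (Some a) l x * (mu l x + mat 1 $ l $ None))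
     + (dmu (Some a) (Some b) x - dg (Some a) (Some b) None x)
     - (gam (Some b) (Some a) None x - lgam (Some b) (Some a) None x)) \<in> growth endF (- 2 * \<tau> - 1)"
    by (intro growth_diff growth_add 1 2 dmu_lin gam_lin)
  then show ?thesis
  proof (rule growth_cong)
    show "\<forall>\<^sub>F x in endF. (\<Sum>k\<in>UNIV. X k x * (g x $ k $ Some b - mat 1 $ k $ Some b))
     + (\<Sum>l\<in>UNIV. gam (Some b) (Some a) l x * (mu l x + mat 1 $ l $ None))
     + (dmu (Some a) (Some b) x - dg (Some a) (Some b) None x)
     - (gam (Some b) (Some a) None x - lgam (Some b) (Some a) None x) = sff a b x - linA' a b x"
      using eventually_end_region
    proof eventually_elim
      case (elim x)
      have 1: "(\<Sum>k\<in>UNIV. X k x * (g x $ k $ Some b - mat 1 $ k $ Some b)) = sff a b x - X (Some b) x"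
        by (simp only: right_diff_distrib sum_subtractf sum_mat_delta) (simp add: sff_def X_def)
      have 2: "(\<Sum>l\<in>UNIV. gam (Some b) (Some a) l x * (mu l x + mat 1 $ l $ None))
        = (\<Sum>l\<in>UNIV. gam (Some b) (Some a) l x * mu l x) + gam (Some b) (Some a) None x"
        by (simp only: distrib_left sum.distrib sum_mat_delta)
      have 3: "dg (Some a) (Some b) None x - lgam (Some b) (Some a) None x = linA' a b x"
        unfolding lgam_def linA'_def
        by (simp add: dg_sym[OF elim, of _ "Some _" None] field_simps)
      show ?case unfolding 1 2 using 3 by (simp add: X_def)
    qed
  qed
qed

lemma sff_bounded: "sff a b \<in> growth endF (- \<tau> - 1)"
  by (rule growth_approx_close[OF endF_le sff_lin linA'_bound]) (use tau in simp)

lemma mc_lin: "(\<lambda>x. mc x - (\<Sum>a\<in>UNIV. linA' a a x)) \<in> growth endF (- 2 * \<tau> - 1)"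
proof -
  have "(\<lambda>x. (\<Sum>i\<in>UNIV. \<Sum>j\<in>UNIV. (th i j x - mat 1 $ i $ j) * sff i j x) + (\<Sum>i\<in>UNIV. sff i i x - linA' i i x)) \<in> growth endF (- 2 * \<tau> - 1)"
    by (intro growth_add growth_sum growth_mult[OF endF_le th_approx sff_bounded] sff_lin) auto
  then show ?thesis
    by (simp only: mc_def left_diff_distrib sum_subtractf sum_mat_delta) simp
qed

lemma mc_bounded: "mc \<in> growth endF (- \<tau> - 1)"
  by (rule growth_approx_close[OF endF_le mc_lin growth_sum[OF linA'_bound]]) (use tau in simp)

text \<open>
  The integrand on the boundary sphere with respect to the Euclidean surface measure.
\<close>

definition boundary_density where
  "boundary_density y = form (second_ff end_region g (bdry_pt y) - mean_curv end_region g (bdry_pt y) *\<^sub>R tang (g (bdry_pt y)))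
     y (unit_normal (tang (g (bdry_pt y))) y) * induced_density (tang (g (bdry_pt y))) y"

lemma eventually_exterior: "\<forall>\<^sub>F y :: real^'a in at_infinity. y \<in> - cball 0 1"
  by (auto simp: eventually_at_infinity intro: exI[of _ 2])

lemma boundary_density_lin: "(\<lambda>y. boundary_density y - linAH y / norm y) \<in> growth at_infinity (- 2 * \<tau>)"
proof -
  let ?L = "\<lambda>a b y. linA a b y - linH y * mat 1 $ a $ b"
  let ?m = "\<lambda>y. tang (g (bdry_pt y))"
  let ?T = "\<lambda>y. second_ff end_region g (bdry_pt y) - mean_curv end_region g (bdry_pt y) *\<^sub>R ?m y"
  have A: "linA a b y = linA' a b (bdry_pt y)" for a b y by (simp add: linA_def linA'_def)
  have nm: "near_id at_infinity (- \<tau>) ?m"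
    using near_tang growth_bdry by (auto simp: near_id_def)
  have sp: "\<forall>\<^sub>F y in at_infinity. spd (?m y)"
    using eventually_exterior by eventually_elim (rule spd_tang[OF bdry_pt_in_end_region])
  have L: "?L a b \<in> growth at_infinity (- \<tau> - 1)" for a b
  proof -
    have "(\<lambda>x. linA' a b x - mat 1 $ a $ b * (\<Sum>c\<in>UNIV. linA' c c x)) \<in> growth endF (- \<tau> - 1)"
      by (intro growth_diff growth_cmult growth_sum linA'_bound)
    from growth_bdry[OF this] show ?thesis by (simp add: A linH_def mult_ac)
  qed
  have T: "(\<lambda>y. ?T y $ a $ b - ?L a b y) \<in> growth at_infinity ((- \<tau> - 1) + (- \<tau>))" for a b
  proof -
    have "(\<lambda>x. (sff a b x - linA' a b x) - (mc x * (tang (g x) $ a $ b - mat 1 $ a $ b)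
        + mat 1 $ a $ b * (mc x - (\<Sum>c\<in>UNIV. linA' c c x)))) \<in> growth endF (- 2 * \<tau> - 1)"
    proof (rule growth_diff[OF sff_lin growth_add[OF _ growth_cmult[OF mc_lin]]])
      have "(\<lambda>x. tang (g x) $ a $ b - mat 1 $ a $ b) \<in> growth endF (- \<tau>)"
        using near_tang by (simp add: near_id_def)
      from growth_mult[OF endF_le mc_bounded this]
      show "(\<lambda>x. mc x * (tang (g x) $ a $ b - mat 1 $ a $ b)) \<in> growth endF (- 2 * \<tau> - 1)" by simp
    qed
    from growth_bdry[OF this] have "(\<lambda>y. ?T y $ a $ b - ?L a b y) \<in> growth at_infinity (- 2 * \<tau> - 1)"
      by (rule growth_cong) (use eventually_exterior in eventually_elim,
          simp add: second_ff_eq mean_curv_eq bdry_pt_in_end_region A linH_def algebra_simps)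
    moreover have "(- \<tau> - 1) + (- \<tau>) = - 2 * \<tau> - 1" by simp
    ultimately show ?thesis by (simp only:)
  qed
  have "(\<lambda>y. boundary_density y - (\<Sum>a\<in>UNIV. \<Sum>b\<in>UNIV. ?L a b y * (y $ a * y $ b)) / norm y)
      \<in> growth at_infinity ((- \<tau> - 1) + (- \<tau>) + 1)"
    unfolding boundary_density_def by (rule flux_integrand_asymp[OF nm sp T L])
  moreover have "(\<Sum>a\<in>UNIV. \<Sum>b\<in>UNIV. ?L a b y * (y $ a * y $ b)) = linAH y" for y
    unfolding linAH_def by (rule sum_minus_trace)
  moreover have "(- \<tau> - 1) + (- \<tau>) + 1 = - 2 * \<tau>" by simp
  ultimately show ?thesis by (simp only:)
qed

lemma boundary_density_cont: "continuous_on (- cball 0 1) boundary_density"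
proof -
  let ?S = "- cball 0 1 :: (real^'a) set"
  have "0 \<notin> ?S" by simp
  note c = continuous_on_unit_normal_density[OF bdry_cont[OF tang_cont] spd_tang[OF bdry_pt_in_end_region] this]
  have x: "continuous_on ?S (\<lambda>x. x $ k)" for k by (intro continuous_intros)
  have "continuous_on ?S (\<lambda>y. sff a b (bdry_pt y) - mc (bdry_pt y) * tang (g (bdry_pt y)) $ a $ b)" for a b
    by (intro continuous_on_diff continuous_on_mult bdry_cont[OF tang_cont] bdry_cont[OF sff_cont] bdry_cont[OF mc_cont])
  then have T: "continuous_on ?S (\<lambda>y. (second_ff end_region g (bdry_pt y) - mean_curv end_region g (bdry_pt y) *\<^sub>R tang (g (bdry_pt y))) $ a $ b)" for a b
    by (rule continuous_on_eq) (simp add: second_ff_eq mean_curv_eq bdry_pt_in_end_region)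
  show ?thesis
    unfolding boundary_density_def[abs_def] form_def inner_vec_def matrix_vector_mult_def vec_lambda_beta inner_real_def
    by (intro continuous_on_mult continuous_on_sum T c x)
qed

end

section \<open>Limits of sphere integrals\<close>

lemma powr_set_integrable:
  fixes e a :: real
  assumes e: "e < -1" and a: "a > 0"
  shows "set_integrable lborel {a..} (\<lambda>x. x powr e)"
proof -
  have "(\<lambda>x. x powr e) integrable_on {a..}"
    using has_integral_powr_to_inf[OF e a] by blast
  then have "(\<lambda>x. x powr e) absolutely_integrable_on {a..}"
    by (rule nonnegative_absolutely_integrable_1) auto
  then have "integrable (completion lborel) (\<lambda>x. indicator {a..} x *\<^sub>R (x powr e))"
    by (simp add: set_integrable_def)
  then show ?thesis unfolding set_integrable_def
    by (subst (asm) integrable_completion) auto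
qed

lemma growth_bound:
  assumes "f \<in> growth (inf at_infinity (principal C)) s"
  obtains c r0 where "c > 0" "r0 > 1" "\<And>x. x \<in> C \<Longrightarrow> norm x \<ge> r0 \<Longrightarrow> \<bar>f x\<bar> \<le> c * norm x powr s"
proof -
  obtain c where c: "c > 0" "\<forall>\<^sub>F x in inf at_infinity (principal C). norm (f x) \<le> c * norm (norm x powr s)"
    using assms unfolding growth_def by (elim landau_o.bigE)
  then obtain b where b: "\<And>x. norm x \<ge> b \<Longrightarrow> x \<in> C \<Longrightarrow> norm (f x) \<le> c * norm (norm x powr s)"
    unfolding eventually_inf_principal eventually_at_infinity by blast
  show thesis by (rule that[of c "max b 2"]) (use b c in auto)
qed

text \<open>
  The area of the sphere of radius \<open>r\<close> is a multiple of \<open>r\<^sup>d\<^sup>-\<^sup>1\<close> in dimension \<open>d\<close>.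
\<close>

lemma cone_int_abs_le:
  fixes f :: "'a::euclidean_space \<Rightarrow> real"
  assumes C: "is_cone C" and f: "continuous_on (C - cball 0 1) f" and r: "r > 1"
    and b: "\<And>x. x \<in> C \<Longrightarrow> norm x = r \<Longrightarrow> \<bar>f x\<bar> \<le> c" and c: "c \<ge> 0"
  shows "\<bar>cone_int C f r\<bar> \<le> real DIM('a) * measure (cone_measure :: 'a measure) UNIV * r ^ (DIM('a) - 1) * c"
proof -
  interpret finite_measure "cone_measure :: 'a measure" by (rule finite_cone_measure)
  let ?k = "\<lambda>z. indicator (sphere 0 1 \<inter> C) z * f (r *\<^sub>R z)"
  have kb: "\<bar>?k z\<bar> \<le> c" for z
    using b[of "r *\<^sub>R z"] c r is_cone_scaleR[OF C, of r z] by (auto simp: indicator_def)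
  have "integrable cone_measure ?k"
    by (rule integrable_const_bound[where B=c]) 
      (use kb cone_scaled_measurable[OF C f r] in \<open>auto cong: measurable_cong_sets\<close>)
  then have "\<bar>LINT z|cone_measure. ?k z\<bar> \<le> (LINT z|(cone_measure :: 'a measure). c)"
    by (intro order.trans[OF integral_abs_bound] integral_mono) (use kb in auto)
  then have "\<bar>LINT z|cone_measure. ?k z\<bar> \<le> measure (cone_measure :: 'a measure) UNIV * c" by simp
  then have "real DIM('a) * r ^ (DIM('a) - 1) * \<bar>LINT z|cone_measure. ?k z\<bar>
     \<le> real DIM('a) * r ^ (DIM('a) - 1) * (measure (cone_measure :: 'a measure) UNIV * c)"
    using r by (intro mult_left_mono) auto
  then show ?thesis unfolding cone_int_eq[OF C f r] using r by (simp add: abs_mult mult_ac)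
qed

lemma cone_int_growth:
  fixes f :: "'a::euclidean_space \<Rightarrow> real"
  assumes C: "is_cone C" and f: "continuous_on (C - cball 0 1) f" and growth: "f \<in> growth (inf at_infinity (principal C)) s"
  obtains K r0 where "K \<ge> 0" "r0 > 1" "\<And>r. r \<ge> r0 \<Longrightarrow> \<bar>cone_int C f r\<bar> \<le> K * r powr (real DIM('a) - 1 + s)"
proof -
  obtain c r0 where c: "c > 0" "r0 > 1" "\<And>x. x \<in> C \<Longrightarrow> norm x \<ge> r0 \<Longrightarrow> \<bar>f x\<bar> \<le> c * norm x powr s"
    using growth_bound[OF growth] by blast
  let ?M = "real DIM('a) * measure (cone_measure :: 'a measure) UNIV"
  show thesis
  proof (rule that[of "?M * c" r0])
    fix r assume r: "r \<ge> r0"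
    then have r1: "r > 1" using c by simp
    have "\<bar>cone_int C f r\<bar> \<le> ?M * r ^ (DIM('a) - 1) * (c * r powr s)"
      by (rule cone_int_abs_le[OF C f r1]) (use c r in auto)
    also have "r ^ (DIM('a) - 1) = r powr (real DIM('a) - 1)"
      using r1 DIM_positive[where 'a='a] by (simp add: powr_realpow[symmetric] of_nat_diff Suc_leI)
    finally show "\<bar>cone_int C f r\<bar> \<le> (?M * c) * r powr (real DIM('a) - 1 + s)"
      by (simp add: powr_add mult_ac)
  qed (use c in auto)
qed

lemma cone_int_tendsto_0:
  fixes f :: "'a::euclidean_space \<Rightarrow> real"
  assumes C: "is_cone C" and f: "continuous_on (C - cball 0 1) f" and growth: "f \<in> growth (inf at_infinity (principal C)) s"
    and s: "real DIM('a) - 1 + s < 0"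
  shows "(cone_int C f \<longlongrightarrow> 0) at_top"
proof -
  obtain K r0 where K: "K \<ge> 0" "r0 > 1" "\<And>r. r \<ge> r0 \<Longrightarrow> \<bar>cone_int C f r\<bar> \<le> K * r powr (real DIM('a) - 1 + s)"
    using cone_int_growth[OF C f growth] by blast
  have "((\<lambda>r. r powr (real DIM('a) - 1 + s)) \<longlongrightarrow> 0) at_top"
    by (rule tendsto_neg_powr[OF s filterlim_ident])
  then have t: "((\<lambda>r. K * r powr (real DIM('a) - 1 + s)) \<longlongrightarrow> 0) at_top" by (rule tendsto_mult_right_zero)
  have "\<forall>\<^sub>F r in at_top. norm (cone_int C f r) \<le> K * r powr (real DIM('a) - 1 + s)"
    using eventually_ge_at_top[of r0] by eventually_elim (use K in auto)
  then show ?thesis by (rule Lim_null_comparison[OF _ t])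
qed

lemma cone_int_borel_measurable:
  assumes C: "is_cone C" and f: "continuous_on (C - cball 0 1) f" and r: "r0 > 1"
  shows "set_borel_measurable lborel {r0..} (cone_int C f)"
proof -
  have "{r0..} \<subseteq> {1<..}" using r by auto
  from continuous_on_subset[OF cone_int_continuous[OF C f] this]
  show ?thesis
    unfolding set_borel_measurable_def using borel_measurable_continuous_on_indicator[of "{r0..}" "cone_int C f"] by simp
qed

lemma cone_int_set_integrable_of_growth:
  fixes f :: "'a::euclidean_space \<Rightarrow> real"
  assumes C: "is_cone C" and f: "continuous_on (C - cball 0 1) f" and growth: "f \<in> growth (inf at_infinity (principal C)) s"
    and s: "real DIM('a) + s < 0"
  obtains r0 where "r0 > 1" "\<And>r1. r1 \<ge> r0 \<Longrightarrow> set_integrable lborel {r1..} (cone_int C f)"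
proof -
  obtain K r0 where K: "K \<ge> 0" "r0 > 1" "\<And>r. r \<ge> r0 \<Longrightarrow> \<bar>cone_int C f r\<bar> \<le> K * r powr (real DIM('a) - 1 + s)"
    using cone_int_growth[OF C f growth] by blast
  show thesis
  proof (rule that[OF K(2)])
    fix r1 assume r1: "r1 \<ge> r0"
    have "set_integrable lborel {r1..} (\<lambda>x. K * x powr (real DIM('a) - 1 + s))"
      by (intro set_integrable_mult_right powr_set_integrable) (use s r1 K in auto)
    then show "set_integrable lborel {r1..} (cone_int C f)"
    proof (rule set_integrable_bound)
      show "set_borel_measurable lborel {r1..} (cone_int C f)"
        by (rule cone_int_borel_measurable[OF C f]) (use r1 K in simp)
      show "AE x in lborel. x \<in> {r1..} \<longrightarrow> norm (cone_int C f x) \<le> norm (K * x powr (real DIM('a) - 1 + s))"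
        using K r1 by (intro AE_I2) (force simp: abs_mult)
    qed
  qed
qed

text \<open>
  Polar coordinates: an integrable function has integrable integrals over spheres.
\<close>

lemma cone_int_set_integrable:
  fixes f :: "'a::euclidean_space \<Rightarrow> real"
  assumes C: "is_cone C" and f: "continuous_on (C - cball 0 1) f" and r: "r0 > 1"
    and int: "integrable lborel (\<lambda>x. indicator (C - ball 0 r0) x * f x)"
  shows "set_integrable lborel {r0..} (cone_int C f)"
proof -
  let ?G = "\<lambda>x. indicator (C - ball 0 r0) x * f x"
  have G: "?G \<in> borel_measurable borel" using int by simp
  have "indicator {0<..} r * integral\<^sup>L (sphere_measure r) ?G = indicator {r0..} r *\<^sub>R cone_int C f r" for r :: real
  proof (cases "r > 0")
    case True
    have "integral\<^sup>L (sphere_measure r) ?G = real DIM('a) * r ^ (DIM('a) - 1) * (LINT z|cone_measure. ?G (r *\<^sub>R z))"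
      by (rule integral_sphere_measure[OF G]) (use True in simp)
    also have "\<dots> = indicator {r0..} r *\<^sub>R cone_int C f r"
    proof (cases "r \<ge> r0")
      case r0: True
      then have r1: "r > 1" using r by simp
      have "(LINT z|cone_measure. ?G (r *\<^sub>R z)) = (LINT z|cone_measure. indicator (sphere 0 1 \<inter> C) z * f (r *\<^sub>R z))"
      proof (rule integral_cong_AE)
        show "(\<lambda>z. ?G (r *\<^sub>R z)) \<in> borel_measurable cone_measure"
          using measurable_compose[OF _ G, of "\<lambda>z. r *\<^sub>R z" borel] by (simp cong: measurable_cong_sets)
        show "(\<lambda>z. indicator (sphere 0 1 \<inter> C) z * f (r *\<^sub>R z)) \<in> borel_measurable cone_measure"
          using cone_scaled_measurable[OF C f r1] by (simp cong: measurable_cong_sets)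
        show "AE z in cone_measure. ?G (r *\<^sub>R z) = indicator (sphere 0 1 \<inter> C) z * f (r *\<^sub>R z)"
          using AE_cone_measure
          by eventually_elim (use r0 True is_cone_scaleR[OF C True] in \<open>auto simp: indicator_def\<close>)
      qed
      then show ?thesis using r0 cone_int_eq[OF C f r1] by simp
    next
      case False
      have "AE z in cone_measure. ?G (r *\<^sub>R z) = 0"
        using AE_cone_measure by eventually_elim (use False True in \<open>auto simp: indicator_def\<close>)
      then have "(LINT z|cone_measure. ?G (r *\<^sub>R z)) = 0" by (rule integral_eq_zero_AE)
      then show ?thesis using False by simp
    qed
    finally show ?thesis using True by simp
  qed (use r in auto)
  with lborel_integral_polar(1)[OF int] show ?thesis unfolding set_integrable_def by simp
qed

text \<open>
  Used for \<open>f = R\<close>, its linear part \<open>l\<close> and the volume density \<open>w\<close>, and likewise for the mean curvature.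
  The weight is at least \<open>1/2\<close> far out, and the error \<open>f - l\<close> is integrable by its decay.
\<close>

lemma cone_int_set_integrable_approx:
  fixes f l w :: "'a::euclidean_space \<Rightarrow> real"
  assumes C: "is_cone C" and f: "continuous_on (C - cball 0 1) f" and l: "continuous_on (C - cball 0 1) l"
    and w: "continuous_on (C - cball 0 1) w" and w1: "(w \<longlongrightarrow> 1) (inf at_infinity (principal C))"
    and int: "integrable lborel (\<lambda>x. indicator (C - cball 0 1) x * (w x * f x))"
    and growth: "(\<lambda>x. f x - l x) \<in> growth (inf at_infinity (principal C)) s" and s: "real DIM('a) + s < 0"
  obtains r0 where "r0 > 1" "\<And>r. r \<ge> r0 \<Longrightarrow> set_integrable lborel {r..} (cone_int C l)"
proof -
  have fl: "continuous_on (C - cball 0 1) (\<lambda>x. f x - l x)" by (intro continuous_on_diff f l)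
  obtain ra where ra: "ra > 1" "\<And>r1. r1 \<ge> ra \<Longrightarrow> set_integrable lborel {r1..} (cone_int C (\<lambda>x. f x - l x))"
    using cone_int_set_integrable_of_growth[OF C fl growth s] by blast
  have "\<forall>\<^sub>F x in inf at_infinity (principal C). w x > 1/2"
    by (rule order_tendstoD[OF w1]) simp
  then obtain rb where rb: "\<And>x. norm x \<ge> rb \<Longrightarrow> x \<in> C \<Longrightarrow> w x > 1/2"
    unfolding eventually_inf_principal eventually_at_infinity by blast
  show thesis
  proof (rule that[of "max ra rb"])
    fix r assume r: "r \<ge> max ra rb"
    then have r1: "r > 1" using ra by simp
    have Cb: "C - ball 0 r \<in> sets borel" using C unfolding is_cone_def by auto
    have sub: "C - ball 0 r \<subseteq> C - cball 0 1" using r1 by auto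
    have "integrable lborel (\<lambda>x. indicator (C - ball 0 r) x * f x)"
    proof (rule Bochner_Integration.integrable_bound[OF integrable_mult_right[OF int, of 2]])
      show "(\<lambda>x. indicator (C - ball 0 r) x * f x) \<in> borel_measurable lborel"
        using borel_measurable_continuous_on_indicator[OF Cb continuous_on_subset[OF f sub]] by simp
      show "AE x in lborel. norm (indicator (C - ball 0 r) x * f x) \<le> norm (2 * (indicator (C - cball 0 1) x * (w x * f x)))"
      proof (rule AE_I2)
        fix x show "norm (indicator (C - ball 0 r) x * f x) \<le> norm (2 * (indicator (C - cball 0 1) x * (w x * f x)))"
        proof (cases "x \<in> C - ball 0 r")
          case True
          then have "w x > 1/2" using rb[of x] r by auto
          then have "1 * \<bar>f x\<bar> \<le> (2 * \<bar>w x\<bar>) * \<bar>f x\<bar>" by (intro mult_right_mono) auto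
          then show ?thesis using True sub by (auto simp: abs_mult)
        qed simp
      qed
    qed
    then have "set_integrable lborel {r..} (cone_int C f)" by (rule cone_int_set_integrable[OF C f r1])
    moreover have "set_integrable lborel {r..} (cone_int C (\<lambda>x. f x - l x))" using ra r by simp
    ultimately have "set_integrable lborel {r..} (\<lambda>r. cone_int C f r - cone_int C (\<lambda>x. f x - l x) r)"
      by (rule set_integral_diff)
    moreover have "cone_int C f u - cone_int C (\<lambda>x. f x - l x) u = cone_int C l u" if "u \<ge> r" for u
      using cone_int_add[OF C fl l, of u] that r1 by simp
    ultimately show "set_integrable lborel {r..} (cone_int C l)"
      unfolding set_integrable_def by (elim Bochner_Integration.integrable_cong[THEN iffD1, rotated -1]) (auto simp: indicator_def)
  qed (use ra in auto)
qed

context AF_end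
begin

lemma adm_flux_eq:
  "adm_flux g r = 1 / (2 * (real CARD('a option) - 1) * unit_sphere_vol TYPE(real^('a option))) * mass_flux r"
  unfolding adm_flux_def mass_flux_def cone_int_def hemisphere_def massV_def dg_def by simp

lemma einstein_flux_eq:
  "einstein_flux g r = cone_int half_space einstein_density r + cone_int UNIV boundary_density r"
  unfolding einstein_flux_def cone_int_def hemisphere_def einstein_density_def boundary_density_def Let_def by simp

lemma exterior_eq: "UNIV - cball 0 1 = - cball (0::real^'a) 1" by auto

text \<open>
  The errors on the hemisphere and on the boundary sphere are both \<open>O(r\<^sup>n\<^sup>-\<^sup>2\<^sup>-\<^sup>2\<^sup>\<tau>)\<close>.
\<close>

lemma einstein_flux_asymp:
  assumes tau2: "2 * \<tau> > real CARD('a) - 1"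
  shows "((\<lambda>r. einstein_flux g r + (real CARD('a) - 1) / 2 * mass_flux r) \<longlongrightarrow> 0) at_top"
proof -
  have U: "is_cone (UNIV :: (real^'a) set)" by (simp add: is_cone_def)
  let ?d1 = "\<lambda>x. einstein_density x - linEin x / norm x" and ?d2 = "\<lambda>y. boundary_density y - linAH y / norm y"
  have l1: "continuous_on (half_space - cball 0 1) (\<lambda>x. linEin x / norm x)"
    unfolding end_region_def[symmetric] by (intro continuous_intros linEin_cont) (auto simp: end_region_def)
  have e1: "continuous_on (half_space - cball 0 1) einstein_density"
    using einstein_density_cont by (simp add: end_region_def)
  have l2: "continuous_on (UNIV - cball 0 1) (\<lambda>y. linAH y / norm y)"
    unfolding exterior_eq by (intro continuous_intros linAH_cont) auto
  have e2: "continuous_on (UNIV - cball 0 1) boundary_density"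
    unfolding exterior_eq by (rule boundary_density_cont)
  have d1: "continuous_on (half_space - cball 0 1) ?d1" by (intro continuous_on_diff e1 l1)
  have d2: "continuous_on (UNIV - cball 0 1) ?d2" by (intro continuous_on_diff e2 l2)
  have t1: "(cone_int half_space ?d1 \<longlongrightarrow> 0) at_top"
    by (rule cone_int_tendsto_0[OF is_cone_half_space d1 einstein_density_lin[unfolded endF_def]])
      (use tau2 in simp)
  have t2: "(cone_int UNIV ?d2 \<longlongrightarrow> 0) at_top"
    by (rule cone_int_tendsto_0[OF U d2]) (use boundary_density_lin tau2 in auto)
  have "\<forall>\<^sub>F r in at_top. cone_int half_space ?d1 r + cone_int UNIV ?d2 r = einstein_flux g r + (real CARD('a) - 1) / 2 * mass_flux r"
    using eventually_gt_at_top[of 1]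
  proof eventually_elim
    case (elim r)
    have "cone_int half_space einstein_density r = cone_int half_space ?d1 r + cone_int half_space (\<lambda>x. linEin x / norm x) r"
      using cone_int_add[OF is_cone_half_space d1 l1 elim] by simp
    moreover have "cone_int UNIV boundary_density r = cone_int UNIV ?d2 r + cone_int UNIV (\<lambda>y. linAH y / norm y) r"
      using cone_int_add[OF U d2 l2 elim] by simp
    moreover have "- n / 2 * M = - (n / 2 * M)" for n M :: real by simp
    ultimately show ?case using linear_flux_identity[OF elim] unfolding einstein_flux_eq by linarith
  qed
  with tendsto_add[OF t1 t2] show ?thesis by (simp add: tendsto_cong)
qed

lemma mass_flux_convergent:
  assumes tau2: "2 * \<tau> > real CARD('a) - 1"
    and int1: "integrable lborel (\<lambda>x. indicator end_region x * (sqrt (det (g x)) * scal x))"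
    and int2: "integrable lborel (\<lambda>y. indicator (- cball 0 1) y * (sqrt (det (tang (g (bdry_pt y)))) * mc (bdry_pt y)))"
  shows "\<exists>m. (mass_flux \<longlongrightarrow> m) at_top"
proof -
  have U: "is_cone (UNIV :: (real^'a) set)" by (simp add: is_cone_def)
  obtain r1 where r1: "r1 > 1" "\<And>r. r \<ge> r1 \<Longrightarrow> set_integrable lborel {r..} (cone_int half_space linR)"
  proof (rule cone_int_set_integrable_approx[OF is_cone_half_space, folded end_region_def endF_def, OF scal_cont linR_cont _ _ int1 scal_lin])
    show "continuous_on end_region (\<lambda>x. sqrt (det (g x)))"
      by (intro continuous_on_real_sqrt continuous_on_det g_cont)
    show "((\<lambda>x. sqrt (det (g x))) \<longlongrightarrow> 1) endF"
      by (rule growth_approx_tendsto[OF endF_le growth_sqrt_approx[OF endF_le _ near_id_det[OF near_g]]]) (use tau in auto)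
    show "real DIM(real^('a option)) + (- 2 * \<tau> - 2) < 0" using tau2 by simp
  qed blast
  obtain r2 where r2: "r2 > 1" "\<And>r. r \<ge> r2 \<Longrightarrow> set_integrable lborel {r..} (cone_int UNIV linH)"
  proof (rule cone_int_set_integrable_approx[OF U, unfolded exterior_eq, OF bdry_cont[OF mc_cont] linH_cont _ _ int2])
    show "continuous_on (- cball 0 1) (\<lambda>y. sqrt (det (tang (g (bdry_pt y)))))"
      by (intro continuous_on_real_sqrt continuous_on_det bdry_cont[OF tang_cont])
    have "(\<lambda>x. sqrt (det (tang (g x))) - 1) \<in> growth endF (- \<tau>)"
      by (rule growth_sqrt_approx[OF endF_le _ near_id_det[OF near_tang]]) (use tau in auto)
    from growth_bdry[OF this] show "((\<lambda>y. sqrt (det (tang (g (bdry_pt y))))) \<longlongrightarrow> 1) (inf at_infinity (principal UNIV))"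
      using tau by (auto intro: growth_approx_tendsto[of _ _ 1 "- \<tau>"])
    show "(\<lambda>y. mc (bdry_pt y) - linH y) \<in> growth (inf at_infinity (principal UNIV)) (- 2 * \<tau> - 1)"
      using growth_bdry[OF mc_lin] by (simp add: linH_def linA_def linA'_def)
    show "real DIM(real^'a) + (- 2 * \<tau> - 1) < 0" using tau2 by simp
  qed blast
  define s where "s = max r1 r2"
  have s: "s > 1" "s \<ge> r1" "s \<ge> r2" using r1 by (auto simp: s_def)
  let ?k = "\<lambda>r. cone_int half_space linR r + cone_int UNIV (\<lambda>y. 2 * linH y) r"
  have k: "set_integrable lborel {s..} ?k"
    unfolding cone_int_cmult by (intro set_integral_add set_integrable_mult_right r1 r2 s)
  have lim: "((\<lambda>t. LINT r|lborel. indicator {..t} r *\<^sub>R (indicator {s..} r *\<^sub>R ?k r)) \<longlongrightarrow> (LINT r|lborel. indicator {s..} r *\<^sub>R ?k r)) at_top"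
    by (rule tendsto_integral_at_top) (use k in \<open>auto simp: set_integrable_def\<close>)
  have ev: "\<forall>\<^sub>F t in at_top. (LINT r|lborel. indicator {..t} r *\<^sub>R (indicator {s..} r *\<^sub>R ?k r)) + mass_flux s = mass_flux t"
    using eventually_ge_at_top[of s]
  proof eventually_elim
    case (elim t)
    have "(LINT r|lborel. indicator {..t} r *\<^sub>R (indicator {s..} r *\<^sub>R ?k r)) = (LINT r:{s..t}|lborel. ?k r)"
      unfolding set_lebesgue_integral_def
      by (rule Bochner_Integration.integral_cong) (auto simp: indicator_def)
    also have "\<dots> = integral {s..t} ?k"
      by (rule set_borel_integral_eq_integral(2), rule set_integrable_subset[OF k]) auto
    also have "\<dots> = mass_flux t - mass_flux s" using mass_flux_increment[OF s(1) elim] by simp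
    finally show ?case by simp
  qed
  from tendsto_add[OF lim tendsto_const[of "mass_flux s"]] 
  show ?thesis using tendsto_cong[OF ev] by blast
qed

end

text \<open>
  The coordinate expression of a volume measure says that the chart \<open>\<Phi>\<close> pushes it forward to the
  Borel measure with density \<open>w\<close>.
\<close>

lemma integrable_transfer:
  fixes F w :: "'b::euclidean_space \<Rightarrow> real" and R :: "'p \<Rightarrow> real"
  assumes U: "U \<in> sets M" and \<Phi>: "\<Phi> \<in> measurable (restrict_space M U) borel"
    and E: "E \<in> sets borel" and w: "(\<lambda>x. indicator E x * w x) \<in> borel_measurable borel" "\<And>x. x \<in> E \<Longrightarrow> w x \<ge> 0"
    and em: "\<And>A. A \<in> sets borel \<Longrightarrow> emeasure M (\<Phi> -` A \<inter> U) = (\<integral>\<^sup>+x\<in>A \<inter> E. ennreal (w x) \<partial>lborel)"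
    and F: "(\<lambda>x. indicator E x * F x) \<in> borel_measurable borel" and R: "integrable M R"
    and RF: "\<And>p. p \<in> U \<Longrightarrow> \<Phi> p \<in> E \<and> R p = F (\<Phi> p)"
  shows "integrable lborel (\<lambda>x. indicator E x * (w x * F x))"
proof -
  let ?w = "\<lambda>x. indicator E x * w x" and ?F = "\<lambda>x. indicator E x * F x"
  have sp: "U \<inter> space M \<in> sets M" using U by auto
  have wE: "?w x \<ge> 0" for x using w(2) by (auto simp: indicator_def)
  have Usp: "U \<subseteq> space M" using U by (rule sets.sets_into_space)
  have eq: "distr (restrict_space M U) borel \<Phi> = density lborel (\<lambda>x. ennreal (?w x))"
  proof (rule measure_eqI)
    fix A assume "A \<in> sets (distr (restrict_space M U) borel \<Phi>)"
    then have A: "A \<in> sets borel" by simp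
    have "emeasure (distr (restrict_space M U) borel \<Phi>) A = emeasure (restrict_space M U) (\<Phi> -` A \<inter> U)"
      by (subst emeasure_distr[OF \<Phi> A]) (use Usp in \<open>auto simp: space_restrict_space Int_absorb2\<close>)
    also have "\<dots> = emeasure M (\<Phi> -` A \<inter> U)"
      by (rule emeasure_restrict_space[OF sp]) auto
    also have "\<dots> = (\<integral>\<^sup>+x. ennreal (?w x) * indicator A x \<partial>lborel)"
      unfolding em[OF A] by (rule nn_integral_cong) (auto simp: indicator_def)
    also have "\<dots> = emeasure (density lborel (\<lambda>x. ennreal (?w x))) A"
      by (rule emeasure_density[symmetric]) (use w A in auto)
    finally show "emeasure (distr (restrict_space M U) borel \<Phi>) A = emeasure (density lborel (\<lambda>x. ennreal (?w x))) A" .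
  qed simp
  have "integrable M (\<lambda>p. indicator U p *\<^sub>R R p)" using U R by (intro integrable_mult_indicator)
  then have "integrable (restrict_space M U) R" by (subst integrable_restrict_space[OF sp])
  moreover have "R p = ?F (\<Phi> p)" if "p \<in> space (restrict_space M U)" for p
    using that RF[of p] by (auto simp: space_restrict_space)
  ultimately have "integrable (restrict_space M U) (\<lambda>p. ?F (\<Phi> p))"
    by (subst (asm) Bochner_Integration.integrable_cong[OF refl]) auto
  then have "integrable (distr (restrict_space M U) borel \<Phi>) ?F"
    by (subst integrable_distr_eq[OF \<Phi> F])
  then have "integrable lborel (\<lambda>x. ?w x *\<^sub>R ?F x)"
    unfolding eq by (subst (asm) integrable_density) (use F w wE in auto)
  moreover have "(\<lambda>x. ?w x *\<^sub>R ?F x) = (\<lambda>x. indicator E x * (w x * F x))"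
    by (auto simp: indicator_def fun_eq_iff)
  ultimately show ?thesis by simp
qed

section \<open>The mass and the Einstein tensor\<close>

text \<open>
  The determinant does not vanish along the segment from the identity to \<open>m\<close>, which consists of positive
  definite matrices.
\<close>

lemma spd_det_pos:
  fixes m :: "real^'n^'n::finite"
  assumes "spd m" shows "det m > 0"
proof (rule ccontr)
  assume neg: "\<not> det m > 0"
  let ?p = "\<lambda>t::real. \<chi> i j. (1 - t) * mat 1 $ i $ j + t * m $ i $ j"
  have p: "?p t = (1 - t) *\<^sub>R mat 1 + t *\<^sub>R m" for t by (simp add: vec_eq_iff)
  have "continuous_on {0..1} (\<lambda>t. det (?p t))"
    by (rule continuous_on_det) (simp, intro continuous_intros)
  moreover have "det (?p 1) \<le> 0" "0 \<le> det (?p 0)" using neg by (simp_all add: p)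
  ultimately obtain t where t: "0 \<le> t" "t \<le> 1" "det (?p t) = 0"
    using IVT2'[of "\<lambda>t. det (?p t)" 1 0 0] by auto
  have fm: "form (?p t) v v = (1 - t) * (v \<bullet> v) + t * form m v v" for v
    unfolding p form_def by (simp add: matrix_vector_mult_add_rdistrib scaleR_matrix_vector_assoc[symmetric] inner_add_right)
  have sp: "spd (?p t)"
    unfolding spd_def
  proof (intro conjI allI impI)
    have "m $ i $ j = m $ j $ i" for i j
      using assms unfolding spd_def transpose_def vec_eq_iff by simp
    then show "transpose (?p t) = ?p t" by (simp add: vec_eq_iff transpose_def mat_delta)
    fix v :: "real^'n" assume v: "v \<noteq> 0"
    then have "form m v v > 0" "v \<bullet> v > 0" using assms by (auto simp: spd_def)
    with t(1,2) show "form (?p t) v v > 0" unfolding fm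
      by (cases "t = 0") (auto intro: add_nonneg_pos mult_pos_pos)
  qed
  show False using t(3) spd_invertible[OF sp] by (simp add: invertible_det_nz)
qed

text \<open>
  Each of the three nonnegative summands of the decay condition is bounded by their sum.
\<close>

lemma asymptotically_flat_AF_end:
  fixes g :: "('p::topological_space, 'm::finite) tensor2"
  assumes rm: "riemannian_metric \<A> g" and af: "asymptotically_flat \<A> g \<tau> K \<Psi>" and tau: "\<tau> > 0"
  shows "AF_end (g (- K, \<Psi>)) \<tau>"
proof -
  let ?c = "(- K, \<Psi>)"
  let ?g = "g ?c"
  have c: "?c \<in> \<A>" "\<Psi> ` (- K) = end_region" using af by (auto simp: asymptotically_flat_def)
  have im: "snd ?c ` fst ?c = end_region" using c by simp
  have sm: "smooth_on end_region (\<lambda>x. ?g x $ i $ j)" for i j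
    using rm c(1) im unfolding riemannian_metric_def by metis
  have tp: "transpose (?g x) = ?g x" "\<And>v. v \<noteq> 0 \<Longrightarrow> form (?g x) v v > 0" if "x \<in> end_region" for x
    using rm c(1) im that unfolding riemannian_metric_def by metis+
  interpret C2_end_metric ?g
  proof
    show "Ck_on 2 end_region (\<lambda>x. ?g x $ i $ j)" for i j using sm by (simp add: smooth_on_def)
    show "?g x $ i $ j = ?g x $ j $ i" if "x \<in> end_region" for x i j
    proof -
      have "transpose (?g x) $ j $ i = ?g x $ j $ i" by (simp only: tp(1)[OF that])
      then show ?thesis by (simp add: transpose_def)
    qed
  qed
  have bound: "f \<in> growth endF s" if "\<And>x. norm x ^ k * \<bar>f x\<bar> \<le> S x" "S \<in> o[endF](\<lambda>x. norm x powr (- \<tau>))" "s = - \<tau> - real k"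
    for f S :: "real^('m option) \<Rightarrow> real" and k s
  proof -
    have S: "S \<in> growth endF (- \<tau>)" unfolding growth_def using that(2) by (rule landau_o.small_imp_big)
    have "(\<lambda>x. norm x powr (- real k)) \<in> growth endF (- real k)" by (simp add: growth_def)
    from growth_mult[OF endF_le this S, of s] have 1: "(\<lambda>x. norm x powr (- real k) * S x) \<in> growth endF s" using that(3) by simp
    have "\<forall>\<^sub>F x in endF. norm (f x) \<le> 1 * norm (norm x powr (- real k) * S x)"
      using growth_norm_ge[OF endF_le, of 1]
    proof eventually_elim
      case (elim x)
      have "norm x powr (- real k) * (norm x ^ k * \<bar>f x\<bar>) \<le> norm x powr (- real k) * S x"
        by (rule mult_left_mono[OF that(1)]) simp
      moreover have "norm x powr (- real k) * norm x ^ k = 1"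
      proof -
        have "norm x > 0" using elim by linarith
        then show ?thesis by (simp add: powr_minus powr_realpow)
      qed
      ultimately have "\<bar>f x\<bar> \<le> norm x powr (- real k) * S x" by (simp add: mult.assoc[symmetric])
      then show ?case by simp
    qed
    then have "f \<in> O[endF](\<lambda>x. norm x powr (- real k) * S x)" by (rule bigoI)
    then show ?thesis using 1 unfolding growth_def by (rule landau_o.big_trans)
  qed
  define S where "S i j k l x = \<bar>?g x $ i $ j - mat 1 $ i $ j\<bar> + norm x * \<bar>dg k i j x\<bar> + (norm x)\<^sup>2 * \<bar>ddg l k i j x\<bar>" for i j k l x
  have S: "S i j k l \<in> o[endF](\<lambda>x. norm x powr (- \<tau>))" for i j k l
    using af unfolding asymptotically_flat_def endF_def[symmetric] S_def[abs_def] dg_def ddg_def by blast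
  show ?thesis
  proof
    show "form (?g x) v v > 0" if "x \<in> end_region" "v \<noteq> 0" for x v using tp(2)[OF that] .
    fix i j k l :: "'m option"
    show "(\<lambda>x. ?g x $ i $ j - mat 1 $ i $ j) \<in> growth endF (- \<tau>)"
      by (rule bound[OF _ S[of i j k l], where k=0]) (auto simp: S_def)
    show "dg k i j \<in> growth endF (- \<tau> - 1)"
      by (rule bound[OF _ S[of i j k l], where k=1]) (auto simp: S_def)
    show "ddg l k i j \<in> growth endF (- \<tau> - 2)"
      by (rule bound[OF _ S[of i j k l], where k=2]) (auto simp: S_def)
  qed (rule tau)
qed

lemma scalar_curvature_integrable:
  fixes g :: "('p::t2_space, 'm::finite) tensor2"
  assumes ss: "smooth_structure \<A>" and af: "asymptotically_flat \<A> g \<tau> K \<Psi>"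
    and AF: "AF_end (g (- K, \<Psi>)) \<tau>"
    and vol: "riemannian_volume \<A> g vol" and R: "is_scalar_curvature \<A> g R" "integrable vol R"
  shows "integrable lborel (\<lambda>x. indicator end_region x * (sqrt (det (g (- K, \<Psi>) x)) * AF_end.scal (g (- K, \<Psi>)) x))"
proof -
  let ?c = "(- K, \<Psi>)"
  let ?g = "g ?c"
  interpret AF_end ?g \<tau> by (rule AF)
  have c: "?c \<in> \<A>" and im: "\<Psi> ` (- K) = end_region" and K: "compact K"
    using af unfolding asymptotically_flat_def by simp_all
  have oK: "open (- K)" using K by (simp add: compact_imp_closed open_closed)
  have "is_chart ?c" using ss c unfolding smooth_structure_def by blast
  then have cont: "continuous_on (- K) \<Psi>" unfolding is_chart_def homeomorphism_def by simp
  have sv: "sets vol = sets borel" using vol by (simp add: riemannian_volume_def)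
  have U: "- K \<in> sets vol" unfolding sv using oK by simp
  have E: "end_region \<in> sets (borel :: (real^('m option)) measure)"
  proof -
    have "is_cone (half_space :: (real^('m option)) set)" by (rule is_cone_half_space)
    then show ?thesis unfolding end_region_def is_cone_def by (intro sets.Diff borel_closed) simp_all
  qed
  have wcont: "continuous_on end_region (\<lambda>x. sqrt (det (?g x)))"
    by (intro continuous_on_real_sqrt continuous_on_det g_cont)
  show ?thesis
  proof (rule integrable_transfer[where M=vol and U="- K" and \<Phi>=\<Psi> and R=R])
    have "\<Psi> \<in> borel_measurable (restrict_space borel (- K))"
      by (rule borel_measurable_continuous_on_restrict[OF cont])
    then show \<Psi>m: "\<Psi> \<in> borel_measurable (restrict_space vol (- K))"
      by (subst measurable_cong_sets[OF sets_restrict_space_cong[OF sv] refl])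
    show "(\<lambda>x. indicator end_region x * sqrt (det (?g x))) \<in> borel_measurable borel"
      using borel_measurable_continuous_on_indicator[OF E wcont] by simp
    show "(\<lambda>x. indicator end_region x * scal x) \<in> borel_measurable borel"
      using borel_measurable_continuous_on_indicator[OF E scal_cont] by simp
    show "sqrt (det (?g x)) \<ge> 0" if "x \<in> end_region" for x
      using spd_det_pos[OF spd_g[OF that]] by simp
    show "emeasure vol (\<Psi> -` A \<inter> - K) = (\<integral>\<^sup>+x\<in>A \<inter> end_region. ennreal (sqrt (det (?g x))) \<partial>lborel)"
      if A: "A \<in> sets borel" for A
    proof -
      have "\<Psi> -` A \<inter> space (restrict_space vol (- K)) \<in> sets (restrict_space vol (- K))"
        by (rule measurable_sets[OF \<Psi>m A])
      moreover have "- K \<inter> space vol \<in> sets vol" using U by auto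
      ultimately have B: "\<Psi> -` A \<inter> - K \<in> sets vol"
        using sets.sets_into_space[OF U] by (subst (asm) sets_restrict_space_iff) (auto simp: space_restrict_space Int_absorb2)
      have "\<Psi> ` (\<Psi> -` A \<inter> - K) = A \<inter> end_region" unfolding im[symmetric] by blast
      moreover have "emeasure vol (\<Psi> -` A \<inter> - K) = (\<integral>\<^sup>+x\<in>snd ?c ` (\<Psi> -` A \<inter> - K). ennreal (sqrt (det (g ?c x))) \<partial>lborel)"
        by (rule vol[unfolded riemannian_volume_def, THEN conjunct2, rule_format, OF c B]) simp
      ultimately show ?thesis by simp
    qed
    show "\<Psi> p \<in> end_region \<and> R p = scal (\<Psi> p)" if "p \<in> - K" for p
    proof
      show e: "\<Psi> p \<in> end_region" using im that by auto
      have "R p = scalar_curv (snd ?c ` fst ?c) (g ?c) (snd ?c p)"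
        using R(1) c that unfolding is_scalar_curvature_def by (metis fst_conv)
      then show "R p = scal (\<Psi> p)" using im scalar_curv_eq[OF e] by simp
    qed
  qed (use U E R in auto)
qed

text \<open>
  The set \<open>U\<close> of points of the end with \<open>x\<^sub>1 = 0\<close> lies in the boundary of the manifold because the chart
  of the end belongs to the atlas.  On \<open>U\<close>, the remaining coordinates \<open>\<Phi>\<close> form a chart onto the exterior of
  the unit ball in the hyperplane.
\<close>

lemma mean_curvature_integrable:
  fixes g :: "('p::t2_space, 'm::finite) tensor2"
  assumes ss: "smooth_structure \<A>" and af: "asymptotically_flat \<A> g \<tau> K \<Psi>"
    and AF: "AF_end (g (- K, \<Psi>)) \<tau>"
    and area: "boundary_volume \<A> g area" and H: "is_boundary_mean_curvature \<A> g H" "integrable area H"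
  shows "integrable lborel (\<lambda>y. indicator (- cball 0 1) y * 
     (sqrt (det (tang (g (- K, \<Psi>) (bdry_pt y)))) * AF_end.mc (g (- K, \<Psi>)) (bdry_pt y)))"
proof -
  let ?c = "(- K, \<Psi>)"
  let ?g = "g ?c"
  interpret AF_end ?g \<tau> by (rule AF)
  have c: "?c \<in> \<A>" and im: "\<Psi> ` (- K) = end_region" and K: "compact K"
    using af unfolding asymptotically_flat_def by simp_all
  have oK: "open (- K)" using K by (simp add: compact_imp_closed open_closed)
  have "is_chart ?c" using ss c unfolding smooth_structure_def by blast
  then have cont: "continuous_on (- K) \<Psi>" unfolding is_chart_def homeomorphism_def by simp
  have sv: "sets area = sets (restrict_space borel (boundary \<A>))" using area by (simp add: boundary_volume_def)
  define U where "U = {p. p \<in> - K \<and> \<Psi> p $ None = 0}"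
  define \<Phi> where "\<Phi> p = (\<chi> a. \<Psi> p $ Some a)" for p
  have UK: "U \<subseteq> - K" by (auto simp: U_def)
  have Ub: "U \<subseteq> boundary \<A>" by (auto simp: U_def boundary_def intro!: bexI[OF _ c])
  have \<Phi>b: "\<Psi> p = bdry_pt (\<Phi> p)" if "p \<in> U" for p
    using that by (auto simp: vec_eq_iff split_option_all \<Phi>_def U_def)
  have \<Phi>E: "\<Phi> p \<in> - cball 0 1" if "p \<in> U" for p
  proof -
    have "\<Psi> p \<in> \<Psi> ` (- K)" using that UK by blast
    then have "bdry_pt (\<Phi> p) \<in> end_region" by (simp only: im \<Phi>b[OF that])
    then show ?thesis by (simp add: end_region_def)
  qed
  have Uo: "U \<in> sets borel"
  proof -
    have "(\<lambda>p. \<Psi> p $ None) \<in> borel_measurable (restrict_space borel (- K))"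
      by (rule borel_measurable_continuous_on_restrict) (intro continuous_intros cont)
    from measurable_sets[OF this, of "{0}"] 
    have "(\<lambda>p. \<Psi> p $ None) -` {0} \<inter> space (restrict_space borel (- K)) \<in> sets (restrict_space borel (- K))" by simp
    then have "(\<lambda>p. \<Psi> p $ None) -` {0} \<inter> space (restrict_space borel (- K)) \<in> sets borel"
      using oK by (subst (asm) sets_restrict_space_iff) auto
    moreover have "(\<lambda>p. \<Psi> p $ None) -` {0} \<inter> space (restrict_space borel (- K)) = U"
      by (auto simp: space_restrict_space U_def)
    ultimately show ?thesis by simp
  qed
  have inA: "B \<in> sets area" if "B \<in> sets borel" "B \<subseteq> U" for B
    unfolding sv sets_restrict_space using that Ub by (auto intro!: image_eqI[of _ _ B])
  have U: "U \<in> sets area" by (rule inA[OF Uo]) simp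
  have \<Phi>o: "\<Phi> -` A \<inter> U \<in> sets borel" if "A \<in> sets borel" for A
  proof -
    have "continuous_on U \<Phi>" unfolding \<Phi>_def
      by (rule continuous_on_vec_lambda) (intro continuous_intros continuous_on_subset[OF cont UK])
    then have "\<Phi> \<in> borel_measurable (restrict_space borel U)" by (rule borel_measurable_continuous_on_restrict)
    from measurable_sets[OF this that] show ?thesis
      using Uo by (subst (asm) sets_restrict_space_iff) (auto simp: space_restrict_space)
  qed
  have spU: "space (restrict_space area U) = U"
    using sets.sets_into_space[OF U] by (auto simp: space_restrict_space)
  have E: "- cball 0 1 \<in> sets (borel :: (real^'m) measure)" by simp
  show ?thesis
  proof (rule integrable_transfer[where M=area and U=U and \<Phi>=\<Phi> and R=H])
    show "\<Phi> \<in> borel_measurable (restrict_space area U)"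
    proof (rule measurableI)
      fix A :: "(real^'m) set" assume A: "A \<in> sets borel"
      have "\<Phi> -` A \<inter> U \<in> sets area" by (rule inA[OF \<Phi>o[OF A]]) simp
      then show "\<Phi> -` A \<inter> space (restrict_space area U) \<in> sets (restrict_space area U)"
        unfolding spU using U by (subst sets_restrict_space_iff) auto
    qed simp
    show "(\<lambda>y. indicator (- cball 0 1) y * sqrt (det (tang (?g (bdry_pt y))))) \<in> borel_measurable borel"
      using borel_measurable_continuous_on_indicator[OF E continuous_on_real_sqrt[OF continuous_on_det[OF bdry_cont[OF tang_cont]]]] by simp
    show "(\<lambda>y. indicator (- cball 0 1) y * mc (bdry_pt y)) \<in> borel_measurable borel"
      using borel_measurable_continuous_on_indicator[OF E bdry_cont[OF mc_cont]] by simp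
    show "sqrt (det (tang (?g (bdry_pt y)))) \<ge> 0" if "y \<in> - cball 0 1" for y
      using spd_det_pos[OF spd_tang[OF bdry_pt_in_end_region[OF that]]] by simp
    show "emeasure area (\<Phi> -` A \<inter> U) = (\<integral>\<^sup>+y\<in>A \<inter> - cball 0 1. ennreal (sqrt (det (tang (?g (bdry_pt y))))) \<partial>lborel)"
      if A: "A \<in> sets borel" for A
    proof -
      have B: "\<Phi> -` A \<inter> U \<in> sets area" by (rule inA[OF \<Phi>o[OF A]]) simp
      have BK: "\<Phi> -` A \<inter> U \<subseteq> fst ?c" using UK by auto
      have "{y. bdry_pt y \<in> \<Psi> ` (\<Phi> -` A \<inter> U)} = A \<inter> - cball 0 1"
      proof (intro set_eqI iffI)
        fix y :: "real^'m" assume "y \<in> {y. bdry_pt y \<in> \<Psi> ` (\<Phi> -` A \<inter> U)}"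
        then obtain p where p: "bdry_pt y = \<Psi> p" "\<Phi> p \<in> A" "p \<in> U" by auto
        then have "y = \<Phi> p" by (simp add: \<Phi>_def vec_eq_iff flip: p(1))
        then show "y \<in> A \<inter> - cball 0 1" using p \<Phi>E by auto
      next
        fix y :: "real^'m" assume y: "y \<in> A \<inter> - cball 0 1"
        then have "bdry_pt y \<in> \<Psi> ` (- K)" unfolding im by (intro bdry_pt_in_end_region) simp
        then obtain p where p: "bdry_pt y = \<Psi> p" "p \<in> - K" by auto
        then have "p \<in> U" by (simp add: U_def flip: p(1))
        moreover have "\<Phi> p = y" by (simp add: \<Phi>_def vec_eq_iff flip: p(1))
        ultimately show "y \<in> {y. bdry_pt y \<in> \<Psi> ` (\<Phi> -` A \<inter> U)}" using p y by auto
      qed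
      moreover have "emeasure area (\<Phi> -` A \<inter> U) = 
         (\<integral>\<^sup>+y\<in>{y. bdry_pt y \<in> snd ?c ` (\<Phi> -` A \<inter> U)}. ennreal (sqrt (det (tang (g ?c (bdry_pt y))))) \<partial>lborel)"
        using area c B BK unfolding boundary_volume_def by blast
      ultimately show ?thesis by simp
    qed
    show "\<Phi> p \<in> - cball 0 1 \<and> H p = mc (bdry_pt (\<Phi> p))" if "p \<in> U" for p
    proof
      show e: "\<Phi> p \<in> - cball 0 1" by (rule \<Phi>E[OF that])
      have "p \<in> fst ?c \<inter> boundary \<A>" using that UK Ub by auto
      then have "H p = mean_curv (snd ?c ` fst ?c) (g ?c) (snd ?c p)"
        using H(1) c unfolding is_boundary_mean_curvature_def by blast
      then show "H p = mc (bdry_pt (\<Phi> p))"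
        using im \<Phi>b[OF that] mean_curv_eq[OF bdry_pt_in_end_region[OF e]] by simp
    qed
  qed (use U E H in auto)
qed

theorem theorem2:
  fixes \<A> :: "('p::{t2_space,second_countable_topology}, 'm::finite) chart set"
    and g :: "('p, 'm) tensor2"
    and \<tau> :: real and K :: "'p set" and \<Psi> :: "'p \<Rightarrow> real^('m option)"
    and R H :: "'p \<Rightarrow> real" and vol area :: "'p measure"
  defines "n \<equiv> real CARD('m option)"
  assumes "n \<ge> 3"
    and "smooth_structure \<A>" and "riemannian_metric \<A> g" and "\<not> compact (boundary \<A>)"
    and "asymptotically_flat \<A> g \<tau> K \<Psi>" and "\<tau> > (n - 2) / 2"
    and "riemannian_volume \<A> g vol" and "boundary_volume \<A> g area"
    and "is_scalar_curvature \<A> g R" and "integrable vol R"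
    and "is_boundary_mean_curvature \<A> g H" and "integrable area H"
  shows "(adm_flux (g (- K, \<Psi>)) \<longlongrightarrow> adm_mass (g (- K, \<Psi>))) at_top \<and>
    (\<exists>L. (einstein_flux (g (- K, \<Psi>)) \<longlongrightarrow> L) at_top \<and>
      adm_mass (g (- K, \<Psi>)) =
        - (1 / ((n - 2) * (n - 1) * unit_sphere_vol TYPE(real^('m option)))) * L)"
proof -
  have n: "n = real CARD('m) + 1" by (simp add: n_def)
  have tau2: "2 * \<tau> > real CARD('m) - 1" using assms(7) by (simp add: n)
  have tau: "\<tau> > 0" using assms(2) tau2 n by simp
  have AF: "AF_end (g (- K, \<Psi>)) \<tau>" by (rule asymptotically_flat_AF_end[OF assms(4,6) tau])
  interpret AF_end "g (- K, \<Psi>)" \<tau> by (rule AF)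
  let ?g = "g (- K, \<Psi>)"
  let ?\<omega> = "unit_sphere_vol TYPE(real^('m option))"
  obtain m where m: "(mass_flux \<longlongrightarrow> m) at_top"
    using mass_flux_convergent[OF tau2 scalar_curvature_integrable[OF assms(3,6) AF assms(8,10,11)]
        mean_curvature_integrable[OF assms(3,6) AF assms(9,12,13)]] by blast
  let ?b = "1 / (2 * (n - 1) * ?\<omega>)"
  have adm: "(adm_flux ?g \<longlongrightarrow> ?b * m) at_top"
  proof -
    have "adm_flux ?g = (\<lambda>r. ?b * mass_flux r)" by (rule ext) (simp add: adm_flux_eq n)
    then show ?thesis using tendsto_mult_left[OF m, of ?b] by simp
  qed
  then have mass: "adm_mass ?g = ?b * m" unfolding adm_mass_def by (intro tendsto_Lim) auto
  let ?L = "- (n - 2) / 2 * m"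
  have "((\<lambda>r. (einstein_flux ?g r + (real CARD('m) - 1) / 2 * mass_flux r) - (real CARD('m) - 1) / 2 * mass_flux r)
      \<longlongrightarrow> 0 - (real CARD('m) - 1) / 2 * m) at_top"
    by (intro tendsto_diff einstein_flux_asymp[OF tau2] tendsto_mult_left m)
  moreover have "0 - (real CARD('m) - 1) / 2 * m = ?L" by (simp add: n field_simps)
  ultimately have ein: "(einstein_flux ?g \<longlongrightarrow> ?L) at_top" by (simp only: add_diff_cancel_right')
  have "?b * m = - (1 / ((n - 2) * (n - 1) * ?\<omega>)) * ?L"
  proof -
    have "1 / (2 * b * w) * m = - (1 / (a * b * w)) * (- a / 2 * m)" if "a \<noteq> 0" for a b w :: real
      using that by (cases "b = 0"; cases "w = 0") (auto simp: field_simps)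
    moreover have "n - 2 \<noteq> 0" using assms(2) by simp
    ultimately show ?thesis by blast
  qed
  with adm ein mass show ?thesis by metis
qed

end
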